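(* Let $M$ be a connected complete noncompact Riemannian manifold of infinite volume with $b>0$, positive injectivity radius and Ricci tensor bounded from below. For every $g\in BMO(M)$ and every positive integer $k$, any solution $U_{k,g}\in L^2_{\mathrm{loc}}(M)$ of the equation $\mathcal{L}^ku=g$ is in $GBMO^k(M)$, and $$\|U_{k,g}\|_{GBMO^k}\le\|\mathcal{L}^{-k}\|_{L^2(M)\to L^2(M)}\,\|g\|_{BMO}.$$
   Context: $\mu$ is the Riemannian measure of $M$, $\mathcal{L}$ is minus the Laplace--Beltrami operator (self-adjoint on $L^2(M)$, also extended to distributions), $b$ is the bottom of the $L^2(M)$-spectrum of $\mathcal{L}$; since $b>0$, $\mathcal{L}^{-k}$ is bounded on $L^2(M)$. $\mathrm{Inj}(M)$ is the injectivity radius; $\mathcal{B}_s$ is the family of all (open) geodesic balls of radius at most $s$. Set $s_0=\tfrac12\mathrm{Inj}(M)$ (if $\mathrm{Inj}(M)=\infty$, $s_0$ is any fixed positive number). $BMO(M)$ is the space of all locally integrable functions $g$ such that $$\|g\|_{BMO}=\sup_{B\in\mathcal{B}_{s_0}}\inf_{c\in\mathbb{C}}\Big(\frac1{\mu(B)}\int_B|g-c|^2\,d\mu\Big)^{1/2}<\infty .$$ For a ball $B$, $q_k^2(B)$ is the space of all $v\in L^2(B)$ such that $\mathcal{L}^kv$ is constant on $B$ (in the sense of distributions), and $q_k^2(B)^\perp$ is its orthogonal complement in $L^2(B)$. For $G\in L^2_{\mathrm{loc}}(M)$, $\pi_{B,k}(G)$ denotes the orthogonal projection of $G|_B\in L^2(B)$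 onto $q_k^2(B)^\perp$. $GBMO^k(M)$ is the vector space of all $G\in L^2_{\mathrm{loc}}(M)$ such that $$\|G\|_{GBMO^k}=\sup_{B\in\mathcal{B}_{s_0}}\mu(B)^{-1/2}\|\pi_{B,k}(G)\|_2<\infty .$$ *)

theory Defs
  imports "HOL-Analysis.Analysis"
begin

section \<open>Smooth functions on open subsets of Euclidean space\<close>

definition partial :: "'n::finite \<Rightarrow> (real^'n \<Rightarrow> 'b::real_normed_vector) \<Rightarrow> real^'n \<Rightarrow> 'b" where
  "partial i f x = frechet_derivative f (at x) (axis i 1)"

fun Ck_on :: "nat \<Rightarrow> (real^'n::finite) set \<Rightarrow> (real^'n \<Rightarrow> 'b::real_normed_vector) \<Rightarrow> bool" where
  "Ck_on 0 S f \<longleftrightarrow> continuous_on S f"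
| "Ck_on (Suc k) S f \<longleftrightarrow> f differentiable_on S \<and> (\<forall>i. Ck_on k S (partial i f))"

text \<open>Only meaningful (and only used) for open \<open>S\<close>.\<close>

definition smooth_on :: "(real^'n::finite) set \<Rightarrow> (real^'n \<Rightarrow> 'b::real_normed_vector) \<Rightarrow> bool" where
  "smooth_on S f \<longleftrightarrow> (\<forall>k. Ck_on k S f)"


section \<open>Riemannian manifolds\<close>

text \<open>
  The points of the manifold are all the elements of a type \<open>'a\<close>, and the manifold is
  \<open>n\<close>-dimensional with \<open>n = CARD('n)\<close>.  A chart is a pair \<open>(V, x)\<close> of a coordinate domain and a
  coordinate map, only the values of \<open>x\<close> on \<open>V\<close> being relevant.  The metric tensor is given by its
  coefficient matrix in each chart, as a function of the coordinates.  The component \<open>vol\<close> is the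
  Riemannian measure, on the Borel sets.
\<close>

type_synonym ('a, 'n) chart = "'a set \<times> ('a \<Rightarrow> real^'n)"

record ('a, 'n) riem =
  charts :: "('a, 'n) chart set"
  gmat :: "('a, 'n) chart \<Rightarrow> real^'n \<Rightarrow> real^'n^'n"
  vol :: "'a measure"

definition chart_inv :: "('a, 'n::finite) chart \<Rightarrow> real^'n \<Rightarrow> 'a" where
  "chart_inv c = inv_into (fst c) (snd c)"

text \<open>A choice of a chart around a point; used only where the chart is immaterial.\<close>

definition chart_at :: "('a, 'n::finite) riem \<Rightarrow> 'a \<Rightarrow> ('a, 'n) chart" where
  "chart_at M p = (SOME c. c \<in> charts M \<and> p \<in> fst c)"

definition smooth_atlas :: "('a::topological_space, 'n::finite) chart set \<Rightarrow> bool" where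
  "smooth_atlas A \<longleftrightarrow>
     (\<Union>c\<in>A. fst c) = UNIV \<and>
     (\<forall>c\<in>A. open (fst c) \<and> open (snd c ` fst c) \<and>
        homeomorphism (fst c) (snd c ` fst c) (snd c) (chart_inv c)) \<and>
     (\<forall>c\<in>A. \<forall>d\<in>A. smooth_on (snd c ` (fst c \<inter> fst d)) (snd d \<circ> chart_inv c))"

definition riemannian_metric :: "('a::topological_space, 'n::finite) riem \<Rightarrow> bool" where
  "riemannian_metric M \<longleftrightarrow>
     (\<forall>c\<in>charts M. smooth_on (snd c ` fst c) (gmat M c) \<and>
        (\<forall>x\<in>snd c ` fst c. transpose (gmat M c x) = gmat M c x \<and>
           (\<forall>v. v \<noteq> 0 \<longrightarrow> v \<bullet> (gmat M c x *v v) > 0))) \<and>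
     (\<forall>c\<in>charts M. \<forall>d\<in>charts M. \<forall>p\<in>fst c \<inter> fst d.
        (let J = jacobian (snd d \<circ> chart_inv c) (at (snd c p)) in
          gmat M c (snd c p) = transpose J ** gmat M d (snd d p) ** J))"

definition is_riemannian_measure :: "('a::topological_space, 'n::finite) riem \<Rightarrow> bool" where
  "is_riemannian_measure M \<longleftrightarrow>
     sets (vol M) = sets borel \<and>
     (\<forall>c\<in>charts M. \<forall>E\<in>sets borel. E \<subseteq> fst c \<longrightarrow>
        emeasure (vol M) E = (\<integral>\<^sup>+x\<in>snd c ` E. ennreal (sqrt (det (gmat M c x))) \<partial>lborel))"


subsection \<open>Riemannian distance\<close>

text \<open>The length of the tangent vector with coordinates \<open>v\<close> at the point with coordinates \<open>x\<close>.\<close>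

definition tangent_norm :: "('a, 'n::finite) riem \<Rightarrow> ('a, 'n) chart \<Rightarrow> real^'n \<Rightarrow> real^'n \<Rightarrow> real" where
  "tangent_norm M c x v = sqrt (v \<bullet> (gmat M c x *v v))"

definition piecewise_C1_curve :: "('a::topological_space, 'n::finite) riem \<Rightarrow> (real \<Rightarrow> 'a) \<Rightarrow> bool" where
  "piecewise_C1_curve M \<gamma> \<longleftrightarrow>
     continuous_on {0..1} \<gamma> \<and>
     (\<exists>F. finite F \<and> (\<forall>c\<in>charts M.
        (snd c \<circ> \<gamma>) C1_differentiable_on ({t \<in> {0<..<1}. \<gamma> t \<in> fst c} - F)))"

definition curve_length :: "('a::topological_space, 'n::finite) riem \<Rightarrow> (real \<Rightarrow> 'a) \<Rightarrow> ennreal" where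
  "curve_length M \<gamma> =
     (\<integral>\<^sup>+t\<in>{0..1}. ennreal (let c = chart_at M (\<gamma> t) in
        tangent_norm M c (snd c (\<gamma> t)) (vector_derivative (snd c \<circ> \<gamma>) (at t))) \<partial>lborel)"

definition riemannian_distance :: "('a::topological_space, 'n::finite) riem \<Rightarrow> 'a \<Rightarrow> 'a \<Rightarrow> ennreal" where
  "riemannian_distance M p q =
     (INF \<gamma>\<in>{\<gamma>. piecewise_C1_curve M \<gamma> \<and> \<gamma> 0 = p \<and> \<gamma> 1 = q}. curve_length M \<gamma>)"

text \<open>
  The metric space structure of \<open>'a\<close> is the one given by the Riemannian distance, which always
  induces the manifold topology.  So \<open>ball p r\<close> is the geodesic ball, and \<open>complete\<close>, \<open>compact\<close>,
  \<open>connected\<close> have their usual meaning for the Riemannian manifold.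
\<close>

definition riemannian_manifold ::
    "('a::{metric_space,second_countable_topology}, 'n::finite) riem \<Rightarrow> bool" where
  "riemannian_manifold M \<longleftrightarrow>
     smooth_atlas (charts M) \<and> riemannian_metric M \<and> is_riemannian_measure M \<and>
     (\<forall>p q. ennreal (dist p q) = riemannian_distance M p q)"


subsection \<open>Ricci curvature\<close>

definition ginv :: "('a, 'n::finite) riem \<Rightarrow> ('a, 'n) chart \<Rightarrow> real^'n \<Rightarrow> real^'n^'n" where
  "ginv M c x = matrix_inv (gmat M c x)"

text \<open>\<open>christoffel M c k i j\<close> is the symbol with upper index \<open>k\<close> and lower indices \<open>i\<close>, \<open>j\<close>.\<close>

definition christoffel ::
    "('a, 'n::finite) riem \<Rightarrow> ('a, 'n) chart \<Rightarrow> 'n \<Rightarrow> 'n \<Rightarrow> 'n \<Rightarrow> real^'n \<Rightarrow> real" where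
  "christoffel M c k i j x = (1/2) * (\<Sum>l\<in>UNIV. ginv M c x $ k $ l *
     (partial i (\<lambda>y. gmat M c y $ j $ l) x + partial j (\<lambda>y. gmat M c y $ i $ l) x
      - partial l (\<lambda>y. gmat M c y $ i $ j) x))"

definition ricci :: "('a, 'n::finite) riem \<Rightarrow> ('a, 'n) chart \<Rightarrow> real^'n \<Rightarrow> real^'n^'n" where
  "ricci M c x = (\<chi> i j.
     (\<Sum>k\<in>UNIV. partial k (christoffel M c k i j) x - partial j (christoffel M c k i k) x
        + (\<Sum>l\<in>UNIV. christoffel M c k k l x * christoffel M c l i j x
                   - christoffel M c k j l x * christoffel M c l i k x)))"

definition ricci_bounded_below :: "('a, 'n::finite) riem \<Rightarrow> bool" where
  "ricci_bounded_below M \<longleftrightarrow> (\<exists>\<kappa>::real. \<forall>c\<in>charts M. \<forall>x\<in>snd c ` fst c. \<forall>v.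
     v \<bullet> (ricci M c x *v v) \<ge> \<kappa> * (v \<bullet> (gmat M c x *v v)))"


subsection \<open>Injectivity radius\<close>

text \<open>Geodesics defined on the whole real line (all maximal ones are, in the complete case).\<close>

definition geodesic :: "('a::topological_space, 'n::finite) riem \<Rightarrow> (real \<Rightarrow> 'a) \<Rightarrow> bool" where
  "geodesic M \<gamma> \<longleftrightarrow>
     continuous_on UNIV \<gamma> \<and>
     (\<forall>c\<in>charts M. \<forall>t. \<gamma> t \<in> fst c \<longrightarrow>
        (let \<sigma> = snd c \<circ> \<gamma>; \<sigma>' = (\<lambda>s. vector_derivative \<sigma> (at s)) in
           \<sigma> differentiable (at t) \<and>
           (\<sigma>' has_vector_derivative
              (\<chi> k. - (\<Sum>i\<in>UNIV. \<Sum>j\<in>UNIV. christoffel M c k i j (\<sigma> t) * \<sigma>' t $ i * \<sigma>' t $ j))) (at t)))"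

text \<open>
  The exponential map at \<open>p\<close> of a complete manifold.  The tangent space at \<open>p\<close> is identified with
  \<open>real^'n\<close> by means of the chart \<open>chart_at M p\<close>.
\<close>

definition riem_exp :: "('a::topological_space, 'n::finite) riem \<Rightarrow> 'a \<Rightarrow> real^'n \<Rightarrow> 'a" where
  "riem_exp M p v = (THE \<gamma>. geodesic M \<gamma> \<and> \<gamma> 0 = p \<and>
     ((snd (chart_at M p) \<circ> \<gamma>) has_vector_derivative v) (at 0)) 1"

definition diffeo_onto_image ::
    "('a::topological_space, 'n::finite) riem \<Rightarrow> (real^'n) set \<Rightarrow> (real^'n \<Rightarrow> 'a) \<Rightarrow> bool" where
  "diffeo_onto_image M S f \<longleftrightarrow>
     open S \<and> continuous_on S f \<and> inj_on f S \<and> open (f ` S) \<and>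
     (\<forall>c\<in>charts M. smooth_on {v \<in> S. f v \<in> fst c} (snd c \<circ> f) \<and>
        smooth_on (snd c ` (fst c \<inter> f ` S)) (inv_into S f \<circ> chart_inv c))"

definition inj_radius_at :: "('a::topological_space, 'n::finite) riem \<Rightarrow> 'a \<Rightarrow> ereal" where
  "inj_radius_at M p = Sup (ereal ` {r. 0 < r \<and>
     diffeo_onto_image M {v. tangent_norm M (chart_at M p) (snd (chart_at M p) p) v < r} (riem_exp M p)})"

definition inj_radius :: "('a::topological_space, 'n::finite) riem \<Rightarrow> ereal" where
  "inj_radius M = (INF p. inj_radius_at M p)"


section \<open>Laplace--Beltrami operator and distributions\<close>

definition smooth_fun :: "('a, 'n::finite) riem \<Rightarrow> ('a \<Rightarrow> complex) \<Rightarrow> bool" where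
  "smooth_fun M f \<longleftrightarrow> (\<forall>c\<in>charts M. smooth_on (snd c ` fst c) (f \<circ> chart_inv c))"

definition test_functions :: "('a::topological_space, 'n::finite) riem \<Rightarrow> 'a set \<Rightarrow> ('a \<Rightarrow> complex) set" where
  "test_functions M S = {\<phi>. smooth_fun M \<phi> \<and>
     compact (closure {p. \<phi> p \<noteq> 0}) \<and> closure {p. \<phi> p \<noteq> 0} \<subseteq> S}"

definition laplace_beltrami_coord ::
    "('a, 'n::finite) riem \<Rightarrow> ('a, 'n) chart \<Rightarrow> (real^'n \<Rightarrow> complex) \<Rightarrow> real^'n \<Rightarrow> complex" where
  "laplace_beltrami_coord M c F x = (1 / sqrt (det (gmat M c x))) *\<^sub>R
     (\<Sum>i\<in>UNIV. partial i (\<lambda>y. sqrt (det (gmat M c y)) *\<^sub>R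
        (\<Sum>j\<in>UNIV. (ginv M c y $ i $ j) *\<^sub>R partial j F y)) x)"

text \<open>Minus the Laplace--Beltrami operator, on smooth functions.\<close>

definition lap :: "('a, 'n::finite) riem \<Rightarrow> ('a \<Rightarrow> complex) \<Rightarrow> 'a \<Rightarrow> complex" where
  "lap M f p = (let c = chart_at M p in - laplace_beltrami_coord M c (f \<circ> chart_inv c) (snd c p))"

type_synonym 'a distribution = "('a \<Rightarrow> complex) \<Rightarrow> complex"

definition distr_of :: "('a, 'n::finite) riem \<Rightarrow> ('a \<Rightarrow> complex) \<Rightarrow> 'a distribution" where
  "distr_of M u = (\<lambda>\<phi>. LINT p|vol M. u p * \<phi> p)"

definition lap_distr :: "('a, 'n::finite) riem \<Rightarrow> 'a distribution \<Rightarrow> 'a distribution" where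
  "lap_distr M T = (\<lambda>\<phi>. T (lap M \<phi>))"

definition distr_eq_on ::
    "('a::topological_space, 'n::finite) riem \<Rightarrow> 'a set \<Rightarrow> 'a distribution \<Rightarrow> 'a distribution \<Rightarrow> bool" where
  "distr_eq_on M S T T' \<longleftrightarrow> (\<forall>\<phi>\<in>test_functions M S. T \<phi> = T' \<phi>)"


section \<open>The operator on square-integrable functions\<close>

text \<open>
  Elements of \<open>L\<^sup>2\<close> are represented by measurable functions, and equality in \<open>L\<^sup>2\<close> is equality almost
  everywhere.  Norms are extended nonnegative reals.
\<close>

definition enn_sqrt :: "ennreal \<Rightarrow> ennreal" where
  "enn_sqrt x = (if x = \<infinity> then \<infinity> else ennreal (sqrt (enn2real x)))"

definition L2_norm :: "'a measure \<Rightarrow> ('a \<Rightarrow> complex) \<Rightarrow> ennreal" where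
  "L2_norm N f = enn_sqrt (\<integral>\<^sup>+p. ennreal ((cmod (f p))\<^sup>2) \<partial>N)"

definition L2 :: "'a measure \<Rightarrow> ('a \<Rightarrow> complex) set" where
  "L2 N = {f. f \<in> borel_measurable N \<and> L2_norm N f < \<infinity>}"

text \<open>
  The graph of the self-adjoint operator on \<open>L\<^sup>2(M)\<close>: its domain consists of all \<open>u \<in> L\<^sup>2(M)\<close> whose
  distributional image is in \<open>L\<^sup>2(M)\<close>.  For complete \<open>M\<close> the operator on test functions is
  essentially self-adjoint, so that this maximal realization is also the closure of the operator
  on test functions and its only self-adjoint extension.
\<close>

definition lap_L2 :: "('a::topological_space, 'n::finite) riem \<Rightarrow> ('a \<Rightarrow> complex) \<Rightarrow> ('a \<Rightarrow> complex) \<Rightarrow> bool" where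
  "lap_L2 M u h \<longleftrightarrow> u \<in> L2 (vol M) \<and> h \<in> L2 (vol M) \<and>
     distr_eq_on M UNIV (lap_distr M (distr_of M u)) (distr_of M h)"

text \<open>
  \<open>z\<close> is in the resolvent set if the operator minus \<open>z\<close> is a bijection from its domain onto
  \<open>L\<^sup>2(M)\<close> with bounded inverse.
\<close>

definition L2_resolvent_set :: "('a::topological_space, 'n::finite) riem \<Rightarrow> complex set" where
  "L2_resolvent_set M = {z.
     (\<forall>u. lap_L2 M u (\<lambda>p. z * u p) \<longrightarrow> (AE p in vol M. u p = 0)) \<and>
     (\<forall>f\<in>L2 (vol M). \<exists>u. lap_L2 M u (\<lambda>p. z * u p + f p)) \<and>
     (\<exists>C::real. \<forall>f\<in>L2 (vol M). \<forall>u. lap_L2 M u (\<lambda>p. z * u p + f p) \<longrightarrow>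
        L2_norm (vol M) u \<le> ennreal C * L2_norm (vol M) f)}"

definition L2_spectrum :: "('a::topological_space, 'n::finite) riem \<Rightarrow> complex set" where
  "L2_spectrum M = - L2_resolvent_set M"

definition spectral_bottom :: "('a::topological_space, 'n::finite) riem \<Rightarrow> ereal" where
  "spectral_bottom M = Inf {ereal r | r. complex_of_real r \<in> L2_spectrum M}"

text \<open>The inverse on \<open>L\<^sup>2(M)\<close>; the values are determined almost everywhere if \<open>0\<close> is not in the spectrum.\<close>

definition lap_inv :: "('a::topological_space, 'n::finite) riem \<Rightarrow> ('a \<Rightarrow> complex) \<Rightarrow> 'a \<Rightarrow> complex" where
  "lap_inv M f = (SOME u. lap_L2 M u f)"

definition L2_opnorm :: "'a measure \<Rightarrow> (('a \<Rightarrow> complex) \<Rightarrow> ('a \<Rightarrow> complex)) \<Rightarrow> ennreal" where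
  "L2_opnorm N T = (SUP f\<in>{f \<in> L2 N. L2_norm N f \<le> 1}. L2_norm N (T f))"


section \<open>The function spaces\<close>

definition L1_loc :: "('a::topological_space, 'n::finite) riem \<Rightarrow> ('a \<Rightarrow> complex) set" where
  "L1_loc M = {f \<in> borel_measurable (vol M). \<forall>K. compact K \<longrightarrow> set_integrable (vol M) K f}"

definition L2_loc :: "('a::topological_space, 'n::finite) riem \<Rightarrow> ('a \<Rightarrow> complex) set" where
  "L2_loc M = {f \<in> borel_measurable (vol M). \<forall>K. compact K \<longrightarrow> f \<in> L2 (restrict_space (vol M) K)}"

definition balls_upto :: "real \<Rightarrow> 'a::metric_space set set" where
  "balls_upto s = {ball p r | p r. 0 < r \<and> r \<le> s}"

definition BMO_norm :: "real \<Rightarrow> ('a::metric_space, 'n::finite) riem \<Rightarrow> ('a \<Rightarrow> complex) \<Rightarrow> ennreal" where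
  "BMO_norm s M g = (SUP B\<in>balls_upto s. INF c::complex.
     enn_sqrt ((\<integral>\<^sup>+p\<in>B. ennreal ((cmod (g p - c))\<^sup>2) \<partial>vol M) / emeasure (vol M) B))"

definition BMO :: "real \<Rightarrow> ('a::metric_space, 'n::finite) riem \<Rightarrow> ('a \<Rightarrow> complex) set" where
  "BMO s M = {g \<in> L1_loc M. BMO_norm s M g < \<infinity>}"

text \<open>Below, functions in \<open>L\<^sup>2(B)\<close> are functions on all of \<open>'a\<close> whose values outside \<open>B\<close> are ignored.\<close>

definition q2 :: "('a::topological_space, 'n::finite) riem \<Rightarrow> nat \<Rightarrow> 'a set \<Rightarrow> ('a \<Rightarrow> complex) set" where
  "q2 M k B = {v \<in> L2 (restrict_space (vol M) B). \<exists>c::complex.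
     distr_eq_on M B ((lap_distr M ^^ k) (distr_of M v)) (distr_of M (\<lambda>p. c))}"

definition q2_perp :: "('a::topological_space, 'n::finite) riem \<Rightarrow> nat \<Rightarrow> 'a set \<Rightarrow> ('a \<Rightarrow> complex) set" where
  "q2_perp M k B = {w \<in> L2 (restrict_space (vol M) B).
     \<forall>v\<in>q2 M k B. (LINT p|restrict_space (vol M) B. w p * cnj (v p)) = 0}"

text \<open>The orthogonal projection of (the restriction to \<open>B\<close> of) \<open>G\<close> onto the orthogonal complement of \<open>q2 M k B\<close>.\<close>

definition proj_perp :: "('a::topological_space, 'n::finite) riem \<Rightarrow> nat \<Rightarrow> 'a set \<Rightarrow> ('a \<Rightarrow> complex) \<Rightarrow> 'a \<Rightarrow> complex" where
  "proj_perp M k B G = (SOME w. w \<in> q2_perp M k B \<and> (\<lambda>p. G p - w p) \<in> q2 M k B)"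

definition GBMO_norm :: "real \<Rightarrow> ('a::metric_space, 'n::finite) riem \<Rightarrow> nat \<Rightarrow> ('a \<Rightarrow> complex) \<Rightarrow> ennreal" where
  "GBMO_norm s M k G = (SUP B\<in>balls_upto s.
     L2_norm (restrict_space (vol M) B) (proj_perp M k B G) / enn_sqrt (emeasure (vol M) B))"

definition GBMO :: "real \<Rightarrow> ('a::metric_space, 'n::finite) riem \<Rightarrow> nat \<Rightarrow> ('a \<Rightarrow> complex) set" where
  "GBMO s M k = {G \<in> L2_loc M. GBMO_norm s M k G < \<infinity>}"

end

theory Submission
  imports Defs
begin

text \<open>
  Why the estimate holds.  Fix a ball \<open>B\<close> of the family and a constant \<open>c\<close> with \<open>g - c \<in> L\<^sup>2(B)\<close>.
  Extend \<open>g - c\<close> by zero outside \<open>B\<close> to a function \<open>f \<in> L\<^sup>2(M)\<close>, and let \<open>v\<close> be the image of \<open>f\<close> under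
  the \<open>k\<close>-th power of the inverse operator.  In the sense of distributions on \<open>B\<close>, the \<open>k\<close>-th power of
  the operator maps \<open>U - v\<close> to \<open>g - (g - c) = c\<close>, so \<open>U - v\<close> belongs to \<open>q2 M k B\<close>, and \<open>U\<close> and \<open>v\<close> have the
  same projection onto the orthogonal complement.  Projections do not increase norms, whence the
  norm of the projection of \<open>U\<close> is at most the norm of \<open>v\<close>, which is at most the operator norm times
  the norm of \<open>g - c\<close> on \<open>B\<close> (\<open>proj_perp_norm_le\<close>).  It remains to take the infimum over \<open>c\<close>, to divide
  by the square root of the volume of \<open>B\<close>, and to take the supremum over \<open>B\<close> (\<open>GBMO_norm_le\<close>).

  Four facts carry this argument.

  \<^item> The operator maps test functions to test functions (\<open>lap_test_function\<close>); otherwise its powers on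
    distributions could not be compared with powers of its inverse.  Locality is clear.  Smoothness
    is not, because \<open>lap\<close> is evaluated at each point in a chart chosen for that point; it follows
    from the independence of the coordinate expression from the chart, a consequence of the chain
    rule and of the Piola identity.

  \<^item> Closed balls are compact (\<open>Hopf_Rinow\<close>), so that \<open>U\<close> is in \<open>L\<^sup>2(B)\<close> and \<open>B\<close> has finite volume.  As
    the metric is an infimum of lengths of curves, this is the purely metric form of the
    Hopf--Rinow theorem.

  \<^item> The projection exists: \<open>q2 M k B\<close> is a linear subspace closed under \<open>L\<^sup>2\<close> convergence (\<open>q2_closed\<close>),
    and \<open>L\<^sup>2\<close> is complete (\<open>L2_complete\<close>, \<open>L2_projection\<close>).

  \<^item> A positive bottom of the spectrum puts \<open>0\<close> into the resolvent set, so the inverse is everywhere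
    defined and bounded.  Its values are determined only almost everywhere, and its powers are
    homogeneous only up to null sets, which suffices for the usual operator norm inequality
    (\<open>opnorm_bound\<close>).
\<close>

section \<open>Calculus of functions of class C^k on open sets\<close>

lemma has_derivative_partial:
  assumes "(f has_derivative f') (at x)"
  shows "partial i f x = f' (axis i 1)"
  using frechet_derivative_at[OF assms] by (simp add: partial_def)

lemma partial_cong:
  assumes "open S" "x \<in> S" "\<And>y. y \<in> S \<Longrightarrow> f y = g y"
  shows "partial i f x = partial i g x"
proof -
  have "(f has_derivative f') (at x) \<longleftrightarrow> (g has_derivative f') (at x)" for f'
    using has_derivative_transform_within_open[OF _ assms(1,2), of f f' UNIV g]
      has_derivative_transform_within_open[OF _ assms(1,2), of g f' UNIV f] assms(3) by auto
  then show ?thesis by (simp add: partial_def frechet_derivative_def)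
qed

lemma differentiable_on_agree:
  assumes "\<And>y. y \<in> S \<Longrightarrow> f y = g y"
  shows "f differentiable_on S \<longleftrightarrow> g differentiable_on S"
proof -
  have "(f has_derivative f') (at x within S) \<longleftrightarrow> (g has_derivative f') (at x within S)" if "x \<in> S" for x f'
    using has_derivative_transform[OF that, of f g f'] has_derivative_transform[OF that, of g f f'] assms
    by auto
  then show ?thesis by (auto simp: differentiable_on_def differentiable_def)
qed

lemma Ck_on_cong:
  assumes "open S" "\<And>y. y \<in> S \<Longrightarrow> f y = g y"
  shows "Ck_on k S f \<longleftrightarrow> Ck_on k S g"
  using assms(2)
proof (induction k arbitrary: f g)
  case 0
  then show ?case by (simp cong: continuous_on_cong)
next
  case (Suc k)
  have "Ck_on k S (partial i f) = Ck_on k S (partial i g)" for i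
    by (rule Suc.IH) (rule partial_cong[OF assms(1) _ Suc.prems])
  then show ?case using differentiable_on_agree[of S f g] Suc.prems by simp
qed

lemma Ck_on_subset: "Ck_on k S f \<Longrightarrow> T \<subseteq> S \<Longrightarrow> Ck_on k T f"
proof (induction k arbitrary: f)
  case 0
  then show ?case using continuous_on_subset[of S f T] by simp
next
  case (Suc k)
  then show ?case using differentiable_on_subset[of f S T] by simp
qed

lemma Ck_on_Suc_imp: "Ck_on (Suc k) S f \<Longrightarrow> Ck_on k S f"
proof (induction k arbitrary: f)
  case (Suc k)
  then have "f differentiable_on S" "Ck_on (Suc k) S (partial i f)" for i by auto
  then show ?case using Suc.IH by auto
qed (simp add: differentiable_imp_continuous_on)

lemma Ck_on_has_derivative:
  assumes "Ck_on (Suc k) S f" "open S" "x \<in> S"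
  shows "(f has_derivative frechet_derivative f (at x)) (at x)"
proof -
  have "f differentiable (at x within S)" using assms by (simp add: differentiable_on_def)
  then show ?thesis
    unfolding at_within_open[OF assms(3,2)] frechet_derivative_works .
qed

lemma frechet_derivative_eq_partials:
  fixes f :: "real^'n::finite \<Rightarrow> 'b::real_normed_vector"
  assumes "(f has_derivative f') (at x)"
  shows "f' h = (\<Sum>i\<in>UNIV. h $ i *\<^sub>R partial i f x)"
proof -
  interpret bounded_linear f' using assms by (rule has_derivative_bounded_linear)
  have "f' h = f' (\<Sum>i\<in>UNIV. h $ i *\<^sub>R axis i 1)"
    by (simp add: basis_expansion flip: scalar_mult_eq_scaleR)
  also have "\<dots> = (\<Sum>i\<in>UNIV. h $ i *\<^sub>R partial i f x)"
    by (simp add: sum scaleR has_derivative_partial[OF assms])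
  finally show ?thesis .
qed

lemma Ck_on_const: "Ck_on k S (\<lambda>x. c)"
proof (induction k arbitrary: c)
  case (Suc k)
  have "partial i (\<lambda>x. c) = (\<lambda>x. 0)" for i :: 'a
    by (simp add: partial_def fun_eq_iff)
  then show ?case using Suc by simp
qed simp

text \<open>
  For linear images, sums, products, inverses and square roots the total derivative is known; this rule
  reads the partial derivatives off from it, so that induction on the order of differentiability applies.
\<close>

lemma Ck_on_SucI:
  assumes "open S" and D: "\<And>x. x \<in> S \<Longrightarrow> (f has_derivative f' x) (at x)"
    and "\<And>i. Ck_on k S (\<lambda>x. f' x (axis i 1))"
  shows "Ck_on (Suc k) S f"
proof -
  have "Ck_on k S (partial i f)" for i
    using Ck_on_cong[OF assms(1), of "partial i f" "\<lambda>x. f' x (axis i 1)"] assms(3)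
    by (simp add: has_derivative_partial[OF D])
  then show ?thesis
    using D by (auto simp: differentiable_on_def differentiable_def intro: has_derivative_at_withinI)
qed

lemma Ck_on_bounded_linear:
  assumes "bounded_linear L" "open S" "Ck_on k S f"
  shows "Ck_on k S (\<lambda>x. L (f x))"
  using assms(3)
proof (induction k arbitrary: f)
  case 0
  then show ?case using bounded_linear.continuous_on[OF assms(1)] by simp
next
  case (Suc k)
  have D: "((\<lambda>x. L (f x)) has_derivative (\<lambda>h. L (frechet_derivative f (at x) h))) (at x)"
    if "x \<in> S" for x
    using bounded_linear.has_derivative[OF assms(1) Ck_on_has_derivative[OF Suc.prems assms(2) that]] .
  have "Ck_on k S (\<lambda>x. L (partial i f x))" for i using Suc by simp
  then show ?case
    by (intro Ck_on_SucI[OF assms(2) D]) (simp_all flip: partial_def)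
qed

lemma Ck_on_add:
  assumes "open S" "Ck_on k S f" "Ck_on k S g"
  shows "Ck_on k S (\<lambda>x. f x + g x)"
  using assms(2,3)
proof (induction k arbitrary: f g)
  case 0
  then show ?case by (simp add: continuous_on_add)
next
  case (Suc k)
  have D: "((\<lambda>x. f x + g x) has_derivative
      (\<lambda>h. frechet_derivative f (at x) h + frechet_derivative g (at x) h)) (at x)" if "x \<in> S" for x
    using has_derivative_add[OF Ck_on_has_derivative[OF Suc.prems(1) assms(1) that]
        Ck_on_has_derivative[OF Suc.prems(2) assms(1) that]] .
  have "Ck_on k S (\<lambda>x. partial i f x + partial i g x)" for i using Suc by simp
  then show ?case
    by (intro Ck_on_SucI[OF assms(1) D]) (simp_all flip: partial_def)
qed

lemma Ck_on_bounded_bilinear: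
  assumes "bounded_bilinear prd" "open S" "Ck_on k S f" "Ck_on k S g"
  shows "Ck_on k S (\<lambda>x. prd (f x) (g x))"
  using assms(3,4)
proof (induction k arbitrary: f g)
  case 0
  then show ?case using bounded_bilinear.continuous_on[OF assms(1)] by simp
next
  case (Suc k)
  have D: "((\<lambda>x. prd (f x) (g x)) has_derivative
      (\<lambda>h. prd (f x) (frechet_derivative g (at x) h) + prd (frechet_derivative f (at x) h) (g x))) (at x)"
    if "x \<in> S" for x
    using bounded_bilinear.FDERIV[OF assms(1) Ck_on_has_derivative[OF Suc.prems(1) assms(2) that]
        Ck_on_has_derivative[OF Suc.prems(2) assms(2) that]] .
  have "Ck_on k S (\<lambda>x. prd (f x) (partial i g x) + prd (partial i f x) (g x))" for i
    using Suc.prems Ck_on_Suc_imp[OF Suc.prems(1)] Ck_on_Suc_imp[OF Suc.prems(2)] by (intro Ck_on_add[OF assms(2)] Suc.IH) simp_all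
  then show ?case
    by (intro Ck_on_SucI[OF assms(2) D]) (simp_all flip: partial_def)
qed

lemmas Ck_on_mult = Ck_on_bounded_bilinear[OF bounded_bilinear_mult]
lemmas Ck_on_scaleR = Ck_on_bounded_bilinear[OF bounded_bilinear_scaleR]

lemma Ck_on_sum:
  assumes "open S" "\<And>i. i \<in> I \<Longrightarrow> Ck_on k S (f i)"
  shows "Ck_on k S (\<lambda>x. \<Sum>i\<in>I. f i x)"
  using assms(2)
  by (induction I rule: infinite_finite_induct) (auto simp: Ck_on_const intro!: Ck_on_add[OF assms(1)])

lemma Ck_on_prod:
  fixes f :: "_ \<Rightarrow> _ \<Rightarrow> real"
  assumes "open S" "\<And>i. i \<in> I \<Longrightarrow> Ck_on k S (f i)"
  shows "Ck_on k S (\<lambda>x. \<Prod>i\<in>I. f i x)"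
  using assms(2)
  by (induction I rule: infinite_finite_induct) (auto simp: Ck_on_const intro!: Ck_on_mult[OF assms(1)])

lemma Ck_on_vec_nth: "open S \<Longrightarrow> Ck_on k S f \<Longrightarrow> Ck_on k S (\<lambda>x. f x $ i)"
  by (rule Ck_on_bounded_linear[OF bounded_linear_vec_nth])

lemma Ck_on_det:
  fixes A :: "_ \<Rightarrow> real^'m^'m::finite"
  assumes "open S" "\<And>i j. Ck_on k S (\<lambda>x. A x $ i $ j)"
  shows "Ck_on k S (\<lambda>x. det (A x))"
  unfolding det_def by (intro Ck_on_sum Ck_on_mult Ck_on_prod Ck_on_const assms)

lemma Ck_on_inverse:
  fixes f :: "_ \<Rightarrow> real"
  assumes "open S" "Ck_on k S f" "\<And>x. x \<in> S \<Longrightarrow> f x \<noteq> 0"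
  shows "Ck_on k S (\<lambda>x. inverse (f x))"
  using assms(2)
proof (induction k)
  case 0
  then show ?case using assms(3) by (simp add: continuous_on_inverse)
next
  case (Suc k)
  have D: "((\<lambda>x. inverse (f x)) has_derivative
      (\<lambda>h. - (inverse (f x) * frechet_derivative f (at x) h * inverse (f x)))) (at x)"
    if "x \<in> S" for x
    by (rule Deriv.has_derivative_inverse[OF assms(3)[OF that] Ck_on_has_derivative[OF Suc.prems assms(1) that]])
  have "Ck_on k S (\<lambda>x. - 1 * (inverse (f x) * partial i f x * inverse (f x)))" for i
    using Suc.prems Ck_on_Suc_imp[OF Suc.prems]
    by (intro Ck_on_mult[OF assms(1)] Suc.IH Ck_on_const) auto
  then show ?case
    by (intro Ck_on_SucI[OF assms(1) D]) (simp_all flip: partial_def)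
qed

lemma Ck_on_sqrt:
  fixes f :: "_ \<Rightarrow> real"
  assumes "open S" "Ck_on k S f" "\<And>x. x \<in> S \<Longrightarrow> f x > 0"
  shows "Ck_on k S (\<lambda>x. sqrt (f x))"
  using assms(2)
proof (induction k)
  case 0
  then show ?case by (simp add: continuous_on_real_sqrt)
next
  case (Suc k)
  have D: "((\<lambda>x. sqrt (f x)) has_derivative
      (\<lambda>h. frechet_derivative f (at x) h * (inverse (sqrt (f x)) / 2))) (at x)"
    if "x \<in> S" for x
    using has_derivative_real_sqrt[OF assms(3)[OF that] Ck_on_has_derivative[OF Suc.prems assms(1) that]]
    by (simp add: mult.commute)
  have "Ck_on k S (\<lambda>x. partial i f x * (inverse (sqrt (f x)) * (1/2)))" for i
    using Suc.prems Ck_on_Suc_imp[OF Suc.prems] assms(3)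
    by (intro Ck_on_mult[OF assms(1)] Suc.IH Ck_on_const Ck_on_inverse[OF assms(1)]) fastforce+
  then show ?case
    by (intro Ck_on_SucI[OF assms(1) D]) (simp_all flip: partial_def)
qed

lemma has_derivative_partial_compose:
  fixes f :: "real^'m::finite \<Rightarrow> 'b::real_normed_vector" and \<tau> :: "real^'n::finite \<Rightarrow> real^'m"
  assumes "(f has_derivative f') (at (\<tau> x))" "(\<tau> has_derivative \<tau>') (at x)"
  shows "partial i (\<lambda>x. f (\<tau> x)) x = (\<Sum>j\<in>UNIV. partial i \<tau> x $ j *\<^sub>R partial j f (\<tau> x))"
  using has_derivative_partial[OF has_derivative_compose[OF assms(2,1)]]
    frechet_derivative_eq_partials[OF assms(1)] has_derivative_partial[OF assms(2)] by simp

lemma matrix_inv_works: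
  fixes A :: "real^'m^'m::finite"
  assumes "det A \<noteq> 0"
  shows "A ** matrix_inv A = mat 1" "matrix_inv A ** A = mat 1"
proof -
  have "\<exists>A'. A ** A' = mat 1 \<and> A' ** A = mat 1"
    using assms unfolding invertible_det_nz[symmetric] invertible_def .
  from someI_ex[OF this] show "A ** matrix_inv A = mat 1" "matrix_inv A ** A = mat 1"
    by (simp_all add: matrix_inv_def)
qed

lemma matrix_inv_unique:
  fixes A B :: "real^'m^'m::finite"
  assumes "A ** B = mat 1"
  shows "matrix_inv A = B"
proof -
  have "det A * det B = 1"
    using arg_cong[OF assms, of det] by (simp add: det_mul)
  then have inv: "matrix_inv A ** A = mat 1"
    by (intro matrix_inv_works(2)) auto
  have "matrix_inv A = matrix_inv A ** (A ** B)" by (simp add: assms)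
  also have "\<dots> = B" by (simp add: matrix_mul_assoc inv)
  finally show ?thesis .
qed

text \<open>
  Cramer's rule writes the entries of the inverse as rational functions of the entries, which shows
  that inversion preserves smoothness.
\<close>

lemma matrix_inv_cramer:
  fixes A :: "real^'m^'m::finite"
  assumes "det A \<noteq> 0"
  shows "matrix_inv A $ i $ j = det (\<chi> p q. if q = i then axis j 1 $ p else A $ p $ q) * inverse (det A)"
proof -
  let ?x = "\<chi> i. matrix_inv A $ i $ j"
  have "A *v ?x = axis j 1"
    using matrix_inv_works(1)[OF assms]
    by (simp add: vec_eq_iff matrix_vector_mult_def matrix_matrix_mult_def mat_def axis_def)
  then have "?x = (\<chi> k. det (\<chi> p q. if q = k then axis j 1 $ p else A $ p $ q) / det A)"
    using cramer[OF assms] by blast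
  then show ?thesis by (simp add: vec_eq_iff divide_inverse)
qed

lemma Ck_on_matrix_inv:
  fixes A :: "_ \<Rightarrow> real^'m^'m::finite"
  assumes "open S" "\<And>i j. Ck_on k S (\<lambda>x. A x $ i $ j)" "\<And>x. x \<in> S \<Longrightarrow> det (A x) \<noteq> 0"
  shows "Ck_on k S (\<lambda>x. matrix_inv (A x) $ i $ j)"
proof -
  have "Ck_on k S (\<lambda>x. det (\<chi> p q. if q = i then axis j 1 $ p else A x $ p $ q) * inverse (det (A x)))"
  proof (intro Ck_on_mult Ck_on_det Ck_on_inverse assms)
    fix p q
    show "Ck_on k S (\<lambda>x. (\<chi> p q. if q = i then axis j 1 $ p else A x $ p $ q) $ p $ q)"
      using assms(2) by (cases "q = i") (auto simp: Ck_on_const)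
  qed
  then show ?thesis
    by (subst Ck_on_cong[OF assms(1)]) (auto simp: matrix_inv_cramer assms(3))
qed

section \<open>Symmetry of second derivatives and the derivative of the determinant\<close>

lemma has_real_derivative_along_axis:
  fixes f :: "real^'n::finite \<Rightarrow> real"
  assumes "(f has_derivative f') (at (x + s *\<^sub>R axis i 1))"
  shows "((\<lambda>s. f (x + s *\<^sub>R axis i 1)) has_real_derivative partial i f (x + s *\<^sub>R axis i 1)) (at s)"
proof -
  interpret bounded_linear f' using assms by (rule has_derivative_bounded_linear)
  have "((\<lambda>s. x + s *\<^sub>R axis i 1) has_derivative (\<lambda>h. h *\<^sub>R axis i 1)) (at s)"
    by (auto intro!: derivative_eq_intros)
  from has_derivative_compose[OF this assms] show ?thesis
    by (simp add: has_field_derivative_def has_derivative_partial[OF assms] scaleR mult_commute_abs)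
qed

text \<open>
  Two applications of the mean value theorem to the second difference of \<open>f\<close> over a small square.
  The second difference is symmetric in \<open>i\<close> and \<open>j\<close>, the right-hand side is not; letting \<open>h\<close> tend to
  \<open>0\<close> gives the symmetry of second derivatives in \<open>partial_commute\<close>.
\<close>

lemma mixed_difference_mean_value:
  fixes f :: "real^'n::finite \<Rightarrow> real"
  assumes f: "Ck_on 2 (ball x r) f" and h: "0 < h" "2 * h < r"
  obtains s t where "0 < s" "s < h" "0 < t" "t < h"
    "f (x + h *\<^sub>R axis i 1 + h *\<^sub>R axis j 1) - f (x + h *\<^sub>R axis i 1)
       - f (x + h *\<^sub>R axis j 1) + f x
     = h^2 * partial j (partial i f) (x + s *\<^sub>R axis i 1 + t *\<^sub>R axis j 1)"
proof -
  have f1: "Ck_on (Suc (Suc 0)) (ball x r) f" using f by (simp add: numeral_2_eq_2)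
  have in_ball: "x + s *\<^sub>R axis i 1 + t *\<^sub>R axis j 1 \<in> ball x r" if "\<bar>s\<bar> \<le> h" "\<bar>t\<bar> \<le> h" for s t
  proof -
    have "norm (s *\<^sub>R axis i 1 + t *\<^sub>R (axis j 1 :: real^'n)) \<le> \<bar>s\<bar> + \<bar>t\<bar>"
      by (rule order_trans[OF norm_triangle_ineq]) (simp add: norm_axis_1)
    then show ?thesis using that h unfolding mem_ball dist_commute[of x] by (simp add: dist_norm add.assoc)
  qed
  have D: "(f has_derivative frechet_derivative f (at y)) (at y)" if "y \<in> ball x r" for y
    by (rule Ck_on_has_derivative[OF f1 open_ball that])
  have D2: "(partial i f has_derivative frechet_derivative (partial i f) (at y)) (at y)" if "y \<in> ball x r" for y
    by (rule Ck_on_has_derivative[OF _ open_ball that, of 0]) (use f1 in simp)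
  define u where "u s = f (x + s *\<^sub>R axis i 1 + h *\<^sub>R axis j 1) - f (x + s *\<^sub>R axis i 1)" for s
  have "\<exists>s. 0 < s \<and> s < h \<and> u h - u 0 = (h - 0) *
      (partial i f (x + s *\<^sub>R axis i 1 + h *\<^sub>R axis j 1) - partial i f (x + s *\<^sub>R axis i 1))"
  proof (rule MVT2[OF h(1)])
    fix s assume s: "0 \<le> s" "s \<le> h"
    have "((\<lambda>s. f ((x + h *\<^sub>R axis j 1) + s *\<^sub>R axis i 1)) has_real_derivative
        partial i f ((x + h *\<^sub>R axis j 1) + s *\<^sub>R axis i 1)) (at s)"
      by (rule has_real_derivative_along_axis[OF D])
        (use in_ball[of s h] s in \<open>simp add: ac_simps\<close>)
    moreover have "((\<lambda>s. f (x + s *\<^sub>R axis i 1)) has_real_derivative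
        partial i f (x + s *\<^sub>R axis i 1)) (at s)"
      by (rule has_real_derivative_along_axis[OF D]) (use in_ball[of s 0] s in simp)
    ultimately show "(u has_real_derivative partial i f (x + s *\<^sub>R axis i 1 + h *\<^sub>R axis j 1)
        - partial i f (x + s *\<^sub>R axis i 1)) (at s)"
      unfolding u_def by (intro DERIV_diff) (simp_all add: ac_simps)
  qed
  then obtain s where s: "0 < s" "s < h" and us: "u h - u 0 = h *
      (partial i f (x + s *\<^sub>R axis i 1 + h *\<^sub>R axis j 1) - partial i f (x + s *\<^sub>R axis i 1))"
    by auto
  have "\<exists>t. 0 < t \<and> t < h \<and> partial i f (x + s *\<^sub>R axis i 1 + h *\<^sub>R axis j 1)
      - partial i f (x + s *\<^sub>R axis i 1 + 0 *\<^sub>R axis j 1)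
      = (h - 0) * partial j (partial i f) (x + s *\<^sub>R axis i 1 + t *\<^sub>R axis j 1)"
    by (rule MVT2[OF h(1)])
      (intro has_real_derivative_along_axis[OF D2] in_ball, use s in auto)
  then obtain t where t: "0 < t" "t < h" and "partial i f (x + s *\<^sub>R axis i 1 + h *\<^sub>R axis j 1)
      - partial i f (x + s *\<^sub>R axis i 1)
      = h * partial j (partial i f) (x + s *\<^sub>R axis i 1 + t *\<^sub>R axis j 1)"
    by auto
  with us have "u h - u 0 = h^2 * partial j (partial i f) (x + s *\<^sub>R axis i 1 + t *\<^sub>R axis j 1)"
    by (simp add: power2_eq_square)
  then show ?thesis using that[OF s t] by (simp add: u_def)
qed

lemma partial_commute:
  fixes f :: "real^'n::finite \<Rightarrow> real"
  assumes "open S" "x \<in> S" "Ck_on 2 S f"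
  shows "partial i (partial j f) x = partial j (partial i f) x"
proof -
  have cont: "continuous (at x) (partial k (partial l f))" for k l
    using assms by (simp add: numeral_2_eq_2 continuous_on_eq_continuous_at)
  obtain r where r: "r > 0" "ball x r \<subseteq> S" using assms(1,2) open_contains_ball by blast
  have f: "Ck_on 2 (ball x r) f" using Ck_on_subset[OF assms(3) r(2)] .
  let ?A = "partial i (partial j f)" and ?B = "partial j (partial i f)"
  have "dist (?A x) (?B x) \<le> e" if "e > 0" for e
  proof -
    obtain d where d: "d > 0" "\<And>y. dist y x < d \<Longrightarrow> dist (?A y) (?A x) < e/2"
      using cont[of i j] \<open>e > 0\<close> unfolding continuous_at_eps_delta by (meson half_gt_zero)
    obtain d' where d': "d' > 0" "\<And>y. dist y x < d' \<Longrightarrow> dist (?B y) (?B x) < e/2"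
      using cont[of j i] \<open>e > 0\<close> unfolding continuous_at_eps_delta by (meson half_gt_zero)
    define h where "h = min r (min d d') / 4"
    have h: "0 < h" "2 * h < r" "2 * h < d" "2 * h < d'"
      using r d d' by (auto simp: h_def)
    have near: "dist (x + s *\<^sub>R axis k 1 + t *\<^sub>R axis l 1) x < 2 * h"
      if "0 < s" "s < h" "0 < t" "t < h" for s t k l
    proof -
      have "norm (s *\<^sub>R axis k 1 + t *\<^sub>R (axis l 1 :: real^'n)) \<le> \<bar>s\<bar> + \<bar>t\<bar>"
        by (rule order_trans[OF norm_triangle_ineq]) (simp add: norm_axis_1)
      then show ?thesis using that by (simp add: dist_norm add.assoc)
    qed
    obtain s t where st: "0 < s" "s < h" "0 < t" "t < h"
      "f (x + h *\<^sub>R axis i 1 + h *\<^sub>R axis j 1) - f (x + h *\<^sub>R axis i 1)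
         - f (x + h *\<^sub>R axis j 1) + f x = h^2 * ?B (x + s *\<^sub>R axis i 1 + t *\<^sub>R axis j 1)"
      using mixed_difference_mean_value[OF f h(1,2)] .
    obtain s' t' where st': "0 < s'" "s' < h" "0 < t'" "t' < h"
      "f (x + h *\<^sub>R axis j 1 + h *\<^sub>R axis i 1) - f (x + h *\<^sub>R axis j 1)
         - f (x + h *\<^sub>R axis i 1) + f x = h^2 * ?A (x + s' *\<^sub>R axis j 1 + t' *\<^sub>R axis i 1)"
      using mixed_difference_mean_value[OF f h(1,2)] .
    have "f (x + h *\<^sub>R axis j 1 + h *\<^sub>R axis i 1) = f (x + h *\<^sub>R axis i 1 + h *\<^sub>R axis j 1)"
      by (simp add: ac_simps)
    with st(5) st'(5) have "h^2 * ?B (x + s *\<^sub>R axis i 1 + t *\<^sub>R axis j 1)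
        = h^2 * ?A (x + s' *\<^sub>R axis j 1 + t' *\<^sub>R axis i 1)" by linarith
    then have eq: "?B (x + s *\<^sub>R axis i 1 + t *\<^sub>R axis j 1) = ?A (x + s' *\<^sub>R axis j 1 + t' *\<^sub>R axis i 1)"
      using h by simp
    have "dist (?B (x + s *\<^sub>R axis i 1 + t *\<^sub>R axis j 1)) (?B x) < e/2"
      using near[OF st(1-4), of i j] h by (intro d') linarith
    moreover have "dist (?A (x + s' *\<^sub>R axis j 1 + t' *\<^sub>R axis i 1)) (?A x) < e/2"
      using near[OF st'(1-4), of j i] h by (intro d) linarith
    ultimately show ?thesis unfolding eq dist_real_def by linarith
  qed
  then have "dist (?A x) (?B x) \<le> 0" by (rule field_le_epsilon) auto
  then show ?thesis by simp
qed

text \<open>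
  In the Leibniz expansion, the product rule leaves, for each permutation \<open>p\<close> and each index \<open>i\<close>, a
  product of the entries \<open>(j, p j)\<close> with \<open>j \<noteq> i\<close>.  A permutation other than the identity moves at least
  two indices, so one of these entries is off the diagonal and the product vanishes at the identity
  matrix.
\<close>

lemma has_derivative_det_at_identity:
  fixes C :: "'a::real_normed_vector \<Rightarrow> real^'m^'m::finite"
  assumes D: "\<And>a b. ((\<lambda>y. C y $ a $ b) has_derivative C' a b) (at x)" and C: "C x = mat 1"
  shows "((\<lambda>y. det (C y)) has_derivative (\<lambda>h. \<Sum>a\<in>UNIV. C' a a h)) (at x)"
proof -
  let ?P = "{p. p permutes (UNIV :: 'm set)}"
  let ?term = "\<lambda>p h. of_int (sign p) *
      (\<Sum>i\<in>UNIV. C' i (p i) h * (\<Prod>j\<in>UNIV - {i}. C x $ j $ p j))"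
  have "((\<lambda>y. det (C y)) has_derivative (\<lambda>h. \<Sum>p\<in>?P. ?term p h)) (at x)"
    unfolding det_def
    by (intro has_derivative_sum has_derivative_mult_right has_derivative_prod D)
  moreover have "(\<Sum>p\<in>?P. ?term p h) = (\<Sum>a\<in>UNIV. C' a a h)" for h
  proof -
    have "?term p h = 0" if "p \<in> ?P - {id}" for p
    proof -
      have p: "bij p" and "p \<noteq> id" using that permutes_bij by auto
      have "(\<Prod>j\<in>UNIV - {i}. C x $ j $ p j) = 0" for i
      proof -
        have "\<exists>j. j \<noteq> i \<and> p j \<noteq> j"
        proof (rule ccontr)
          assume "\<not> (\<exists>j. j \<noteq> i \<and> p j \<noteq> j)"
          then have *: "p j = j" if "j \<noteq> i" for j using that by blast
          have "p i = i" using *[of "p i"] bij_is_inj[OF p] by (auto dest: injD)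
          with * have "p = id" by (metis eq_id_iff)
          with \<open>p \<noteq> id\<close> show False by simp
        qed
        then obtain j where "j \<noteq> i" "p j \<noteq> j" by blast
        then show ?thesis by (intro prod_zero bexI[of _ j]) (auto simp: C mat_def)
      qed
      then show ?thesis by (simp del: prod_zero_iff)
    qed
    then have "(\<Sum>p\<in>?P. ?term p h) = (\<Sum>p\<in>{id}. ?term p h)"
      by (intro sum.mono_neutral_right) (auto simp: permutes_id finite_permutations)
    also have "\<dots> = (\<Sum>a\<in>UNIV. C' a a h)"
      by (simp add: C mat_def sign_id)
    finally show ?thesis .
  qed
  ultimately show ?thesis by simp
qed

text \<open>
  Jacobi's formula, reduced to the identity matrix by writing \<open>A y\<close> as \<open>A x\<close> times
  \<open>matrix_inv (A x) ** A y\<close>.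
\<close>

lemma has_derivative_det:
  fixes A :: "'a::real_normed_vector \<Rightarrow> real^'m^'m::finite"
  assumes D: "\<And>a b. ((\<lambda>y. A y $ a $ b) has_derivative A' a b) (at x)" and nz: "det (A x) \<noteq> 0"
  shows "((\<lambda>y. det (A y)) has_derivative
    (\<lambda>h. det (A x) * (\<Sum>a\<in>UNIV. \<Sum>b\<in>UNIV. matrix_inv (A x) $ a $ b * A' b a h))) (at x)"
proof -
  let ?K = "matrix_inv (A x)"
  have "((\<lambda>y. det (?K ** A y)) has_derivative (\<lambda>h. \<Sum>a\<in>UNIV. \<Sum>b\<in>UNIV. ?K $ a $ b * A' b a h)) (at x)"
  proof (rule has_derivative_det_at_identity[where C' = "\<lambda>a b h. \<Sum>c\<in>UNIV. ?K $ a $ c * A' c b h"])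
    fix a b
    show "((\<lambda>y. (?K ** A y) $ a $ b) has_derivative (\<lambda>h. \<Sum>c\<in>UNIV. ?K $ a $ c * A' c b h)) (at x)"
      by (simp add: matrix_matrix_mult_def) (intro has_derivative_sum has_derivative_mult_right D)
  qed (simp add: matrix_inv_works[OF nz])
  then have "((\<lambda>y. det (A x) * det (?K ** A y)) has_derivative
      (\<lambda>h. det (A x) * (\<Sum>a\<in>UNIV. \<Sum>b\<in>UNIV. ?K $ a $ b * A' b a h))) (at x)"
    by (rule has_derivative_mult_right)
  moreover have "det (A x) * det (?K ** A y) = det (A y)" for y
    using matrix_inv_works(1)[OF nz] by (simp add: matrix_mul_assoc flip: det_mul)
  ultimately show ?thesis by simp
qed

section \<open>Coordinate invariance of the Laplace--Beltrami expression\<close>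

definition jac :: "(real^'n::finite \<Rightarrow> real^'n) \<Rightarrow> real^'n \<Rightarrow> real^'n^'n" where
  "jac \<tau> x = (\<chi> a b. partial b \<tau> x $ a)"

lemma jac_eq_jacobian: "jac \<tau> x = jacobian \<tau> (at x)"
  by (simp add: jac_def jacobian_def matrix_def partial_def)

lemma partial_mult:
  fixes f g :: "real^'n::finite \<Rightarrow> real"
  assumes "(f has_derivative f') (at x)" "(g has_derivative g') (at x)"
  shows "partial i (\<lambda>y. f y * g y) x = f x * partial i g x + partial i f x * g x"
  using has_derivative_partial[OF has_derivative_mult[OF assms]] has_derivative_partial[OF assms(1)]
    has_derivative_partial[OF assms(2)] by simp

lemma partial_scaleR:
  fixes f :: "real^'n::finite \<Rightarrow> real" and g :: "real^'n \<Rightarrow> 'b::real_normed_vector"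
  assumes "(f has_derivative f') (at x)" "(g has_derivative g') (at x)"
  shows "partial i (\<lambda>y. f y *\<^sub>R g y) x = f x *\<^sub>R partial i g x + partial i f x *\<^sub>R g x"
  using has_derivative_partial[OF has_derivative_scaleR[OF assms]] has_derivative_partial[OF assms(1)]
    has_derivative_partial[OF assms(2)] by simp

lemma partial_sum:
  assumes "\<And>a. a \<in> I \<Longrightarrow> (f a has_derivative f' a) (at x)"
  shows "partial i (\<lambda>y. \<Sum>a\<in>I. f a y) x = (\<Sum>a\<in>I. partial i (f a) x)"
  using has_derivative_partial[OF has_derivative_sum[of I f f' "at x"]] assms
    has_derivative_partial[OF assms] by simp

lemma partial_scaleR_const:
  assumes "(f has_derivative f') (at x)"
  shows "partial i (\<lambda>y. c *\<^sub>R f y) x = c *\<^sub>R partial i f x"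
  using has_derivative_partial[OF has_derivative_scaleR_right[OF assms]] has_derivative_partial[OF assms] by simp

lemma Ck_on_jac:
  assumes "open S" "Ck_on (Suc k) S \<tau>"
  shows "Ck_on k S (\<lambda>x. jac \<tau> x $ a $ b)"
  using assms by (simp add: jac_def Ck_on_vec_nth)

lemma partial_vec_nth:
  assumes "(f has_derivative f') (at x)"
  shows "partial i (\<lambda>y. f y $ a) x = partial i f x $ a"
  using has_derivative_partial[OF bounded_linear.has_derivative[OF bounded_linear_vec_nth assms]]
    has_derivative_partial[OF assms] by simp

lemma partial_jac_commute:
  fixes \<tau> :: "real^'n::finite \<Rightarrow> real^'n"
  assumes "open S" "x \<in> S" "Ck_on 2 S \<tau>"
  shows "partial i (\<lambda>y. jac \<tau> y $ b $ a) x = partial a (\<lambda>y. jac \<tau> y $ b $ i) x"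
proof -
  have \<tau>: "Ck_on (Suc (Suc 0)) S \<tau>" using assms(3) by (simp add: numeral_2_eq_2)
  have eq: "partial k (\<lambda>y. \<tau> y $ b) y = jac \<tau> y $ b $ k" if "y \<in> S" for y k
    using partial_vec_nth[OF Ck_on_has_derivative[OF \<tau> assms(1) that]] by (simp add: jac_def)
  have "partial i (\<lambda>y. jac \<tau> y $ b $ a) x = partial i (partial a (\<lambda>y. \<tau> y $ b)) x" for i a
    by (rule partial_cong[OF assms(1,2)]) (simp add: eq)
  then show ?thesis
    using partial_commute[OF assms(1,2) Ck_on_vec_nth[OF assms(1,3)]] by simp
qed

text \<open>
  The columns of the adjugate of a Jacobian matrix have divergence zero.  With \<open>K\<close> the inverse of the
  Jacobian matrix \<open>J\<close>, Jacobi's formula gives the derivative of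
  \<open>det J\<close>, and differentiating \<open>K J = 1\<close> gives that of \<open>K\<close>.  The two resulting triple sums differ only
  by exchanging the two differentiation indices in the second derivatives of \<open>\<tau>\<close>, so they cancel.
\<close>

lemma Piola_identity:
  fixes \<tau> :: "real^'n::finite \<Rightarrow> real^'n"
  assumes S: "open S" "x \<in> S" and \<tau>: "Ck_on 2 S \<tau>" and nz: "\<And>y. y \<in> S \<Longrightarrow> det (jac \<tau> y) \<noteq> 0"
  shows "(\<Sum>i\<in>UNIV. partial i (\<lambda>y. det (jac \<tau> y) * matrix_inv (jac \<tau> y) $ i $ j) x) = 0"
proof -
  define J where "J = jac \<tau>"
  define K where "K y = matrix_inv (J y)" for y
  define D where "D y = det (J y)" for y
  define H where "H i b a = partial i (\<lambda>y. J y $ b $ a) x" for i b a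
  have \<tau>': "Ck_on (Suc (Suc 0)) S \<tau>" using \<tau> by (simp add: numeral_2_eq_2)
  have J1: "Ck_on (Suc 0) S (\<lambda>y. J y $ a $ b)" for a b
    unfolding J_def by (rule Ck_on_jac[OF S(1) \<tau>'])
  have K1: "Ck_on (Suc 0) S (\<lambda>y. K y $ a $ b)" for a b
    unfolding K_def by (rule Ck_on_matrix_inv[OF S(1) J1]) (simp add: J_def nz)
  note dJ = Ck_on_has_derivative[OF J1 S] and dK = Ck_on_has_derivative[OF K1 S]
  have nzx: "det (J x) \<noteq> 0" using nz S by (simp add: J_def)
  have KJ: "(\<Sum>c\<in>UNIV. K y $ a $ c * J y $ c $ b) = (if a = b then 1 else 0)" if "y \<in> S" for y a b
    using matrix_inv_works(2)[of "J y"] nz[OF that]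
    by (simp add: J_def K_def matrix_matrix_mult_def mat_def vec_eq_iff)
  have JK: "(\<Sum>c\<in>UNIV. J x $ a $ c * K x $ c $ b) = (if a = b then 1 else 0)" for a b
    using matrix_inv_works(1)[of "J x"] nzx
    by (simp add: K_def matrix_matrix_mult_def mat_def vec_eq_iff)
  have dD: "(D has_derivative (\<lambda>h. D x * (\<Sum>a\<in>UNIV. \<Sum>b\<in>UNIV. K x $ a $ b *
      frechet_derivative (\<lambda>y. J y $ b $ a) (at x) h))) (at x)"
    unfolding D_def K_def by (rule has_derivative_det[OF dJ nzx])
  \<comment> \<open>Jacobi's formula\<close>
  have pD: "partial i D x = D x * (\<Sum>a\<in>UNIV. \<Sum>b\<in>UNIV. K x $ a $ b * H i b a)" for i
    unfolding has_derivative_partial[OF dD, of i] H_def by (simp only: partial_def)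
  \<comment> \<open>differentiate \<open>K J = 1\<close> and multiply by \<open>K\<close> from the right\<close>
  have pK: "partial i (\<lambda>y. K y $ a $ j) x = - (\<Sum>c\<in>UNIV. \<Sum>b\<in>UNIV. K x $ a $ c * H i c b * K x $ b $ j)" for i a
  proof -
    have *: "(\<Sum>c\<in>UNIV. partial i (\<lambda>y. K y $ a $ c) x * J x $ c $ b) = - (\<Sum>c\<in>UNIV. K x $ a $ c * H i c b)" for b
    proof -
      have "partial i (\<lambda>y. \<Sum>c\<in>UNIV. K y $ a $ c * J y $ c $ b) x
          = (\<Sum>c\<in>UNIV. partial i (\<lambda>y. K y $ a $ c * J y $ c $ b) x)"
        by (rule partial_sum) (rule has_derivative_mult[OF dK dJ])
      also have "\<dots> = (\<Sum>c\<in>UNIV. K x $ a $ c * H i c b) + (\<Sum>c\<in>UNIV. partial i (\<lambda>y. K y $ a $ c) x * J x $ c $ b)"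
        by (simp add: partial_mult[OF dK dJ] sum.distrib H_def)
      also have "partial i (\<lambda>y. \<Sum>c\<in>UNIV. K y $ a $ c * J y $ c $ b) x
          = partial i (\<lambda>y. if a = b then 1 else 0 :: real) x"
        by (rule partial_cong[OF S]) (rule KJ)
      also have "\<dots> = 0" by (simp add: partial_def)
      finally show ?thesis by linarith
    qed
    have "partial i (\<lambda>y. K y $ a $ j) x
        = (\<Sum>c\<in>UNIV. partial i (\<lambda>y. K y $ a $ c) x * (\<Sum>b\<in>UNIV. J x $ c $ b * K x $ b $ j))"
      by (simp add: JK if_distrib[where f = "\<lambda>t. _ * t"] cong: if_cong)
    also have "\<dots> = (\<Sum>b\<in>UNIV. (\<Sum>c\<in>UNIV. partial i (\<lambda>y. K y $ a $ c) x * J x $ c $ b) * K x $ b $ j)"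
      by (simp add: sum_distrib_left sum_distrib_right mult.assoc) (rule sum.swap)
    also have "\<dots> = - (\<Sum>b\<in>UNIV. \<Sum>c\<in>UNIV. K x $ a $ c * H i c b * K x $ b $ j)"
      by (simp add: * sum_negf sum_distrib_right)
    also have "(\<Sum>b\<in>UNIV. \<Sum>c\<in>UNIV. K x $ a $ c * H i c b * K x $ b $ j)
        = (\<Sum>c\<in>UNIV. \<Sum>b\<in>UNIV. K x $ a $ c * H i c b * K x $ b $ j)" by (rule sum.swap)
    finally show ?thesis .
  qed
  have "(\<Sum>i\<in>UNIV. partial i (\<lambda>y. D y * K y $ i $ j) x)
      = (\<Sum>i\<in>UNIV. D x * partial i (\<lambda>y. K y $ i $ j) x + partial i D x * K x $ i $ j)"
    by (simp add: partial_mult[OF dD dK])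
  also have "\<dots> = D x * ((\<Sum>i\<in>UNIV. \<Sum>a\<in>UNIV. \<Sum>b\<in>UNIV. K x $ a $ b * H i b a * K x $ i $ j)
      - (\<Sum>i\<in>UNIV. \<Sum>c\<in>UNIV. \<Sum>b\<in>UNIV. K x $ i $ c * H i c b * K x $ b $ j))"
    by (simp add: pD pK sum.distrib sum_subtractf sum_distrib_left sum_distrib_right sum_negf algebra_simps)
  \<comment> \<open>rename the indices of the first sum until only \<open>H\<close> distinguishes it from the second one\<close>
  also have "(\<Sum>i\<in>UNIV. \<Sum>a\<in>UNIV. \<Sum>b\<in>UNIV. K x $ a $ b * H i b a * K x $ i $ j)
      = (\<Sum>a\<in>UNIV. \<Sum>i\<in>UNIV. \<Sum>b\<in>UNIV. K x $ a $ b * H i b a * K x $ i $ j)"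
    by (rule sum.swap)
  also have "\<dots> = (\<Sum>a\<in>UNIV. \<Sum>b\<in>UNIV. \<Sum>i\<in>UNIV. K x $ a $ b * H i b a * K x $ i $ j)"
    by (rule sum.cong[OF refl]) (rule sum.swap)
  also have "\<dots> = (\<Sum>a\<in>UNIV. \<Sum>b\<in>UNIV. \<Sum>i\<in>UNIV. K x $ a $ b * H a b i * K x $ i $ j)"
    using partial_jac_commute[OF S \<tau>] by (simp add: H_def J_def)
  finally show ?thesis by (simp add: D_def K_def J_def)
qed

text \<open>
  Here \<open>G'\<close> is the pull-back of the metric \<open>G\<close> along the coordinate change \<open>\<tau>\<close>.  With \<open>J\<close> the Jacobian
  matrix, \<open>D\<close> its determinant and \<open>K\<close> its inverse, the density \<open>sqrt (det G')\<close> is \<open>\<bar>D\<bar>\<close> times that of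
  \<open>G\<close>, and the gradient field transforms by \<open>K\<close>.  Thus the weighted gradient of \<open>F \<circ> \<tau>\<close> is the Piola
  transform \<open>\<bar>D\<bar> K (Y \<circ> \<tau>)\<close> of the weighted gradient \<open>Y\<close> of \<open>F\<close>.  By the Piola identity no derivative
  of \<open>D K\<close> survives in its divergence, which is therefore \<open>\<bar>D\<bar>\<close> times the divergence of \<open>Y\<close>.
\<close>

lemma laplacian_coordinate_invariance:
  fixes \<tau> :: "real^'n::finite \<Rightarrow> real^'n" and F :: "real^'n \<Rightarrow> complex"
  assumes S: "open S" "x \<in> S" and T: "open T" "\<tau> ` S \<subseteq> T"
    and \<tau>: "Ck_on 2 S \<tau>" and nz: "\<And>y. y \<in> S \<Longrightarrow> det (jac \<tau> y) \<noteq> 0"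
    and G: "\<And>a b. Ck_on 1 T (\<lambda>z. G z $ a $ b)" "\<And>z. z \<in> T \<Longrightarrow> det (G z) > 0"
    and G': "\<And>y. y \<in> S \<Longrightarrow> G' y = transpose (jac \<tau> y) ** G (\<tau> y) ** jac \<tau> y"
    and F: "Ck_on 2 T F"
  shows "(1 / sqrt (det (G' x))) *\<^sub>R (\<Sum>i\<in>UNIV. partial i (\<lambda>y. sqrt (det (G' y)) *\<^sub>R
        (\<Sum>j\<in>UNIV. matrix_inv (G' y) $ i $ j *\<^sub>R partial j (\<lambda>z. F (\<tau> z)) y)) x)
      = (1 / sqrt (det (G (\<tau> x)))) *\<^sub>R (\<Sum>i\<in>UNIV. partial i (\<lambda>y. sqrt (det (G y)) *\<^sub>R
        (\<Sum>j\<in>UNIV. matrix_inv (G y) $ i $ j *\<^sub>R partial j F y)) (\<tau> x))"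
proof -
  define J where "J = jac \<tau>"
  define K where "K y = matrix_inv (J y)" for y
  define D where "D y = det (J y)" for y
  define Y where "Y a z = sqrt (det (G z)) *\<^sub>R (\<Sum>b\<in>UNIV. matrix_inv (G z) $ a $ b *\<^sub>R partial b F z)" for a z
  define s where "s = sgn (D x)"
  have \<tau>2: "Ck_on (Suc (Suc 0)) S \<tau>" and F2: "Ck_on (Suc (Suc 0)) T F"
    and G1: "Ck_on (Suc 0) T (\<lambda>z. G z $ a $ b)" for a b
    using \<tau> F G(1) by (simp_all add: numeral_2_eq_2)
  note d\<tau> = Ck_on_has_derivative[OF \<tau>2 S(1)]
  have dF: "(F has_derivative frechet_derivative F (at (\<tau> y))) (at (\<tau> y))" if "y \<in> S" for y
    using Ck_on_has_derivative[OF F2 T(1)] T(2) that by blast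
  have J1: "Ck_on (Suc 0) S (\<lambda>y. J y $ a $ b)" for a b
    unfolding J_def by (rule Ck_on_jac[OF S(1) \<tau>2])
  have D1: "Ck_on (Suc 0) S D" unfolding D_def by (rule Ck_on_det[OF S(1) J1])
  have K1: "Ck_on (Suc 0) S (\<lambda>y. K y $ a $ b)" for a b
    unfolding K_def by (rule Ck_on_matrix_inv[OF S(1) J1]) (simp add: J_def nz)
  have DK1: "Ck_on (Suc 0) S (\<lambda>y. D y * K y $ a $ b)" for a b
    by (rule Ck_on_mult[OF S(1) D1 K1])
  have Y1: "Ck_on (Suc 0) T (Y a)" for a
    unfolding Y_def using F2 G(2)
    by (intro Ck_on_scaleR Ck_on_sqrt Ck_on_det Ck_on_sum Ck_on_matrix_inv T(1) G1) (auto simp: less_imp_neq[symmetric])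
  have dY: "(Y a has_derivative frechet_derivative (Y a) (at (\<tau> y))) (at (\<tau> y))" if "y \<in> S" for a y
    using Ck_on_has_derivative[OF Y1 T(1)] T(2) that by blast
  have JK: "J y ** K y = mat 1" "K y ** J y = mat 1" if "y \<in> S" for y
    using matrix_inv_works[of "J y"] nz[OF that] by (simp_all add: J_def K_def)
  have sqrt_det: "sqrt (det (G' y)) = \<bar>D y\<bar> * sqrt (det (G (\<tau> y)))" if "y \<in> S" for y
    using G'[OF that] by (simp add: det_mul det_transpose D_def J_def real_sqrt_mult)
  have inv: "matrix_inv (G' y) ** transpose (J y) = K y ** matrix_inv (G (\<tau> y))" if "y \<in> S" for y
  proof -
    have "det (G (\<tau> y)) \<noteq> 0" using G(2) T(2) that by (metis image_subset_iff less_irrefl)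
    note GG = matrix_inv_works[OF this]
    have tr: "transpose (J y) ** transpose (K y) = mat 1" "transpose (K y) ** transpose (J y) = mat 1"
      using JK[OF that] by (simp_all add: transpose_mat flip: matrix_transpose_mul)
    have "matrix_inv (G' y) = K y ** matrix_inv (G (\<tau> y)) ** transpose (K y)"
    proof (rule matrix_inv_unique)
      have "G' y ** (K y ** matrix_inv (G (\<tau> y)) ** transpose (K y))
          = transpose (J y) ** (G (\<tau> y) ** ((J y ** K y) ** matrix_inv (G (\<tau> y)))) ** transpose (K y)"
        by (simp add: G'[OF that] J_def matrix_mul_assoc)
      then show "G' y ** (K y ** matrix_inv (G (\<tau> y)) ** transpose (K y)) = mat 1"
        by (simp add: JK[OF that] GG tr)
    qed
    then show ?thesis by (simp add: tr flip: matrix_mul_assoc)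
  qed
  have flux: "sqrt (det (G' y)) *\<^sub>R (\<Sum>j\<in>UNIV. matrix_inv (G' y) $ i $ j *\<^sub>R partial j (\<lambda>z. F (\<tau> z)) y)
      = \<bar>D y\<bar> *\<^sub>R (\<Sum>a\<in>UNIV. K y $ i $ a *\<^sub>R Y a (\<tau> y))" if "y \<in> S" for y i
  proof -
    have "(\<Sum>j\<in>UNIV. matrix_inv (G' y) $ i $ j *\<^sub>R partial j (\<lambda>z. F (\<tau> z)) y)
        = (\<Sum>j\<in>UNIV. \<Sum>b\<in>UNIV. (matrix_inv (G' y) $ i $ j * J y $ b $ j) *\<^sub>R partial b F (\<tau> y))"
      by (simp add: has_derivative_partial_compose[OF dF[OF that] d\<tau>[OF that]] scaleR_sum_right J_def jac_def)
    also have "\<dots> = (\<Sum>b\<in>UNIV. (\<Sum>j\<in>UNIV. matrix_inv (G' y) $ i $ j * J y $ b $ j) *\<^sub>R partial b F (\<tau> y))"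
      by (subst sum.swap) (simp add: scaleR_sum_left)
    also have "\<dots> = (\<Sum>b\<in>UNIV. (\<Sum>a\<in>UNIV. K y $ i $ a * matrix_inv (G (\<tau> y)) $ a $ b) *\<^sub>R partial b F (\<tau> y))"
      using inv[OF that] by (simp add: matrix_matrix_mult_def transpose_def vec_eq_iff)
    also have "\<dots> = (\<Sum>b\<in>UNIV. \<Sum>a\<in>UNIV. K y $ i $ a *\<^sub>R matrix_inv (G (\<tau> y)) $ a $ b *\<^sub>R partial b F (\<tau> y))"
      by (simp add: scaleR_sum_left)
    also have "\<dots> = (\<Sum>a\<in>UNIV. \<Sum>b\<in>UNIV. K y $ i $ a *\<^sub>R matrix_inv (G (\<tau> y)) $ a $ b *\<^sub>R partial b F (\<tau> y))"
      by (rule sum.swap)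
    finally show ?thesis
      by (simp add: sqrt_det[OF that] Y_def scaleR_sum_right mult_ac)
  qed
  \<comment> \<open>the sign of \<open>D\<close> is locally constant, so near \<open>x\<close> the absolute value can be replaced by a constant factor\<close>
  define S' where "S' = S \<inter> D -` {t. s * t > 0}"
  have "D x \<noteq> 0" using nz S by (simp add: D_def J_def)
  then have sD: "s * D x > 0" "\<bar>D x\<bar> = s * D x" by (auto simp: s_def sgn_if)
  have S': "open S'" "x \<in> S'"
  proof -
    have "continuous_on S D" using D1 by (simp add: differentiable_imp_continuous_on)
    moreover have "open {t. s * t > 0}" by (intro open_Collect_less continuous_intros)
    ultimately show "open S'" unfolding S'_def using S(1) by (simp add: continuous_on_open_vimage Int_commute del: vimage_Collect_eq)
    show "x \<in> S'" using S sD by (simp add: S'_def)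
  qed
  have abs_D: "\<bar>D y\<bar> = s * D y" if "y \<in> S'" for y
    using that \<open>D x \<noteq> 0\<close> by (auto simp: S'_def s_def sgn_if split: if_splits)
  note dDK = Ck_on_has_derivative[OF DK1 S]
  have dYt: "((\<lambda>y. Y a (\<tau> y)) has_derivative
      (\<lambda>h. frechet_derivative (Y a) (at (\<tau> x)) (frechet_derivative \<tau> (at x) h))) (at x)" for a
    by (rule has_derivative_compose[OF d\<tau>[OF S(2)] dY[OF S(2)]])
  have div: "partial i (\<lambda>y. sqrt (det (G' y)) *\<^sub>R
        (\<Sum>j\<in>UNIV. matrix_inv (G' y) $ i $ j *\<^sub>R partial j (\<lambda>z. F (\<tau> z)) y)) x
      = s *\<^sub>R (\<Sum>a\<in>UNIV. partial i (\<lambda>y. D y * K y $ i $ a) x *\<^sub>R Y a (\<tau> x)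
          + (D x * K x $ i $ a) *\<^sub>R (\<Sum>b\<in>UNIV. J x $ b $ i *\<^sub>R partial b (Y a) (\<tau> x)))" (is "?l = ?r") for i
  proof -
    have "?l = partial i (\<lambda>y. s *\<^sub>R (\<Sum>a\<in>UNIV. (D y * K y $ i $ a) *\<^sub>R Y a (\<tau> y))) x"
    proof (rule partial_cong[OF S'])
      fix y assume "y \<in> S'"
      then show "sqrt (det (G' y)) *\<^sub>R
          (\<Sum>j\<in>UNIV. matrix_inv (G' y) $ i $ j *\<^sub>R partial j (\<lambda>z. F (\<tau> z)) y)
        = s *\<^sub>R (\<Sum>a\<in>UNIV. (D y * K y $ i $ a) *\<^sub>R Y a (\<tau> y))"
        using flux[of y i] abs_D[of y] by (simp add: S'_def scaleR_sum_right[of "D y"] scaleR_scaleR[symmetric] del: scaleR_scaleR)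
    qed
    also have "\<dots> = s *\<^sub>R (\<Sum>a\<in>UNIV. partial i (\<lambda>y. (D y * K y $ i $ a) *\<^sub>R Y a (\<tau> y)) x)"
      by (subst partial_scaleR_const, rule has_derivative_sum, rule has_derivative_scaleR[OF dDK dYt])
        (subst partial_sum, rule has_derivative_scaleR[OF dDK dYt], rule refl)
    also have "\<dots> = ?r"
      by (simp add: partial_scaleR[OF dDK dYt] has_derivative_partial_compose[OF dY[OF S(2)] d\<tau>[OF S(2)]]
          J_def jac_def add.commute)
    finally show ?thesis .
  qed
  have "(\<Sum>i\<in>UNIV. partial i (\<lambda>y. sqrt (det (G' y)) *\<^sub>R
        (\<Sum>j\<in>UNIV. matrix_inv (G' y) $ i $ j *\<^sub>R partial j (\<lambda>z. F (\<tau> z)) y)) x)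
      = s *\<^sub>R ((\<Sum>i\<in>UNIV. \<Sum>a\<in>UNIV. partial i (\<lambda>y. D y * K y $ i $ a) x *\<^sub>R Y a (\<tau> x))
        + (\<Sum>i\<in>UNIV. \<Sum>a\<in>UNIV. \<Sum>b\<in>UNIV. (D x * (J x $ b $ i * K x $ i $ a)) *\<^sub>R partial b (Y a) (\<tau> x)))"
    unfolding div by (simp add: sum.distrib scaleR_sum_right scaleR_add_right mult_ac)
  also have "(\<Sum>i\<in>UNIV. \<Sum>a\<in>UNIV. partial i (\<lambda>y. D y * K y $ i $ a) x *\<^sub>R Y a (\<tau> x))
      = (\<Sum>a\<in>UNIV. (\<Sum>i\<in>UNIV. partial i (\<lambda>y. D y * K y $ i $ a) x) *\<^sub>R Y a (\<tau> x))"
    by (subst sum.swap) (simp add: scaleR_sum_left)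
  also have "\<dots> = 0"
    using Piola_identity[OF S \<tau> nz] by (simp add: D_def K_def J_def)
  also have "(\<Sum>i\<in>UNIV. \<Sum>a\<in>UNIV. \<Sum>b\<in>UNIV. (D x * (J x $ b $ i * K x $ i $ a)) *\<^sub>R partial b (Y a) (\<tau> x))
      = (\<Sum>a\<in>UNIV. \<Sum>i\<in>UNIV. \<Sum>b\<in>UNIV. (D x * (J x $ b $ i * K x $ i $ a)) *\<^sub>R partial b (Y a) (\<tau> x))"
    by (rule sum.swap)
  also have "\<dots> = (\<Sum>a\<in>UNIV. \<Sum>b\<in>UNIV. \<Sum>i\<in>UNIV. (D x * (J x $ b $ i * K x $ i $ a)) *\<^sub>R partial b (Y a) (\<tau> x))"
    by (rule sum.cong[OF refl]) (rule sum.swap)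
  also have "\<dots> = (\<Sum>a\<in>UNIV. \<Sum>b\<in>UNIV. (D x * (\<Sum>i\<in>UNIV. J x $ b $ i * K x $ i $ a)) *\<^sub>R partial b (Y a) (\<tau> x))"
    by (simp add: scaleR_sum_left sum_distrib_left)
  also have "\<dots> = (\<Sum>a\<in>UNIV. \<Sum>b\<in>UNIV. (if b = a then D x *\<^sub>R partial b (Y a) (\<tau> x) else 0))"
    using JK(1)[OF S(2)] by (intro sum.cong refl) (simp add: matrix_matrix_mult_def vec_eq_iff mat_def)
  also have "\<dots> = D x *\<^sub>R (\<Sum>a\<in>UNIV. partial a (Y a) (\<tau> x))"
    by (simp add: scaleR_sum_right)
  finally have main: "(\<Sum>i\<in>UNIV. partial i (\<lambda>y. sqrt (det (G' y)) *\<^sub>R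
        (\<Sum>j\<in>UNIV. matrix_inv (G' y) $ i $ j *\<^sub>R partial j (\<lambda>z. F (\<tau> z)) y)) x)
      = \<bar>D x\<bar> *\<^sub>R (\<Sum>a\<in>UNIV. partial a (Y a) (\<tau> x))"
    using sD by simp
  show ?thesis
    unfolding main sqrt_det[OF S(2)] using \<open>D x \<noteq> 0\<close> by (simp add: Y_def[abs_def])
qed

section \<open>The Laplace--Beltrami operator on test functions\<close>

text \<open>
  Every matrix on the segment from the identity to \<open>A\<close> is positive definite and hence invertible, so
  the determinant cannot change sign along it.
\<close>

lemma pos_def_imp_det_pos:
  fixes A :: "real^'m^'m::finite"
  assumes "\<And>v. v \<noteq> 0 \<Longrightarrow> v \<bullet> (A *v v) > 0"
  shows "det A > 0"
proof (rule ccontr)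
  assume "\<not> det A > 0"
  define B where "B t = (\<chi> i j. t * A $ i $ j + (1 - t) * (mat 1 :: real^'m^'m) $ i $ j)" for t
  have B: "B t *v v = t *\<^sub>R (A *v v) + (1 - t) *\<^sub>R v" for t v
  proof -
    have unit_row: "(\<Sum>j\<in>UNIV. (mat 1 :: real^'m^'m) $ i $ j * v $ j) = v $ i" for i
      using arg_cong[OF matrix_vector_mul_lid[of v], of "\<lambda>w. w $ i"] by (simp add: matrix_vector_mult_def)
    have "(B t *v v) $ i = t * (\<Sum>j\<in>UNIV. A $ i $ j * v $ j)
        + (1 - t) * (\<Sum>j\<in>UNIV. (mat 1 :: real^'m^'m) $ i $ j * v $ j)" for i
      by (simp add: B_def matrix_vector_mult_def distrib_right sum.distrib sum_distrib_left mult.assoc)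
    then show ?thesis
      unfolding unit_row by (simp add: vec_eq_iff matrix_vector_mult_def)
  qed
  have "continuous_on {0..1} (\<lambda>t. det (B t))"
    unfolding det_def B_def by (simp, intro continuous_intros)
  moreover have "det (B 1) \<le> 0" "0 \<le> det (B 0)"
  proof -
    have "B 1 = A" "B 0 = mat 1" by (simp_all add: B_def vec_eq_iff)
    then show "det (B 1) \<le> 0" "0 \<le> det (B 0)" using \<open>\<not> det A > 0\<close> by simp_all
  qed
  ultimately obtain t where t: "0 \<le> t" "t \<le> 1" "det (B t) = 0"
    using IVT2'[of "\<lambda>t. det (B t)" 1 0 0] by auto
  then have "\<not> invertible (B t)" by (simp add: invertible_det_nz)
  then have "\<not> (\<forall>v. B t *v v = 0 \<longrightarrow> v = 0)"
    unfolding invertible_left_inverse matrix_left_invertible_ker .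
  then obtain v where v: "v \<noteq> 0" "B t *v v = 0" by blast
  have "t * (v \<bullet> (A *v v)) + (1 - t) * (v \<bullet> v) = v \<bullet> (B t *v v)"
    by (simp only: B inner_add_right inner_scaleR_right)
  then have "t * (v \<bullet> (A *v v)) + (1 - t) * (v \<bullet> v) = 0" by (simp add: v(2))
  moreover have "t * (v \<bullet> (A *v v)) \<ge> 0" "(1 - t) * (v \<bullet> v) \<ge> 0"
    using t assms[OF v(1)] by simp_all
  ultimately have "t * (v \<bullet> (A *v v)) = 0" "(1 - t) * (v \<bullet> v) = 0" by linarith+
  then have "t = 0" "1 - t = 0" using assms[OF v(1)] v(1) by simp_all
  then show False by simp
qed

locale riemannian =
  fixes M :: "('a::{metric_space,second_countable_topology}, 'n::finite) riem"
  assumes riemannian: "riemannian_manifold M"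
begin

lemma atlas: "smooth_atlas (charts M)" and metric: "riemannian_metric M"
  and measure: "is_riemannian_measure M"
  and dist_eq: "ennreal (dist p q) = riemannian_distance M p q"
  using riemannian by (simp_all add: riemannian_manifold_def)

lemma charts_cover: "(\<Union>c\<in>charts M. fst c) = UNIV"
  using atlas by (simp add: smooth_atlas_def)

lemma
  assumes "c \<in> charts M"
  shows chart_open: "open (fst c)" "open (snd c ` fst c)"
    and chart_homeo: "homeomorphism (fst c) (snd c ` fst c) (snd c) (chart_inv c)"
  using atlas assms unfolding smooth_atlas_def by auto

lemma transition_smooth:
  assumes "c \<in> charts M" "d \<in> charts M"
  shows "smooth_on (snd c ` (fst c \<inter> fst d)) (snd d \<circ> chart_inv c)"
  using atlas assms unfolding smooth_atlas_def by auto

lemma metric_smooth: "c \<in> charts M \<Longrightarrow> smooth_on (snd c ` fst c) (gmat M c)"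
  using metric by (simp add: riemannian_metric_def)

lemma metric_pos:
  assumes "c \<in> charts M" "x \<in> snd c ` fst c" "v \<noteq> 0"
  shows "v \<bullet> (gmat M c x *v v) > 0"
proof -
  from metric have "\<forall>c\<in>charts M. \<forall>x\<in>snd c ` fst c. \<forall>v. v \<noteq> 0 \<longrightarrow> v \<bullet> (gmat M c x *v v) > 0"
    unfolding riemannian_metric_def by blast
  with assms show ?thesis by blast
qed

lemma metric_transform:
  assumes "c \<in> charts M" "d \<in> charts M" "p \<in> fst c" "p \<in> fst d"
  shows "gmat M c (snd c p) = transpose (jac (snd d \<circ> chart_inv c) (snd c p)) ** gmat M d (snd d p)
      ** jac (snd d \<circ> chart_inv c) (snd c p)"
proof -
  from metric have "\<forall>c\<in>charts M. \<forall>d\<in>charts M. \<forall>p\<in>fst c \<inter> fst d.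
        (let J = jacobian (snd d \<circ> chart_inv c) (at (snd c p)) in
          gmat M c (snd c p) = transpose J ** gmat M d (snd d p) ** J)"
    unfolding riemannian_metric_def by (rule conjunct2)
  with assms show ?thesis by (simp only: Let_def jac_eq_jacobian) blast
qed

lemma sets_vol: "sets (vol M) = sets borel"
  using measure by (simp add: is_riemannian_measure_def)

lemma chart_inv_snd: "c \<in> charts M \<Longrightarrow> p \<in> fst c \<Longrightarrow> chart_inv c (snd c p) = p"
  using chart_homeo homeomorphism_apply1 by blast

lemma chart_at: "chart_at M p \<in> charts M" "p \<in> fst (chart_at M p)"
proof -
  have "\<exists>c. c \<in> charts M \<and> p \<in> fst c" using charts_cover by blast
  from someI_ex[OF this] show "chart_at M p \<in> charts M" "p \<in> fst (chart_at M p)"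
    by (simp_all add: chart_at_def)
qed

lemma open_chart_image:
  assumes "c \<in> charts M" "open V" "V \<subseteq> fst c"
  shows "open (snd c ` V)"
proof -
  have "openin (top_of_set (snd c ` fst c)) (snd c ` V)"
    using homeomorphism_imp_open_map[OF chart_homeo[OF assms(1)], of V] assms(2,3)
    by (simp add: open_subset)
  then show ?thesis using chart_open(2)[OF assms(1)] by (simp add: openin_open_eq)
qed

lemma open_chart_inv_image:
  assumes "c \<in> charts M" "open W" "W \<subseteq> snd c ` fst c"
  shows "open (chart_inv c ` W)"
proof -
  have "openin (top_of_set (fst c)) (chart_inv c ` W)"
    using homeomorphism_imp_open_map[OF homeomorphism_symD[OF chart_homeo[OF assms(1)]], of W] assms(2,3)
    by (simp add: open_subset)
  then show ?thesis using chart_open(1)[OF assms(1)] by (simp add: openin_open_eq)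
qed

lemma det_metric_pos: "c \<in> charts M \<Longrightarrow> x \<in> snd c ` fst c \<Longrightarrow> det (gmat M c x) > 0"
  by (rule pos_def_imp_det_pos) (rule metric_pos)

lemma Ck_metric: "c \<in> charts M \<Longrightarrow> Ck_on k (snd c ` fst c) (\<lambda>x. gmat M c x $ a $ b)"
  using metric_smooth chart_open(2) by (intro Ck_on_vec_nth) (auto simp: smooth_on_def)

lemma laplace_beltrami_coord_cong:
  assumes "open S" "x \<in> S" "\<And>y. y \<in> S \<Longrightarrow> F y = F' y"
  shows "laplace_beltrami_coord M c F x = laplace_beltrami_coord M c F' x"
proof -
  have "partial j F y = partial j F' y" if "y \<in> S" for j y
    by (rule partial_cong[OF assms(1) that assms(3)])
  then have "partial i (\<lambda>y. sqrt (det (gmat M c y)) *\<^sub>R (\<Sum>j\<in>UNIV. (ginv M c y $ i $ j) *\<^sub>R partial j F y)) x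
    = partial i (\<lambda>y. sqrt (det (gmat M c y)) *\<^sub>R (\<Sum>j\<in>UNIV. (ginv M c y $ i $ j) *\<^sub>R partial j F' y)) x" for i
    by (intro partial_cong[OF assms(1,2)]) simp
  then show ?thesis by (simp add: laplace_beltrami_coord_def)
qed

text \<open>
  The coordinate invariance above, applied to the transition map; its Jacobian determinant is
  nonzero because it relates two metrics with positive determinant.
\<close>

lemma laplace_beltrami_coord_chart_independent:
  assumes c: "c \<in> charts M" and d: "d \<in> charts M" and p: "p \<in> fst c" "p \<in> fst d"
    and f: "smooth_fun M f"
  shows "laplace_beltrami_coord M c (f \<circ> chart_inv c) (snd c p)
    = laplace_beltrami_coord M d (f \<circ> chart_inv d) (snd d p)"
proof -
  define S where "S = snd c ` (fst c \<inter> fst d)"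
  define \<tau> where "\<tau> = snd d \<circ> chart_inv c"
  define T where "T = snd d ` fst d"
  have S: "open S" "snd c p \<in> S"
    using p open_chart_image[OF c open_Int[OF chart_open(1)[OF c] chart_open(1)[OF d]]]
    by (auto simp: S_def)
  have \<tau>S: "\<tau> ` S \<subseteq> T" using c by (auto simp: S_def \<tau>_def T_def chart_inv_snd)
  have \<tau>p: "\<tau> (snd c p) = snd d p" using c p by (simp add: \<tau>_def chart_inv_snd)
  have trans: "gmat M c y = transpose (jac \<tau> y) ** gmat M d (\<tau> y) ** jac \<tau> y" if y: "y \<in> S" for y
  proof -
    obtain q where q: "q \<in> fst c" "q \<in> fst d" "y = snd c q" using y by (auto simp: S_def)
    show ?thesis using metric_transform[OF c d q(1,2)] q c by (simp add: \<tau>_def chart_inv_snd)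
  qed
  have nz: "det (jac \<tau> y) \<noteq> 0" if "y \<in> S" for y
  proof -
    have "y \<in> snd c ` fst c" using that by (auto simp: S_def)
    from det_metric_pos[OF c this] show ?thesis
      using trans[OF that] by (auto simp: det_mul)
  qed
  have "laplace_beltrami_coord M c (f \<circ> chart_inv c) (snd c p)
      = laplace_beltrami_coord M c (\<lambda>y. (f \<circ> chart_inv d) (\<tau> y)) (snd c p)"
    by (rule laplace_beltrami_coord_cong[OF S])
      (use c d in \<open>auto simp: S_def \<tau>_def chart_inv_snd\<close>)
  also have "\<dots> = laplace_beltrami_coord M d (f \<circ> chart_inv d) (\<tau> (snd c p))"
    unfolding laplace_beltrami_coord_def ginv_def
  proof (rule laplacian_coordinate_invariance[where T = T, OF S _ \<tau>S _ nz _ _ trans])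
    show "open T" using chart_open(2)[OF d] by (simp add: T_def)
    show "Ck_on 2 S \<tau>" using transition_smooth[OF c d] by (simp add: S_def \<tau>_def smooth_on_def)
    show "Ck_on 1 T (\<lambda>z. gmat M d z $ a $ b)" for a b unfolding T_def by (rule Ck_metric[OF d])
    show "det (gmat M d z) > 0" if "z \<in> T" for z using det_metric_pos[OF d] that by (simp add: T_def)
    show "Ck_on 2 T (f \<circ> chart_inv d)" using f d by (simp add: smooth_fun_def smooth_on_def T_def)
  qed
  finally show ?thesis by (simp add: \<tau>p)
qed

text \<open>
  In a fixed chart \<open>c\<close>, the function \<open>lap M f\<close> is given throughout by the coordinate expression of that
  chart, although by definition it is computed in a chart that varies with the point.
\<close>

lemma smooth_lap:
  assumes f: "smooth_fun M f"
  shows "smooth_fun M (lap M f)"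
  unfolding smooth_fun_def
proof
  fix c assume c: "c \<in> charts M"
  let ?S = "snd c ` fst c"
  note S = chart_open(2)[OF c]
  have F: "Ck_on k ?S (f \<circ> chart_inv c)" for k using f c by (simp add: smooth_fun_def smooth_on_def)
  have dF: "Ck_on k ?S (partial j (f \<circ> chart_inv c))" for k j using F[of "Suc k"] by simp
  have nz: "det (gmat M c x) \<noteq> 0" if "x \<in> ?S" for x
    using det_metric_pos[OF c that] by simp
  have sq: "Ck_on k ?S (\<lambda>y. sqrt (det (gmat M c y)))" for k
    by (intro Ck_on_sqrt S Ck_on_det Ck_metric[OF c] det_metric_pos[OF c])
  define X where "X i y = sqrt (det (gmat M c y)) *\<^sub>R
        (\<Sum>j\<in>UNIV. (ginv M c y $ i $ j) *\<^sub>R partial j (f \<circ> chart_inv c) y)" for i y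
  have X: "Ck_on k ?S (X i)" for k i
    unfolding X_def ginv_def
    by (intro Ck_on_scaleR S sq Ck_on_sum Ck_on_matrix_inv Ck_metric[OF c] dF nz)
  have dX: "Ck_on k ?S (partial i (X i))" for k i using X[of "Suc k"] by simp
  have "Ck_on k ?S (\<lambda>x. inverse (sqrt (det (gmat M c x))) *\<^sub>R (\<Sum>i\<in>UNIV. partial i (X i) x))" for k
    by (intro Ck_on_scaleR Ck_on_inverse S sq Ck_on_sum dX) (simp add: nz)
  from Ck_on_bounded_linear[OF bounded_linear_minus[OF bounded_linear_ident] S this]
  have "Ck_on k ?S (\<lambda>x. - laplace_beltrami_coord M c (f \<circ> chart_inv c) x)" for k
    by (simp add: laplace_beltrami_coord_def X_def[abs_def] divide_inverse)
  moreover have "(lap M f \<circ> chart_inv c) x = - laplace_beltrami_coord M c (f \<circ> chart_inv c) x"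
    if x: "x \<in> ?S" for x
  proof -
    obtain p where p: "p \<in> fst c" "x = snd c p" using x by auto
    show ?thesis
      using laplace_beltrami_coord_chart_independent[OF chart_at(1) c chart_at(2) p(1) f] c p
      by (simp add: lap_def Let_def chart_inv_snd)
  qed
  ultimately show "smooth_on ?S (lap M f \<circ> chart_inv c)"
    by (simp add: smooth_on_def Ck_on_cong[OF S, of "lap M f \<circ> chart_inv c"
        "\<lambda>x. - laplace_beltrami_coord M c (f \<circ> chart_inv c) x"])
qed

lemma lap_eq_0_outside_support:
  assumes "p \<notin> closure {q. f q \<noteq> 0}"
  shows "lap M f p = 0"
proof -
  let ?c = "chart_at M p"
  let ?V = "fst ?c \<inter> - closure {q. f q \<noteq> 0}"
  have V: "open (snd ?c ` ?V)" "snd ?c p \<in> snd ?c ` ?V"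
    using open_chart_image[OF chart_at(1)[of p] open_Int[OF chart_open(1)[OF chart_at(1)[of p]]
          open_Compl[OF closed_closure]]] chart_at(2)[of p] assms by auto
  have "laplace_beltrami_coord M ?c (f \<circ> chart_inv ?c) (snd ?c p)
      = laplace_beltrami_coord M ?c (\<lambda>y. 0) (snd ?c p)"
  proof (rule laplace_beltrami_coord_cong[OF V])
    fix y assume "y \<in> snd ?c ` ?V"
    then obtain q where q: "q \<in> fst ?c" "q \<notin> closure {q. f q \<noteq> 0}" "y = snd ?c q" by blast
    then have "f q = 0" using closure_subset[of "{q. f q \<noteq> 0}"] by auto
    with q show "(f \<circ> chart_inv ?c) y = 0" by (simp add: chart_inv_snd[OF chart_at(1)])
  qed
  also have "\<dots> = 0" by (simp add: laplace_beltrami_coord_def partial_def)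
  finally show ?thesis by (simp add: lap_def Let_def)
qed

lemma lap_test_function:
  assumes "\<phi> \<in> test_functions M S"
  shows "lap M \<phi> \<in> test_functions M S"
proof -
  have "{p. lap M \<phi> p \<noteq> 0} \<subseteq> closure {p. \<phi> p \<noteq> 0}"
    using lap_eq_0_outside_support[of _ \<phi>] by auto
  then have sub: "closure {p. lap M \<phi> p \<noteq> 0} \<subseteq> closure {p. \<phi> p \<noteq> 0}"
    by (simp add: closure_minimal)
  then have "compact (closure {p. lap M \<phi> p \<noteq> 0})"
    using assms compact_Int_closed[of "closure {p. \<phi> p \<noteq> 0}" "closure {p. lap M \<phi> p \<noteq> 0}"]
    by (simp add: test_functions_def Int_absorb1)
  with sub show ?thesis using assms smooth_lap by (auto simp: test_functions_def)
qed

lemma lap_funpow_test_function: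
  "\<phi> \<in> test_functions M S \<Longrightarrow> (lap M ^^ k) \<phi> \<in> test_functions M S"
  by (induction k) (auto intro: lap_test_function)

lemma smooth_fun_continuous:
  assumes "smooth_fun M f"
  shows "continuous_on UNIV f"
proof -
  have "isCont f p" for p
  proof -
    let ?c = "chart_at M p"
    have "continuous_on (snd ?c ` fst ?c) (f \<circ> chart_inv ?c)"
    proof -
      have "Ck_on 0 (snd ?c ` fst ?c) (f \<circ> chart_inv ?c)"
        using assms chart_at(1)[of p] unfolding smooth_fun_def smooth_on_def by blast
      then show ?thesis by simp
    qed
    moreover have "continuous_on (fst ?c) (snd ?c)"
      using chart_homeo[OF chart_at(1)] by (simp add: homeomorphism_def)
    ultimately have "continuous_on (fst ?c) ((f \<circ> chart_inv ?c) \<circ> snd ?c)"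
      by (rule continuous_on_compose[rotated])
    then have "continuous_on (fst ?c) f"
      by (rule continuous_on_eq) (simp add: chart_inv_snd[OF chart_at(1)])
    then show ?thesis
      using chart_at[of p] chart_open(1)[OF chart_at(1)[of p]] by (simp add: continuous_on_eq_continuous_at)
  qed
  then show ?thesis by (simp add: continuous_at_imp_continuous_on)
qed

end

section \<open>Compactness of closed balls\<close>

text \<open>
  The speed of a curve is computed in charts that are chosen pointwise, so it need not be measurable.
  The integral of such a function is a lower integral, and it is attained by a measurable minorant,
  to which additivity and change of variables apply.
\<close>

lemma measurable_minorant:
  fixes f :: "'a \<Rightarrow> ennreal"
  obtains g where "g \<in> borel_measurable N" "\<And>x. g x \<le> f x" "integral\<^sup>N N g = integral\<^sup>N N f"
proof -
  let ?A = "{g. simple_function N g \<and> g \<le> f}"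
  have "(\<lambda>x. 0) \<in> ?A" by (simp add: le_fun_def)
  then have "integral\<^sup>S N ` ?A \<noteq> {}" by blast
  from ennreal_Sup_countable_SUP[OF this]
  obtain s :: "nat \<Rightarrow> ennreal" where s: "range s \<subseteq> integral\<^sup>S N ` ?A" "Sup (integral\<^sup>S N ` ?A) = (SUP i. s i)"
    by blast
  have "\<forall>i. \<exists>g. g \<in> ?A \<and> s i = integral\<^sup>S N g"
    using s(1) by (auto simp: image_iff subset_iff)
  from choice[OF this] obtain G where "\<forall>i. G i \<in> ?A \<and> s i = integral\<^sup>S N (G i)" by blast
  then have G: "simple_function N (G i)" "G i \<le> f" "s i = integral\<^sup>S N (G i)" for i by auto
  define g where "g x = (SUP i. G i x)" for x
  have meas: "g \<in> borel_measurable N"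
    unfolding g_def using G(1) by (intro borel_measurable_SUP) (auto intro: borel_measurable_simple_function)
  have le: "g x \<le> f x" for x
    unfolding g_def using G(2) by (intro SUP_least) (simp add: le_fun_def)
  have "s i \<le> integral\<^sup>N N g" for i
  proof -
    have "s i = integral\<^sup>N N (G i)" using G by (simp add: nn_integral_eq_simple_integral)
    also have "\<dots> \<le> integral\<^sup>N N g"
      unfolding g_def by (rule nn_integral_mono) (rule SUP_upper[OF UNIV_I])
    finally show ?thesis .
  qed
  then have "integral\<^sup>N N f \<le> integral\<^sup>N N g"
    using s(2) by (simp add: nn_integral_def[of N f] SUP_least)
  moreover have "integral\<^sup>N N g \<le> integral\<^sup>N N f"
    by (rule nn_integral_mono) (rule le)
  ultimately have "integral\<^sup>N N g = integral\<^sup>N N f" by (rule antisym[rotated])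
  with that meas le show ?thesis by blast
qed

lemma affine_measurable_minorant:
  fixes h :: "real \<Rightarrow> ennreal" and a b :: real
  assumes "a < b"
  obtains G where "G \<in> borel_measurable borel" "\<And>u. G u \<le> h u * indicator {a..b} u"
    "integral\<^sup>N lborel G = (\<integral>\<^sup>+s\<in>{0..1}. ennreal (b - a) * h (a + (b - a) * s) \<partial>lborel)"
proof -
  obtain g where g: "g \<in> borel_measurable lborel"
    "\<And>s. g s \<le> ennreal (b - a) * h (a + (b - a) * s) * indicator {0..1} s"
    "integral\<^sup>N lborel g = (\<integral>\<^sup>+s\<in>{0..1}. ennreal (b - a) * h (a + (b - a) * s) \<partial>lborel)"
    using measurable_minorant[of lborel "\<lambda>s. ennreal (b - a) * h (a + (b - a) * s) * indicator {0..1} s"]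
    by blast
  note [measurable] = g(1)[simplified]
  define G where "G u = ennreal (inverse (b - a)) * g ((u - a) / (b - a))" for u
  have inv: "ennreal (inverse (b - a)) * ennreal (b - a) = 1"
    using assms by (simp flip: ennreal_mult)
  have Gm: "G \<in> borel_measurable borel" unfolding G_def by measurable
  have "G u \<le> h u * indicator {a..b} u" for u
  proof -
    have "G u \<le> ennreal (inverse (b - a)) * (ennreal (b - a) * h (a + (b - a) * ((u - a) / (b - a))) *
        indicator {0..1} ((u - a) / (b - a)))"
      unfolding G_def by (rule mult_left_mono[OF g(2)]) simp
    also have "\<dots> = (ennreal (inverse (b - a)) * ennreal (b - a)) * (h u * indicator {0..1} ((u - a) / (b - a)))"
      using assms by (simp add: mult.assoc)
    also have "indicator {0..1} ((u - a) / (b - a)) = (indicator {a..b} u :: ennreal)"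
      using assms by (auto simp: indicator_def field_simps)
    finally show ?thesis by (simp add: inv)
  qed
  moreover have "integral\<^sup>N lborel G = integral\<^sup>N lborel g"
  proof -
    have "integral\<^sup>N lborel G = ennreal (b - a) * (\<integral>\<^sup>+s. G (a + (b - a) * s) \<partial>lborel)"
      using nn_integral_real_affine[OF Gm, of "b - a" a] assms by simp
    also have "(\<integral>\<^sup>+s. G (a + (b - a) * s) \<partial>lborel) = (\<integral>\<^sup>+s. ennreal (inverse (b - a)) * g s \<partial>lborel)"
      using assms by (simp add: G_def)
    also have "\<dots> = ennreal (inverse (b - a)) * integral\<^sup>N lborel g"
      by (rule nn_integral_cmult) simp
    finally show ?thesis by (simp add: mult.assoc[symmetric] inv mult.commute[of "ennreal (b - a)"])
  qed
  ultimately show ?thesis using that Gm g(3) by simp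
qed

text \<open>
  Superadditivity of lower integrals, with both halves of the interval rescaled to \<open>{0..1}\<close>.
\<close>

lemma nn_integral_split_affine:
  fixes h :: "real \<Rightarrow> ennreal"
  assumes "0 < t" "t < 1"
  shows "(\<integral>\<^sup>+s\<in>{0..1}. ennreal t * h (t * s) \<partial>lborel)
      + (\<integral>\<^sup>+s\<in>{0..1}. ennreal (1 - t) * h (t + (1 - t) * s) \<partial>lborel)
    \<le> (\<integral>\<^sup>+s\<in>{0..1}. h s \<partial>lborel)"
proof -
  obtain G1 where G1: "G1 \<in> borel_measurable borel" "\<And>u. G1 u \<le> h u * indicator {0..t} u"
    "integral\<^sup>N lborel G1 = (\<integral>\<^sup>+s\<in>{0..1}. ennreal t * h (t * s) \<partial>lborel)"
    using affine_measurable_minorant[OF assms(1), of h] by auto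
  obtain G2 where G2: "G2 \<in> borel_measurable borel" "\<And>u. G2 u \<le> h u * indicator {t..1} u"
    "integral\<^sup>N lborel G2 = (\<integral>\<^sup>+s\<in>{0..1}. ennreal (1 - t) * h (t + (1 - t) * s) \<partial>lborel)"
    using affine_measurable_minorant[OF assms(2), of h] by auto
  have "(\<integral>\<^sup>+u. G1 u + G2 u \<partial>lborel) \<le> (\<integral>\<^sup>+u\<in>{0..1}. h u \<partial>lborel)"
  proof (rule nn_integral_mono_AE)
    \<comment> \<open>the two minorants overlap only in the point \<open>t\<close>\<close>
    have "G1 u + G2 u \<le> h u * indicator {0..1} u" if "u \<noteq> t" for u
    proof -
      have "G1 u + G2 u \<le> h u * indicator {0..t} u + h u * indicator {t..1} u"
        by (intro add_mono G1 G2)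
      also have "\<dots> = h u * indicator {0..1} u"
        using that assms by (auto simp: indicator_def)
      finally show ?thesis .
    qed
    then show "AE u in lborel. G1 u + G2 u \<le> h u * indicator {0..1} u"
      using AE_lborel_singleton[of t] by (auto elim: eventually_mono)
  qed
  then show ?thesis using G1 G2 by (simp add: nn_integral_add)
qed

text \<open>
  The metric Hopf--Rinow theorem (Cohn-Vossen): a complete, locally compact space with approximate
  intermediate points has compact closed balls.  Let \<open>s\<close> be the supremum of the radii of compact balls
  around \<open>p\<close>.  By approximate intermediate points, each point of the ball of radius \<open>s\<close> is close to
  a slightly smaller ball, which is compact; hence the ball of radius \<open>s\<close> is totally bounded and thus
  compact.  Likewise, a slightly larger ball lies in an arbitrarily thin neighbourhood of the ball of
  radius \<open>s\<close>, hence in a finite union of compact balls.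
\<close>

lemma proper_metric_space:
  assumes complete: "complete (UNIV :: 'a::metric_space set)"
    and loc: "\<And>p :: 'a. \<exists>r>0. compact (cball p r)"
    and mid: "\<And>(p :: 'a) q a e. 0 < a \<Longrightarrow> a < dist p q \<Longrightarrow> e > 0 \<Longrightarrow>
      \<exists>z. dist p z = a \<and> dist z q \<le> dist p q - a + e"
  shows "compact (cball (p :: 'a) R)"
proof (rule ccontr)
  assume R: "\<not> compact (cball p R)"
  define A where "A = {r. 0 \<le> r \<and> compact (cball p r)}"
  have smaller: "compact (cball p r)" if "r \<le> r'" "compact (cball p r')" for r r'
    using that compact_Int_closed[OF that(2) closed_cball[of p r]] subset_cball[OF that(1), of p]
    by (simp add: Int_absorb1)
  have bdd: "r \<le> R" if "r \<in> A" for r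
    using smaller[of R r] R that by (force simp: A_def)
  then have bdd_above: "bdd_above A" by (rule bdd_aboveI)
  obtain r0 where r0: "r0 > 0" "compact (cball p r0)" using loc by blast
  then have "r0 \<in> A" by (simp add: A_def)
  define s where "s = Sup A"
  have "r0 \<le> s" unfolding s_def using \<open>r0 \<in> A\<close> bdd_above by (rule cSup_upper)
  with r0 have s: "s > 0" by simp
  have below: "compact (cball p r)" if r: "r < s" for r
  proof -
    obtain r' where "r' \<in> A" "r < r'"
      using less_cSupD[of A r] r \<open>r0 \<in> A\<close> by (auto simp: s_def)
    then show ?thesis using smaller[of r r'] by (simp add: A_def)
  qed
  \<comment> \<open>The supremum is attained: a finite net for the ball of radius \<open>s - d\<close> is a coarser net for that of radius \<open>s\<close>.\<close>
  have cs: "compact (cball p s)"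
    unfolding compact_eq_totally_bounded
  proof (intro conjI allI impI)
    show "complete (cball p s)" by (rule complete_closed_subset[OF closed_cball subset_UNIV complete])
    fix e :: real assume e: "e > 0"
    define d where "d = min (e/4) (s/2)"
    have d: "d > 0" "d \<le> e/4" "d < s" using e s by (auto simp: d_def)
    have "compact (cball p (s - d))" using d by (intro below) simp
    then obtain k where k: "finite k" "cball p (s - d) \<subseteq> (\<Union>x\<in>k. ball x (e/4))"
      unfolding compact_eq_totally_bounded using e by (meson divide_pos_pos zero_less_numeral)
    have "x \<in> (\<Union>x\<in>k. ball x e)" if x: "x \<in> cball p s" for x
    proof -
      have "\<exists>z. z \<in> cball p (s - d) \<and> dist z x \<le> e/2"
      proof (cases "dist p x \<le> s - d")
        case True
        then show ?thesis using e by (intro exI[of _ x]) simp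
      next
        case False
        then obtain z where "dist p z = s - d" "dist z x \<le> dist p x - (s - d) + e/4"
          using mid[of "s - d" p x "e/4"] d e by auto
        then show ?thesis using d x by (intro exI[of _ z]) simp
      qed
      then obtain z where z: "z \<in> cball p (s - d)" "dist z x \<le> e/2" by blast
      then obtain y where y: "y \<in> k" "dist y z < e/4" using k(2) by auto
      have "dist y x < e" using dist_triangle[of y x z] z(2) y(2) e by linarith
      with y show ?thesis by auto
    qed
    with k(1) show "\<exists>k. finite k \<and> cball p s \<subseteq> (\<Union>x\<in>k. ball x e)" by blast
  qed
  \<comment> \<open>The supremum can be exceeded: the compact ball has a neighbourhood of width \<open>\<delta>\<close> covered by finitely many compact balls.\<close>
  obtain \<rho> where \<rho>: "\<And>x :: 'a. \<rho> x > 0" "\<And>x. compact (cball x (\<rho> x))" using loc by metis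
  have "\<exists>C. C \<subseteq> cball p s \<and> finite C \<and> cball p s \<subseteq> (\<Union>x\<in>C. ball x (\<rho> x))"
  proof -
    have "cball p s \<subseteq> (\<Union>x\<in>cball p s. ball x (\<rho> x))" using \<rho>(1) by auto
    then show ?thesis by (rule compactE_image[OF cs open_ball]) (intro exI conjI, assumption+)
  qed
  then obtain C where C: "finite C" "cball p s \<subseteq> (\<Union>x\<in>C. ball x (\<rho> x))" by blast
  obtain \<delta> where \<delta>: "\<delta> > 0" "(\<Union>x\<in>cball p s. ball x \<delta>) \<subseteq> (\<Union>x\<in>C. ball x (\<rho> x))"
    by (rule compact_subset_open_imp_ball_epsilon_subset[OF cs _ C(2)]) auto
  have sub: "cball p (s + \<delta>/2) \<subseteq> (\<Union>x\<in>C. cball x (\<rho> x))"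
  proof
    fix x assume x: "x \<in> cball p (s + \<delta>/2)"
    have "\<exists>z. z \<in> cball p s \<and> dist z x < \<delta>"
    proof (cases "dist p x \<le> s")
      case True
      then show ?thesis using \<delta>(1) by (intro exI[of _ x]) simp
    next
      case False
      then obtain z where "dist p z = s" "dist z x \<le> dist p x - s + \<delta>/4"
        using mid[of s p x "\<delta>/4"] s \<delta>(1) by auto
      then show ?thesis using x \<delta>(1) by (intro exI[of _ z]) simp
    qed
    then have "x \<in> (\<Union>x\<in>cball p s. ball x \<delta>)" by auto
    then have "x \<in> (\<Union>x\<in>C. ball x (\<rho> x))" using \<delta>(2) by blast
    then show "x \<in> (\<Union>x\<in>C. cball x (\<rho> x))" by (auto intro: less_imp_le)
  qed
  have "compact (\<Union>x\<in>C. cball x (\<rho> x))" using C(1) \<rho>(2) by (intro compact_UN) auto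
  then have "compact (cball p (s + \<delta>/2))"
    using compact_Int_closed[OF _ closed_cball[of p "s + \<delta>/2"]] sub by (force simp: Int_absorb1)
  then have "s + \<delta>/2 \<in> A" using s \<delta>(1) by (simp add: A_def)
  then have "s + \<delta>/2 \<le> s" unfolding s_def by (intro cSup_upper bdd_above)
  with \<delta>(1) show False by simp
qed

lemma tangent_norm_scaleR: "tangent_norm M c x (r *\<^sub>R v) = \<bar>r\<bar> * tangent_norm M c x v"
proof -
  have "(r *\<^sub>R v) \<bullet> (gmat M c x *v (r *\<^sub>R v)) = r\<^sup>2 * (v \<bullet> (gmat M c x *v v))"
    by (simp add: matrix_vector_mult_scaleR power2_eq_square)
  then show ?thesis by (simp add: tangent_norm_def real_sqrt_mult)
qed

lemma piecewise_C1_subcurve: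
  assumes \<gamma>: "piecewise_C1_curve M \<gamma>" and ab: "0 \<le> a" "a < b" "b \<le> 1"
  shows "piecewise_C1_curve M (\<lambda>s. \<gamma> (a + (b - a) * s))"
proof -
  define A where "A s = a + (b - a) * s" for s
  have inj: "inj A" using ab by (auto simp: inj_def A_def)
  have range: "A s \<in> {0<..<1}" if "s \<in> {0<..<1}" for s
  proof -
    have "0 < (b - a) * s" "(b - a) * s < b - a" using that ab by auto
    then show ?thesis using ab unfolding A_def greaterThanLessThan_iff by (intro conjI) linarith+
  qed
  have dA: "(A has_vector_derivative (b - a)) (at s)" for s
    unfolding A_def[abs_def] by (auto intro!: derivative_eq_intros simp flip: has_real_derivative_iff_has_vector_derivative)
  have contA: "continuous_on S A" for S unfolding A_def[abs_def] by (intro continuous_intros)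
  obtain F where F: "finite F" "\<And>c. c \<in> charts M \<Longrightarrow>
      (snd c \<circ> \<gamma>) C1_differentiable_on ({t \<in> {0<..<1}. \<gamma> t \<in> fst c} - F)"
    using \<gamma> by (auto simp: piecewise_C1_curve_def)
  have "A ` {0..1} \<subseteq> {0..1}"
  proof
    fix u assume "u \<in> A ` {0..1}"
    then obtain s where s: "0 \<le> s" "s \<le> 1" "u = a + (b - a) * s" by (auto simp: A_def)
    then have "0 \<le> (b - a) * s" "(b - a) * s \<le> b - a" using ab mult_left_le[of s "b - a"] by auto
    then show "u \<in> {0..1}" using s ab unfolding s(3) atLeastAtMost_iff by (intro conjI) linarith+
  qed
  then have "continuous_on {0..1} (\<gamma> \<circ> A)"
    using \<gamma> by (intro continuous_on_compose[OF contA], elim continuous_on_subset[rotated])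
      (simp add: piecewise_C1_curve_def)
  moreover have "finite (A -` F)" using F(1) inj by (rule finite_vimageI)
  moreover have "(snd c \<circ> (\<gamma> \<circ> A)) C1_differentiable_on ({s \<in> {0<..<1}. (\<gamma> \<circ> A) s \<in> fst c} - A -` F)"
    (is "_ C1_differentiable_on ?S'") if c: "c \<in> charts M" for c
  proof -
    let ?S = "{t \<in> {0<..<1}. \<gamma> t \<in> fst c} - F"
    obtain D where D: "\<And>t. t \<in> ?S \<Longrightarrow> ((snd c \<circ> \<gamma>) has_vector_derivative D t) (at t)" "continuous_on ?S D"
      using F(2)[OF c] unfolding C1_differentiable_on_def by blast
    have S': "A ` ?S' \<subseteq> ?S" using range by auto
    have "((snd c \<circ> (\<gamma> \<circ> A)) has_vector_derivative (b - a) *\<^sub>R D (A s)) (at s)" if "s \<in> ?S'" for s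
    proof -
      have "A s \<in> ?S" using S' that by (rule set_mp[OF _ imageI])
      from vector_diff_chain_at[OF dA D(1)[OF this]] show ?thesis unfolding comp_assoc .
    qed
    moreover have "continuous_on ?S' (\<lambda>s. (b - a) *\<^sub>R D (A s))"
      using continuous_on_compose2[OF D(2) contA S'] by (intro continuous_intros)
    ultimately show ?thesis
      unfolding C1_differentiable_on_def
      by (intro exI[of _ "\<lambda>s. (b - a) *\<^sub>R D (A s)"] conjI ballI)
  qed
  ultimately have "piecewise_C1_curve M (\<gamma> \<circ> A)"
    unfolding piecewise_C1_curve_def by (intro conjI exI[of _ "A -` F"] ballI)
  then show ?thesis by (simp add: comp_def A_def)
qed

context riemannian begin

definition speed :: "(real \<Rightarrow> 'a) \<Rightarrow> real \<Rightarrow> ennreal" where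
  "speed \<gamma> t = ennreal (let c = chart_at M (\<gamma> t) in
     tangent_norm M c (snd c (\<gamma> t)) (vector_derivative (snd c \<circ> \<gamma>) (at t)))"

text \<open>
  The chain rule holds off the finite exceptional set of the curve and off the end points, where
  \<open>piecewise_C1_curve\<close> requires no differentiability; this is a null set.
\<close>

lemma curve_length_subcurve:
  assumes \<gamma>: "piecewise_C1_curve M \<gamma>" and ab: "0 \<le> a" "a < b" "b \<le> 1"
  shows "curve_length M (\<lambda>s. \<gamma> (a + (b - a) * s))
    = (\<integral>\<^sup>+s\<in>{0..1}. ennreal (b - a) * speed \<gamma> (a + (b - a) * s) \<partial>lborel)"
proof -
  define A where "A s = a + (b - a) * s" for s
  have inj: "inj A" using ab by (auto simp: inj_def A_def)
  have dA: "(A has_vector_derivative (b - a)) (at s)" for s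
    unfolding A_def[abs_def] by (auto intro!: derivative_eq_intros simp flip: has_real_derivative_iff_has_vector_derivative)
  obtain F where F: "finite F" "\<And>c. c \<in> charts M \<Longrightarrow>
      (snd c \<circ> \<gamma>) C1_differentiable_on ({t \<in> {0<..<1}. \<gamma> t \<in> fst c} - F)"
    using \<gamma> by (auto simp: piecewise_C1_curve_def)
  let ?N = "A -` F \<union> {0, 1}"
  have "finite ?N" using F(1) inj by (simp add: finite_vimageI)
  have pointwise: "speed (\<gamma> \<circ> A) s = ennreal (b - a) * speed \<gamma> (A s)" if s: "s \<in> {0..1}" "s \<notin> ?N" for s
  proof -
    let ?c = "chart_at M (\<gamma> (A s))"
    have "0 < s" "s < 1" using s by auto
    then have "0 < (b - a) * s" "(b - a) * s < b - a" using ab by auto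
    then have "0 < A s" "A s < 1" using ab unfolding A_def by linarith+
    then have "A s \<in> {t \<in> {0<..<1}. \<gamma> t \<in> fst ?c} - F"
      using s chart_at(2) by auto
    then obtain D where "((snd ?c \<circ> \<gamma>) has_vector_derivative D) (at (A s))"
      using F(2)[OF chart_at(1)] unfolding C1_differentiable_on_def by blast
    from vector_derivative_at[OF this] vector_derivative_at[OF vector_diff_chain_at[OF dA this]]
    have D: "vector_derivative (snd ?c \<circ> \<gamma>) (at (A s)) = D"
      "vector_derivative (snd ?c \<circ> (\<gamma> \<circ> A)) (at s) = (b - a) *\<^sub>R D"
      unfolding comp_assoc .
    show ?thesis
      using ab unfolding speed_def Let_def comp_apply[of \<gamma> A] D tangent_norm_scaleR
      by (simp add: ennreal_mult')
  qed
  have "curve_length M (\<gamma> \<circ> A) = (\<integral>\<^sup>+s\<in>{0..1}. speed (\<gamma> \<circ> A) s \<partial>lborel)"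
    by (simp add: curve_length_def speed_def)
  also have "\<dots> = (\<integral>\<^sup>+s\<in>{0..1}. ennreal (b - a) * speed \<gamma> (A s) \<partial>lborel)"
  proof (rule nn_integral_cong_AE)
    have "AE s in lborel. s \<notin> ?N"
      using finite_imp_null_set_lborel[OF \<open>finite ?N\<close>] by (rule AE_not_in)
    then show "AE s in lborel. speed (\<gamma> \<circ> A) s * indicator {0..1} s
        = ennreal (b - a) * speed \<gamma> (A s) * indicator {0..1} s"
      by eventually_elim (auto simp: indicator_def pointwise)
  qed
  finally show ?thesis by (simp add: comp_def A_def)
qed

text \<open>
  On a curve from \<open>p\<close> to \<open>q\<close> that is almost of minimal length, take the point at distance \<open>a\<close> from \<open>p\<close>,
  which exists by continuity.  Both parts of the curve are competitors for the respective distances,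
  and their lengths add up to at most the length of the whole curve.
\<close>

lemma approximate_intermediate_point:
  fixes p q :: 'a
  assumes a: "0 < a" "a < dist p q" and e: "e > 0"
  shows "\<exists>z. dist p z = a \<and> dist z q \<le> dist p q - a + e"
proof -
  have "riemannian_distance M p q < ennreal (dist p q + e)"
    using e by (simp add: ennreal_lessI flip: dist_eq)
  then obtain \<gamma> where \<gamma>: "piecewise_C1_curve M \<gamma>" "\<gamma> 0 = p" "\<gamma> 1 = q" "curve_length M \<gamma> < ennreal (dist p q + e)"
    unfolding riemannian_distance_def INF_less_iff by auto
  have "continuous_on {0..1} (\<lambda>t. dist p (\<gamma> t))"
    using \<gamma>(1) by (intro continuous_intros) (simp add: piecewise_C1_curve_def)
  then obtain t where t: "0 \<le> t" "t \<le> 1" "dist p (\<gamma> t) = a"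
    using IVT'[of "\<lambda>t. dist p (\<gamma> t)" 0 a 1] a \<gamma>(2,3) by auto
  have "t \<noteq> 0" "t \<noteq> 1" using t a \<gamma>(2,3) by auto
  with t have t01: "0 < t" "t < 1" by auto
  have d1: "ennreal (dist p (\<gamma> t)) \<le> curve_length M (\<lambda>s. \<gamma> (0 + (t - 0) * s))"
    unfolding dist_eq riemannian_distance_def
    using piecewise_C1_subcurve[OF \<gamma>(1), of 0 t] t01 \<gamma>(2) by (intro INF_lower) auto
  have d2: "ennreal (dist (\<gamma> t) q) \<le> curve_length M (\<lambda>s. \<gamma> (t + (1 - t) * s))"
    unfolding dist_eq riemannian_distance_def
    using piecewise_C1_subcurve[OF \<gamma>(1), of t 1] t01 \<gamma>(3) by (intro INF_lower) auto
  have "ennreal (dist p (\<gamma> t)) + ennreal (dist (\<gamma> t) q)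
      \<le> (\<integral>\<^sup>+s\<in>{0..1}. ennreal t * speed \<gamma> (t * s) \<partial>lborel)
      + (\<integral>\<^sup>+s\<in>{0..1}. ennreal (1 - t) * speed \<gamma> (t + (1 - t) * s) \<partial>lborel)"
    using add_mono[OF d1 d2] curve_length_subcurve[OF \<gamma>(1), of 0 t] curve_length_subcurve[OF \<gamma>(1), of t 1] t01
    by simp
  also have "\<dots> \<le> (\<integral>\<^sup>+s\<in>{0..1}. speed \<gamma> s \<partial>lborel)"
    by (rule nn_integral_split_affine[OF t01])
  also have "\<dots> = curve_length M \<gamma>" by (simp add: curve_length_def speed_def)
  also have "\<dots> < ennreal (dist p q + e)" by fact
  finally have "ennreal (a + dist (\<gamma> t) q) < ennreal (dist p q + e)"
    using a by (simp add: t(3))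
  then have "a + dist (\<gamma> t) q < dist p q + e" using a by (simp add: ennreal_less_iff del: ennreal_plus)
  with t(3) show ?thesis by (intro exI[of _ "\<gamma> t"]) simp
qed

text \<open>
  The image of a small closed coordinate ball is a compact neighbourhood.
\<close>

lemma locally_compact: "\<exists>r>0. compact (cball (p :: 'a) r)"
proof -
  let ?c = "chart_at M p"
  note c = chart_at(1)[of p] chart_at(2)[of p]
  obtain r where r: "r > 0" "cball (snd ?c p) r \<subseteq> snd ?c ` fst ?c"
    using chart_open(2)[OF c(1)] c(2) open_contains_cball[of "snd ?c ` fst ?c"] by auto
  let ?K = "chart_inv ?c ` cball (snd ?c p) r"
  have "continuous_on (cball (snd ?c p) r) (chart_inv ?c)"
    by (rule continuous_on_subset[OF homeomorphism_cont2[OF chart_homeo[OF c(1)]] r(2)])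
  then have K: "compact ?K" by (rule compact_continuous_image) (rule compact_cball)
  have "ball (snd ?c p) r \<subseteq> snd ?c ` fst ?c" using r(2) ball_subset_cball by (rule order_trans[rotated])
  from open_chart_inv_image[OF c(1) open_ball this]
  have "open (chart_inv ?c ` ball (snd ?c p) r)" .
  moreover have "p \<in> chart_inv ?c ` ball (snd ?c p) r"
    using r(1) chart_inv_snd[OF c] by (intro image_eqI[of _ _ "snd ?c p"]) auto
  ultimately obtain e where e: "e > 0" "cball p e \<subseteq> chart_inv ?c ` ball (snd ?c p) r"
    unfolding open_contains_cball by auto
  have "chart_inv ?c ` ball (snd ?c p) r \<subseteq> ?K" by (rule image_mono) (rule ball_subset_cball)
  with e(2) have "cball p e \<subseteq> ?K" by (rule order_trans)
  then have "compact (cball p e)"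
    using compact_Int_closed[OF K closed_cball[of p e]] by (simp add: Int_absorb1)
  with e(1) show ?thesis by blast
qed

theorem Hopf_Rinow:
  assumes "complete (UNIV :: 'a set)"
  shows "compact (cball (p :: 'a) r)"
  using assms locally_compact approximate_intermediate_point by (rule proper_metric_space)

end

section \<open>Square-integrable functions as a Hilbert space\<close>

lemma enn_sqrt_ennreal: "0 \<le> r \<Longrightarrow> enn_sqrt (ennreal r) = ennreal (sqrt r)"
  by (simp add: enn_sqrt_def)

lemma enn_sqrt_less_top_iff: "enn_sqrt x < \<infinity> \<longleftrightarrow> x < \<infinity>"
  by (simp add: enn_sqrt_def less_top)

lemma enn_sqrt_mono:
  assumes "x \<le> y"
  shows "enn_sqrt x \<le> enn_sqrt y"
proof (cases "y = \<infinity>")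
  case False
  then have "x \<noteq> \<infinity>" using assms by (metis infinity_ennreal_def top.extremum_unique)
  with False assms show ?thesis
    by (auto simp: enn_sqrt_def less_top intro!: ennreal_leI enn2real_mono)
qed (simp add: enn_sqrt_def)

lemma L2_iff:
  "f \<in> L2 N \<longleftrightarrow> f \<in> borel_measurable N \<and> integrable N (\<lambda>x. (cmod (f x))\<^sup>2)"
  unfolding L2_def L2_norm_def mem_Collect_eq enn_sqrt_less_top_iff
  by (auto simp: integrable_iff_bounded)

lemma L2_measurable: "f \<in> L2 N \<Longrightarrow> f \<in> borel_measurable N"
  and L2_square_integrable: "f \<in> L2 N \<Longrightarrow> integrable N (\<lambda>x. (cmod (f x))\<^sup>2)"
  by (simp_all add: L2_iff)

lemma nn_integral_L2:
  assumes "f \<in> L2 N"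
  shows "(\<integral>\<^sup>+x. ennreal ((cmod (f x))\<^sup>2) \<partial>N) = ennreal (LINT x|N. (cmod (f x))\<^sup>2)"
  using assms by (intro nn_integral_eq_integral) (auto simp: L2_iff)

lemma L2_norm_eq: "f \<in> L2 N \<Longrightarrow> L2_norm N f = ennreal (sqrt (LINT x|N. (cmod (f x))\<^sup>2))"
  unfolding L2_norm_def nn_integral_L2 by (simp add: enn_sqrt_ennreal)

lemma L2_bounded:
  assumes "integrable N h" "f \<in> borel_measurable N" "\<And>x. (cmod (f x))\<^sup>2 \<le> h x"
  shows "f \<in> L2 N"
  unfolding L2_iff
proof
  have "norm ((cmod (f x))\<^sup>2) \<le> norm (h x)" for x
    using assms(3)[of x] by (simp add: order_trans[OF _ abs_ge_self])
  then show "integrable N (\<lambda>x. (cmod (f x))\<^sup>2)"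
    using assms(2) by (intro Bochner_Integration.integrable_bound[OF assms(1)]) auto
qed (rule assms(2))

lemma cmod_add_square_le: "(cmod (a + b))\<^sup>2 \<le> 2 * (cmod a)\<^sup>2 + 2 * (cmod b)\<^sup>2"
proof -
  have "(cmod (a + b))\<^sup>2 \<le> (cmod a + cmod b)\<^sup>2" by (intro power_mono norm_triangle_ineq) simp
  also have "\<dots> \<le> 2 * (cmod a)\<^sup>2 + 2 * (cmod b)\<^sup>2"
    using zero_le_power2[of "cmod a - cmod b"] by (simp add: power2_eq_square algebra_simps)
  finally show ?thesis .
qed

lemma L2_add:
  assumes "f \<in> L2 N" "g \<in> L2 N"
  shows "(\<lambda>x. f x + g x) \<in> L2 N"
proof (rule L2_bounded)
  show "integrable N (\<lambda>x. 2 * (cmod (f x))\<^sup>2 + 2 * (cmod (g x))\<^sup>2)"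
    using assms by (auto simp: L2_iff)
qed (use assms cmod_add_square_le in \<open>auto simp: L2_iff\<close>)

lemma L2_cmult: "f \<in> L2 N \<Longrightarrow> (\<lambda>x. c * f x) \<in> L2 N"
  by (auto simp: L2_iff norm_mult power_mult_distrib)

lemma L2_diff:
  assumes "f \<in> L2 N" "g \<in> L2 N"
  shows "(\<lambda>x. f x - g x) \<in> L2 N"
  using L2_add[OF assms(1) L2_cmult[OF assms(2), of "-1"]] by simp

lemma L2_cnj: "f \<in> L2 N \<Longrightarrow> (\<lambda>x. cnj (f x)) \<in> L2 N"
  by (simp add: L2_iff bounded_linear.continuous_on[OF bounded_linear_cnj]
      borel_measurable_continuous_on[where f = cnj])

lemma L2_mult_integrable:
  assumes "f \<in> L2 N" "g \<in> L2 N"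
  shows "integrable N (\<lambda>x. f x * g x)"
proof (rule Bochner_Integration.integrable_bound)
  show "integrable N (\<lambda>x. (cmod (f x))\<^sup>2 + (cmod (g x))\<^sup>2)"
    using assms by (auto simp: L2_iff)
  have "cmod (f x * g x) \<le> (cmod (f x))\<^sup>2 + (cmod (g x))\<^sup>2" for x
  proof -
    have "0 \<le> cmod (f x) * cmod (g x)" by simp
    then show ?thesis
      using sum_squares_bound[of "cmod (f x)" "cmod (g x)"] unfolding norm_mult by linarith
  qed
  then show "AE x in N. norm (f x * g x) \<le> norm ((cmod (f x))\<^sup>2 + (cmod (g x))\<^sup>2)" by simp
qed (use assms in \<open>auto simp: L2_iff\<close>)

text \<open>
  The quadratic polynomial in \<open>t\<close> given by the integral of \<open>(\<bar>f\<bar> - t \<bar>g\<bar>)\<^sup>2\<close> is nonnegative.  There is no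
  conjugation on \<open>g\<close>: the form stated covers both the inner product and the pairing with test
  functions.
\<close>

lemma L2_Cauchy_Schwarz:
  assumes f: "f \<in> L2 N" and g: "g \<in> L2 N"
  shows "cmod (LINT x|N. f x * g x) \<le>
    sqrt (LINT x|N. (cmod (f x))\<^sup>2) * sqrt (LINT x|N. (cmod (g x))\<^sup>2)"
proof -
  define a b c where "a = (LINT x|N. (cmod (f x))\<^sup>2)" and "b = (LINT x|N. (cmod (g x))\<^sup>2)"
    and "c = (LINT x|N. cmod (f x) * cmod (g x))"
  have int: "integrable N (\<lambda>x. cmod (f x) * cmod (g x))"
    using integrable_norm[OF L2_mult_integrable[OF f g]] by (simp add: norm_mult)
  note sq = L2_square_integrable[OF f] L2_square_integrable[OF g]
  have nn: "a \<ge> 0" "b \<ge> 0" "c \<ge> 0" by (simp_all add: a_def b_def c_def)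
  have poly: "0 \<le> a - 2 * t * c + t\<^sup>2 * b" for t
  proof -
    have "0 \<le> (LINT x|N. (cmod (f x) - t * cmod (g x))\<^sup>2)" by simp
    also have "(\<lambda>x. (cmod (f x) - t * cmod (g x))\<^sup>2)
        = (\<lambda>x. (cmod (f x))\<^sup>2 - 2 * t * (cmod (f x) * cmod (g x)) + t\<^sup>2 * (cmod (g x))\<^sup>2)"
      by (simp add: power2_eq_square algebra_simps)
    also have "(LINT x|N. \<dots> x) = a - 2 * t * c + t\<^sup>2 * b"
      using int sq by (simp add: a_def b_def c_def)
    finally show ?thesis .
  qed
  have "c\<^sup>2 \<le> a * b"
  proof (cases "b = 0")
    case True
    have "c = 0"
    proof (rule ccontr)
      assume "c \<noteq> 0"
      with nn have "c > 0" by simp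
      with poly[of "(a + 1) / (2 * c)"] True show False by (simp add: field_simps)
    qed
    with True show ?thesis by simp
  next
    case False
    with nn have "b > 0" by simp
    with poly[of "c / b"] show ?thesis by (simp add: field_simps power2_eq_square)
  qed
  then have "c \<le> sqrt (a * b)" by (rule real_le_rsqrt)
  moreover have "cmod (LINT x|N. f x * g x) \<le> c"
    unfolding c_def norm_mult[symmetric] by (rule integral_norm_bound)
  ultimately show ?thesis by (simp add: a_def b_def real_sqrt_mult)
qed

lemma cmod_diff_square: "(cmod (a - b))\<^sup>2 = (cmod a)\<^sup>2 - 2 * Re (a * cnj b) + (cmod b)\<^sup>2"
  unfolding cmod_power2 by (simp add: power2_eq_square algebra_simps)

lemma L2_diff_square_integral:
  assumes "f \<in> L2 N" "g \<in> L2 N"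
  shows "(LINT x|N. (cmod (f x - g x))\<^sup>2) = (LINT x|N. (cmod (f x))\<^sup>2)
    - 2 * Re (LINT x|N. f x * cnj (g x)) + (LINT x|N. (cmod (g x))\<^sup>2)"
proof -
  have int: "integrable N (\<lambda>x. f x * cnj (g x))"
    by (rule L2_mult_integrable[OF assms(1) L2_cnj[OF assms(2)]])
  then have "integrable N (\<lambda>x. Re (f x * cnj (g x)))" by (rule integrable_Re)
  then show ?thesis
    unfolding cmod_diff_square integral_Re[OF int, symmetric]
    using L2_square_integrable[OF assms(1)] L2_square_integrable[OF assms(2)] by (simp del: times_complex.sel)
qed

text \<open>
  Riesz--Fischer for a sequence with geometrically decreasing distances.  The increments \<open>\<Delta> n\<close> satisfy
  \<open>\<Sum>n. 2^n * \<bar>\<Delta> n\<bar>\<^sup>2 < \<infinity>\<close> almost everywhere, since the integral of this sum is at most \<open>\<Sum>n. C / 2^n\<close>.  So they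
  decrease geometrically at almost every point, and the sequence converges there.  Fatou's lemma carries the
  bounds over to the limit.
\<close>

lemma L2_complete:
  assumes q: "\<And>n :: nat. q n \<in> L2 N"
    and Cauchy: "\<And>m n. m \<le> n \<Longrightarrow> (LINT x|N. (cmod (q n x - q m x))\<^sup>2) \<le> C * (1/4)^m"
  obtains h where "h \<in> L2 N" "\<And>m. (LINT x|N. (cmod (q m x - h x))\<^sup>2) \<le> C * (1/4)^m"
proof -
  note [measurable] = L2_measurable[OF q]
  have "0 \<le> (LINT x|N. (cmod (q 0 x - q 0 x))\<^sup>2)" by simp
  also have "\<dots> \<le> C" using Cauchy[of 0 0] by simp
  finally have C: "C \<ge> 0" .
  have nn: "(\<integral>\<^sup>+x. ennreal ((cmod (q n x - q m x))\<^sup>2) \<partial>N) \<le> ennreal (C * (1/4)^m)" if "m \<le> n" for m n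
    using Cauchy[OF that] nn_integral_L2[OF L2_diff[OF q[of n] q[of m]]] by (simp add: ennreal_leI)
  define \<Delta> where "\<Delta> n x = q (Suc n) x - q n x" for n x
  have "(\<integral>\<^sup>+x. (\<Sum>n. ennreal (2^n * (cmod (\<Delta> n x))\<^sup>2)) \<partial>N)
      = (\<Sum>n. \<integral>\<^sup>+x. ennreal (2^n * (cmod (\<Delta> n x))\<^sup>2) \<partial>N)"
    by (rule nn_integral_suminf) (simp add: \<Delta>_def)
  also have "\<dots> \<le> (\<Sum>n. ennreal (C * (1/2)^n))"
  proof (intro suminf_le summableI)
    fix n
    have "(\<integral>\<^sup>+x. ennreal (2^n * (cmod (\<Delta> n x))\<^sup>2) \<partial>N) = ennreal (2^n) * (\<integral>\<^sup>+x. ennreal ((cmod (\<Delta> n x))\<^sup>2) \<partial>N)"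
      by (simp add: ennreal_mult' nn_integral_cmult \<Delta>_def)
    also have "\<dots> \<le> ennreal (2^n) * ennreal (C * (1/4)^n)"
      unfolding \<Delta>_def by (intro mult_left_mono nn) simp_all
    also have "\<dots> = ennreal (2^n * (C * (1/4)^n))" using C by (simp flip: ennreal_mult)
    also have "2^n * (C * (1/4)^n) = C * (1/2 :: real)^n"
      by (simp add: power_divide flip: power_mult_distrib) (simp add: field_simps flip: power_mult_distrib)
    finally show "(\<integral>\<^sup>+x. ennreal (2^n * (cmod (\<Delta> n x))\<^sup>2) \<partial>N) \<le> ennreal (C * (1/2)^n)" .
  qed
  also have "\<dots> = ennreal (\<Sum>n. C * (1/2)^n)"
    using C by (intro suminf_ennreal2) (auto intro!: summable_mult summable_geometric)
  also have "\<dots> < \<infinity>" by simp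
  finally have "(\<integral>\<^sup>+x. (\<Sum>n. ennreal (2^n * (cmod (\<Delta> n x))\<^sup>2)) \<partial>N) \<noteq> \<infinity>" by simp
  then have AE_fin: "AE x in N. (\<Sum>n. ennreal (2^n * (cmod (\<Delta> n x))\<^sup>2)) \<noteq> \<infinity>"
    by (intro nn_integral_noteq_infinite) (auto simp: \<Delta>_def)
  have finite_ennreal: "\<exists>K\<ge>0. T = ennreal K" if "T \<noteq> \<infinity>" for T :: ennreal
    using that by (cases T) auto
  have term_le_suminf: "a n \<le> suminf a" for a :: "nat \<Rightarrow> ennreal" and n
    using sum_le_suminf[of a "{n}"] by (simp add: summableI)
  have convergent_q: "convergent (\<lambda>n. q n x)" if fin: "(\<Sum>n. ennreal (2^n * (cmod (\<Delta> n x))\<^sup>2)) \<noteq> \<infinity>" for x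
  proof -
    obtain K where K: "K \<ge> 0" "(\<Sum>n. ennreal (2^n * (cmod (\<Delta> n x))\<^sup>2)) = ennreal K"
      using finite_ennreal[OF fin] by blast
    have "cmod (\<Delta> n x) \<le> sqrt K * (1 / sqrt 2)^n" for n
    proof -
      have "ennreal (2^n * (cmod (\<Delta> n x))\<^sup>2) \<le> ennreal K"
        unfolding K(2)[symmetric] by (rule term_le_suminf)
      then have "2^n * (cmod (\<Delta> n x))\<^sup>2 \<le> K" using K(1) by simp
      then have "(cmod (\<Delta> n x))\<^sup>2 \<le> K * (1/2)^n" by (simp add: power_divide field_simps)
      then have "cmod (\<Delta> n x) \<le> sqrt (K * (1/2)^n)" by (rule real_le_rsqrt)
      also have "\<dots> = sqrt K * (1 / sqrt 2)^n"
        by (simp add: real_sqrt_mult real_sqrt_power real_sqrt_divide)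
      finally show ?thesis .
    qed
    moreover have "summable (\<lambda>n. sqrt K * (1 / sqrt 2)^n)"
      by (intro summable_mult summable_geometric) simp
    ultimately have "summable (\<lambda>n. \<Delta> n x)" by (rule summable_comparison_test'[rotated])
    then have "convergent (\<lambda>n. q 0 x + (\<Sum>i<n. \<Delta> i x))"
      by (intro convergent_add convergent_const) (simp add: summable_iff_convergent)
    moreover have "q 0 x + (\<Sum>i<n. \<Delta> i x) = q n x" for n
      using sum_lessThan_telescope[of "\<lambda>n. q n x" n] by (simp add: \<Delta>_def)
    ultimately show ?thesis by simp
  qed
  from AE_fin have conv: "AE x in N. convergent (\<lambda>n. q n x)"
    by (rule eventually_mono) (rule convergent_q)
  define h where "h x = lim (\<lambda>n. q n x)" for x
  have [measurable]: "h \<in> borel_measurable N" unfolding h_def by measurable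
  have bound: "(\<integral>\<^sup>+x. ennreal ((cmod (q m x - h x))\<^sup>2) \<partial>N) \<le> ennreal (C * (1/4)^m)" for m
  proof -
    have "(\<integral>\<^sup>+x. ennreal ((cmod (q m x - h x))\<^sup>2) \<partial>N)
        = (\<integral>\<^sup>+x. liminf (\<lambda>n. ennreal ((cmod (q n x - q m x))\<^sup>2)) \<partial>N)"
    proof (rule nn_integral_cong_AE)
      show "AE x in N. ennreal ((cmod (q m x - h x))\<^sup>2) = liminf (\<lambda>n. ennreal ((cmod (q n x - q m x))\<^sup>2))"
        using conv
      proof eventually_elim
        case (elim x)
        then have "(\<lambda>n. q n x) \<longlonglongrightarrow> h x" by (simp add: h_def convergent_LIMSEQ_iff)
        then have "(\<lambda>n. ennreal ((cmod (q n x - q m x))\<^sup>2)) \<longlonglongrightarrow> ennreal ((cmod (h x - q m x))\<^sup>2)"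
          by (intro tendsto_intros)
        then have "liminf (\<lambda>n. ennreal ((cmod (q n x - q m x))\<^sup>2)) = ennreal ((cmod (h x - q m x))\<^sup>2)"
          by (intro lim_imp_Liminf) simp_all
        then show ?case by (simp add: norm_minus_commute)
      qed
    qed
    also have "\<dots> \<le> liminf (\<lambda>n. \<integral>\<^sup>+x. ennreal ((cmod (q n x - q m x))\<^sup>2) \<partial>N)"
      by (rule nn_integral_liminf) simp
    also have "\<dots> \<le> liminf (\<lambda>n :: nat. ennreal (C * (1/4)^m))"
      using nn by (intro Liminf_mono) (auto simp: eventually_sequentially)
    also have "\<dots> = ennreal (C * (1/4)^m)" by (simp add: Liminf_const)
    finally show ?thesis .
  qed
  have dL2: "(\<lambda>x. q m x - h x) \<in> L2 N" for m
    using bound[of m] unfolding L2_def L2_norm_def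
    by (simp add: enn_sqrt_less_top_iff[unfolded infinity_ennreal_def] order.strict_trans1[OF _ ennreal_less_top])
  have "h \<in> L2 N" using L2_diff[OF q[of 0] dL2[of 0]] by simp
  moreover have "(LINT x|N. (cmod (q m x - h x))\<^sup>2) \<le> C * (1/4)^m" for m
    using bound[of m] C unfolding nn_integral_L2[OF dL2] by simp
  ultimately show ?thesis using that by blast
qed

lemma L2_tendsto_integral_mult:
  assumes q: "\<And>n :: nat. q n \<in> L2 N" and h: "h \<in> L2 N" and \<psi>: "\<psi> \<in> L2 N"
    and lim: "(\<lambda>n. LINT x|N. (cmod (q n x - h x))\<^sup>2) \<longlonglongrightarrow> 0"
  shows "(\<lambda>n. LINT x|N. q n x * \<psi> x) \<longlonglongrightarrow> (LINT x|N. h x * \<psi> x)"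
proof (rule LIM_zero_cancel, rule Lim_null_comparison)
  let ?b = "\<lambda>n. sqrt (LINT x|N. (cmod (q n x - h x))\<^sup>2) * sqrt (LINT x|N. (cmod (\<psi> x))\<^sup>2)"
  have "cmod ((LINT x|N. q n x * \<psi> x) - (LINT x|N. h x * \<psi> x)) \<le> ?b n" for n
    using L2_Cauchy_Schwarz[OF L2_diff[OF q h] \<psi>, of n] L2_mult_integrable[OF q \<psi>] L2_mult_integrable[OF h \<psi>]
    by (simp add: left_diff_distrib)
  then show "\<forall>\<^sub>F n in sequentially. cmod ((LINT x|N. q n x * \<psi> x) - (LINT x|N. h x * \<psi> x)) \<le> ?b n"
    by simp
  show "?b \<longlonglongrightarrow> 0"
    using tendsto_mult_left_zero[OF tendsto_real_sqrt[OF lim, simplified]] .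
qed

text \<open>
  The classical argument.  By the parallelogram identity, a sequence in \<open>Q\<close> that minimizes the
  distance to \<open>G\<close> is a Cauchy sequence, and its limit \<open>h\<close> is a point of \<open>Q\<close> nearest to \<open>G\<close>; minimality
  forces \<open>G - h\<close> to be orthogonal to \<open>Q\<close>.  The distances are kept below the infimum plus \<open>1/4^n\<close> to obtain
  the rate needed in \<open>L2_complete\<close>.
\<close>

theorem L2_projection:
  assumes Q: "Q \<subseteq> L2 N" "Q \<noteq> {}"
    and lin: "\<And>f g c. f \<in> Q \<Longrightarrow> g \<in> Q \<Longrightarrow> (\<lambda>x. f x + c * g x) \<in> Q"
    and closed: "\<And>q h. (\<And>n :: nat. q n \<in> Q) \<Longrightarrow> h \<in> L2 N \<Longrightarrow>
      (\<lambda>n. LINT x|N. (cmod (q n x - h x))\<^sup>2) \<longlonglongrightarrow> 0 \<Longrightarrow> h \<in> Q"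
    and G: "G \<in> L2 N"
  obtains w where "w \<in> L2 N" "\<And>v. v \<in> Q \<Longrightarrow> (LINT x|N. w x * cnj (v x)) = 0" "(\<lambda>x. G x - w x) \<in> Q"
proof -
  have QL2: "f \<in> L2 N" if "f \<in> Q" for f using Q(1) that by blast
  have scale: "(\<lambda>x. c * f x) \<in> Q" if "f \<in> Q" for f c
    using lin[OF that that, of "c - 1"] by (simp add: algebra_simps)
  define D where "D q = (LINT x|N. (cmod (G x - q x))\<^sup>2)" for q
  define d where "d = Inf (D ` Q)"
  have bdd: "bdd_below (D ` Q)" by (rule bdd_belowI[of _ 0]) (auto simp: D_def)
  have d_le: "d \<le> D q" if "q \<in> Q" for q
    unfolding d_def using bdd that by (intro cInf_lower) auto
  have "\<exists>q. q \<in> Q \<and> D q < d + (1/4)^n" for n :: nat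
  proof -
    have "Inf (D ` Q) < d + (1/4)^n" by (simp add: d_def)
    then show ?thesis using cInf_lessD[of "D ` Q"] Q(2) by auto
  qed
  then obtain q where q: "\<And>n. q n \<in> Q" "\<And>n :: nat. D (q n) < d + (1/4)^n" by metis
  have "(LINT x|N. (cmod (q n x - q m x))\<^sup>2) \<le> 4 * (1/4)^m" if "m \<le> n" for m n
  proof -
    let ?mid = "\<lambda>x. (1/2) * (q n x + 1 * q m x)"
    have mid: "?mid \<in> Q" by (intro scale lin q)
    have "(LINT x|N. (cmod (q n x - q m x))\<^sup>2)
        = (LINT x|N. 2 * (cmod (G x - q n x))\<^sup>2 + 2 * (cmod (G x - q m x))\<^sup>2 - 4 * (cmod (G x - ?mid x))\<^sup>2)"
      unfolding cmod_power2 by (intro Bochner_Integration.integral_cong refl)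
        (simp add: power2_eq_square field_simps)
    also have "\<dots> = 2 * D (q n) + 2 * D (q m) - 4 * D ?mid"
      unfolding D_def using L2_square_integrable[OF L2_diff[OF G QL2[OF q(1)]]]
        L2_square_integrable[OF L2_diff[OF G QL2[OF mid]]] by simp
    also have "\<dots> \<le> 2 * (1/4)^n + 2 * (1/4)^m"
      using q(2)[of n] q(2)[of m] d_le[OF mid] by linarith
    also have "\<dots> \<le> 4 * (1/4)^m"
      using power_decreasing[OF that, of "1/4 :: real"] by simp
    finally show ?thesis .
  qed
  from L2_complete[OF QL2[OF q(1)] this]
  obtain h where h: "h \<in> L2 N" "\<And>m. (LINT x|N. (cmod (q m x - h x))\<^sup>2) \<le> 4 * (1/4)^m" by blast
  have pow0: "(\<lambda>m. (1/4 :: real)^m) \<longlonglongrightarrow> 0" by (rule LIMSEQ_realpow_zero) simp_all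
  have lim: "(\<lambda>m. LINT x|N. (cmod (q m x - h x))\<^sup>2) \<longlonglongrightarrow> 0"
    by (rule tendsto_sandwich[OF _ _ tendsto_const tendsto_mult_right_zero[OF pow0, of 4]])
      (use h(2) in \<open>auto simp: mult.commute\<close>)
  have hQ: "h \<in> Q" by (rule closed[OF q(1) h(1) lim])
  let ?w = "\<lambda>x. G x - h x"
  have w: "?w \<in> L2 N" by (rule L2_diff[OF G h(1)])
  have "D h \<le> d"
  proof (rule LIMSEQ_le_const)
    let ?e = "\<lambda>n. (1/4 :: real)^n"
    show "(\<lambda>n. (d + ?e n) + 2 * (sqrt (d + ?e n) * sqrt (4 * ?e n)) + 4 * ?e n) \<longlonglongrightarrow> d"
      by (rule tendsto_eq_intros pow0 refl | simp)+
    have "D h \<le> (d + ?e n) + 2 * (sqrt (d + ?e n) * sqrt (4 * ?e n)) + 4 * ?e n" for n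
    proof -
      have f: "(\<lambda>x. G x - q n x) \<in> L2 N" by (rule L2_diff[OF G QL2[OF q(1)]])
      have g: "(\<lambda>x. h x - q n x) \<in> L2 N" by (rule L2_diff[OF h(1) QL2[OF q(1)]])
      have hn: "(LINT x|N. (cmod (h x - q n x))\<^sup>2) \<le> 4 * ?e n"
        using h(2)[of n] by (simp add: norm_minus_commute)
      have "D h = D (q n) - 2 * Re (LINT x|N. (G x - q n x) * cnj (h x - q n x)) + (LINT x|N. (cmod (h x - q n x))\<^sup>2)"
        using L2_diff_square_integral[OF f g] by (simp add: D_def)
      moreover have "0 \<le> D (q n)" by (simp add: D_def)
      moreover have "- Re (LINT x|N. (G x - q n x) * cnj (h x - q n x)) \<le> sqrt (d + ?e n) * sqrt (4 * ?e n)"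
      proof -
        have "- Re (LINT x|N. (G x - q n x) * cnj (h x - q n x)) \<le> cmod (LINT x|N. (G x - q n x) * cnj (h x - q n x))"
          using abs_Re_le_cmod[of "LINT x|N. (G x - q n x) * cnj (h x - q n x)"] by linarith
        also have "\<dots> \<le> sqrt (D (q n)) * sqrt (LINT x|N. (cmod (h x - q n x))\<^sup>2)"
          using L2_Cauchy_Schwarz[OF f L2_cnj[OF g]] unfolding D_def complex_mod_cnj .
        also have "\<dots> \<le> sqrt (d + ?e n) * sqrt (4 * ?e n)"
          using q(2)[of n] hn \<open>0 \<le> D (q n)\<close> by (intro mult_mono real_sqrt_le_mono) auto
        finally show ?thesis .
      qed
      ultimately show ?thesis using q(2)[of n] hn by linarith
    qed
    then show "\<exists>n0. \<forall>n\<ge>n0. D h \<le> (d + ?e n) + 2 * (sqrt (d + ?e n) * sqrt (4 * ?e n)) + 4 * ?e n" by blast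
  qed
  have "(LINT x|N. ?w x * cnj (v x)) = 0" if v: "v \<in> Q" for v
  proof (rule ccontr)
    define z where "z = (LINT x|N. ?w x * cnj (v x))"
    define b where "b = (LINT x|N. (cmod (v x))\<^sup>2)"
    assume "(LINT x|N. ?w x * cnj (v x)) \<noteq> 0"
    then have z: "(cmod z)\<^sup>2 > 0" by (simp add: z_def)
    have b: "b \<ge> 0" by (simp add: b_def)
    \<comment> \<open>any \<open>t > 0\<close> with \<open>t * b < 2\<close> makes \<open>h + t z v\<close> strictly nearer to \<open>G\<close> than \<open>h\<close>\<close>
    define t where "t = 1 / (b + 1)"
    have t: "t > 0" "t * b < 1" using b by (simp_all add: t_def)
    let ?c = "of_real t * z"
    have "D h \<le> D (\<lambda>x. h x + ?c * v x)" using \<open>D h \<le> d\<close> d_le[OF lin[OF hQ v]] by (rule order_trans)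
    also have "D (\<lambda>x. h x + ?c * v x) = (LINT x|N. (cmod (?w x - ?c * v x))\<^sup>2)"
      by (simp add: D_def algebra_simps)
    also have "\<dots> = D h - 2 * Re (LINT x|N. ?w x * cnj (?c * v x)) + (LINT x|N. (cmod (?c * v x))\<^sup>2)"
      using L2_diff_square_integral[OF w L2_cmult[OF QL2[OF v]]] by (simp add: D_def)
    also have "(LINT x|N. ?w x * cnj (?c * v x)) = (LINT x|N. cnj ?c * (?w x * cnj (v x)))"
      by (simp add: mult_ac)
    also have "\<dots> = cnj ?c * z" unfolding z_def by (rule integral_mult_right_zero)
    also have "Re (cnj ?c * z) = t * (cmod z)\<^sup>2"
      unfolding cmod_power2 by (simp add: power2_eq_square algebra_simps)
    also have "(LINT x|N. (cmod (?c * v x))\<^sup>2) = t * (cmod z)\<^sup>2 * (t * b)"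
      by (simp add: norm_mult power_mult_distrib b_def power2_eq_square mult_ac)
    finally have "0 \<le> t * (cmod z)\<^sup>2 * (t * b - 2)" by (simp add: algebra_simps)
    moreover have "t * (cmod z)\<^sup>2 * (t * b - 2) < 0" using t z by (intro mult_pos_neg) auto
    ultimately show False by linarith
  qed
  moreover have "(\<lambda>x. G x - ?w x) \<in> Q" using hQ by simp
  ultimately show ?thesis using that w by blast
qed

section \<open>The GBMO estimate\<close>

lemma L2_restrict_space:
  assumes "f \<in> L2 N" "B \<in> sets N"
  shows "f \<in> L2 (restrict_space N B)"
  unfolding L2_iff
proof
  show "f \<in> borel_measurable (restrict_space N B)"
    by (rule measurable_restrict_space1[OF L2_measurable[OF assms(1)]])
  show "integrable (restrict_space N B) (\<lambda>x. (cmod (f x))\<^sup>2)"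
    using integrable_mult_indicator[OF assms(2) L2_square_integrable[OF assms(1)]] assms(2)
    by (simp add: integrable_restrict_space)
qed

lemma L2_restrict_subset:
  assumes "f \<in> borel_measurable N" "f \<in> L2 (restrict_space N K)" "B \<subseteq> K" "B \<in> sets N" "K \<in> sets N"
  shows "f \<in> L2 (restrict_space N B)"
  unfolding L2_iff
proof
  show "f \<in> borel_measurable (restrict_space N B)" using assms(1) by (rule measurable_restrict_space1)
  have "set_integrable N K (\<lambda>x. (cmod (f x))\<^sup>2)"
    using assms(2,5) by (simp add: L2_iff integrable_restrict_space set_integrable_def)
  from set_integrable_subset[OF this assms(4,3)]
  show "integrable (restrict_space N B) (\<lambda>x. (cmod (f x))\<^sup>2)"
    using assms(4) by (simp add: integrable_restrict_space set_integrable_def)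
qed

lemma L2_norm_restrict_le:
  assumes "B \<in> sets N"
  shows "L2_norm (restrict_space N B) f \<le> L2_norm N f"
  unfolding L2_norm_def using assms
  by (intro enn_sqrt_mono) (auto simp: nn_integral_restrict_space indicator_def intro!: nn_integral_mono)

lemma L2_norm_AE_cong:
  assumes "AE x in N. f x = g x"
  shows "L2_norm N f = L2_norm N g"
proof -
  have "(\<integral>\<^sup>+x. ennreal ((cmod (f x))\<^sup>2) \<partial>N) = (\<integral>\<^sup>+x. ennreal ((cmod (g x))\<^sup>2) \<partial>N)"
    using assms by (intro nn_integral_cong_AE) (auto elim: eventually_mono)
  then show ?thesis by (simp add: L2_norm_def)
qed

lemma L2_norm_cmult:
  assumes "f \<in> L2 N"
  shows "L2_norm N (\<lambda>x. c * f x) = ennreal (cmod c) * L2_norm N f"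
  unfolding L2_norm_eq[OF assms] L2_norm_eq[OF L2_cmult[OF assms]]
  by (simp add: norm_mult power_mult_distrib real_sqrt_mult ennreal_mult')

lemma L2_norm_0_iff:
  assumes "f \<in> borel_measurable N"
  shows "L2_norm N f = 0 \<longleftrightarrow> (AE x in N. f x = 0)"
proof -
  have "enn_sqrt x = 0 \<longleftrightarrow> x = 0" for x
    by (cases x) (auto simp: enn_sqrt_def)
  then show ?thesis
    using assms by (simp add: L2_norm_def nn_integral_0_iff_AE)
qed

text \<open>
  This includes \<open>b = 0\<close>, where \<open>x / 0\<close> is \<open>0\<close> for \<open>x = 0\<close> and \<open>\<infinity>\<close> otherwise.
\<close>

lemma enn_sqrt_divide:
  assumes "x < \<infinity>" "b < \<infinity>"
  shows "enn_sqrt (x / b) = enn_sqrt x / enn_sqrt b"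
proof -
  obtain x' where x: "x = ennreal x'" "x' \<ge> 0" using assms(1) by (cases x) auto
  obtain b' where b: "b = ennreal b'" "b' \<ge> 0" using assms(2) by (cases b) auto
  show ?thesis
  proof (cases "b' = 0")
    case False
    then show ?thesis using x b by (simp add: divide_ennreal enn_sqrt_ennreal real_sqrt_divide)
  next
    case True
    show ?thesis
    proof (cases "x' = 0")
      case True
      then show ?thesis using x by (simp add: enn_sqrt_def)
    next
      case False
      then show ?thesis using x b \<open>b' = 0\<close>
        by (simp add: enn_sqrt_def ennreal_divide_eq_top_iff divide_ennreal_def ennreal_mult_eq_top_iff)
    qed
  qed
qed

lemma lap_distr_funpow: "(lap_distr M ^^ k) T \<phi> = T ((lap M ^^ k) \<phi>)"
proof (induction k arbitrary: \<phi>)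
  case (Suc k)
  have "(lap_distr M ^^ Suc k) T \<phi> = (lap_distr M ^^ k) T (lap M \<phi>)"
    by (simp add: lap_distr_def)
  then show ?case by (simp add: Suc funpow_swap1)
qed simp

lemma test_functions_mono: "S \<subseteq> T \<Longrightarrow> test_functions M S \<subseteq> test_functions M T"
  by (auto simp: test_functions_def)

lemma test_function_eq_0:
  assumes "\<phi> \<in> test_functions M S" "p \<notin> S"
  shows "\<phi> p = 0"
proof (rule ccontr)
  assume "\<phi> p \<noteq> 0"
  then have "p \<in> closure {p. \<phi> p \<noteq> 0}" using closure_subset[of "{p. \<phi> p \<noteq> 0}"] by auto
  then show False using assms by (auto simp: test_functions_def)
qed

text \<open>
  Pythagoras: \<open>v\<close> is the sum of \<open>w\<close> and a vector orthogonal to \<open>w\<close>.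
\<close>

lemma q2_perp_norm_le:
  assumes w: "w \<in> q2_perp M k B" and v: "v \<in> L2 (restrict_space (vol M) B)"
    and diff: "(\<lambda>x. w x - v x) \<in> q2 M k B"
  shows "L2_norm (restrict_space (vol M) B) w \<le> L2_norm (restrict_space (vol M) B) v"
proof -
  let ?N = "restrict_space (vol M) B"
  have wL: "w \<in> L2 ?N" and perp: "(LINT x|?N. w x * cnj (w x - v x)) = 0"
    using w diff by (auto simp: q2_perp_def)
  have dL: "(\<lambda>x. w x - v x) \<in> L2 ?N" using L2_diff[OF wL v] .
  have "(LINT x|?N. (cmod (w x - (w x - v x)))\<^sup>2) = (LINT x|?N. (cmod (w x))\<^sup>2)
      + (LINT x|?N. (cmod (w x - v x))\<^sup>2)"
    unfolding L2_diff_square_integral[OF wL dL] perp by simp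
  moreover have "0 \<le> (LINT x|?N. (cmod (w x - v x))\<^sup>2)" by simp
  ultimately have "(LINT x|?N. (cmod (w x))\<^sup>2) \<le> (LINT x|?N. (cmod (v x))\<^sup>2)" by simp
  then show ?thesis unfolding L2_norm_eq[OF wL] L2_norm_eq[OF v] by (intro ennreal_leI real_sqrt_le_mono)
qed

context riemannian begin

lemma space_vol: "space (vol M) = UNIV"
  using sets_eq_imp_space_eq[OF sets_vol] by simp

lemma borel_measurable_vol: "f \<in> borel_measurable (vol M) \<longleftrightarrow> f \<in> borel_measurable borel"
  using measurable_cong_sets[OF sets_vol refl] by blast

lemma chart_measure:
  assumes "c \<in> charts M" "E \<in> sets borel" "E \<subseteq> fst c"
  shows "emeasure (vol M) E = (\<integral>\<^sup>+x\<in>snd c ` E. ennreal (sqrt (det (gmat M c x))) \<partial>lborel)"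
  using measure assms by (simp add: is_riemannian_measure_def)

text \<open>
  On a compact coordinate ball, the density \<open>sqrt (det g)\<close> is bounded.
\<close>

lemma locally_finite_vol: "\<exists>V. open V \<and> p \<in> V \<and> emeasure (vol M) V < \<infinity>"
proof -
  let ?c = "chart_at M p"
  note c = chart_at(1)[of p] chart_at(2)[of p]
  obtain r where r: "r > 0" "cball (snd ?c p) r \<subseteq> snd ?c ` fst ?c"
    using chart_open(2)[OF c(1)] c(2) open_contains_cball[of "snd ?c ` fst ?c"] by auto
  let ?C = "cball (snd ?c p) r" and ?V = "chart_inv ?c ` ball (snd ?c p) r"
  have bc: "ball (snd ?c p) r \<subseteq> snd ?c ` fst ?c" using r(2) ball_subset_cball by (rule order_trans[rotated])
  have V: "open ?V" by (rule open_chart_inv_image[OF c(1) open_ball bc])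
  have inv: "snd ?c (chart_inv ?c x) = x" "chart_inv ?c x \<in> fst ?c" if "x \<in> snd ?c ` fst ?c" for x
    using chart_homeo[OF c(1)] that chart_inv_snd[OF c(1)] by (auto simp: homeomorphism_def)
  have "snd ?c ` ?V = ball (snd ?c p) r" "?V \<subseteq> fst ?c"
    using inv bc by (force simp: image_image)+
  then have "emeasure (vol M) ?V = (\<integral>\<^sup>+x\<in>ball (snd ?c p) r. ennreal (sqrt (det (gmat M ?c x))) \<partial>lborel)"
    using chart_measure[OF c(1), of ?V] V by simp
  also have "\<dots> < \<infinity>"
  proof -
    have "continuous_on ?C (\<lambda>x. sqrt (det (gmat M ?c x)))"
    proof (rule continuous_on_subset[OF _ r(2)])
      have "Ck_on 0 (snd ?c ` fst ?c) (\<lambda>x. sqrt (det (gmat M ?c x)))"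
        by (intro Ck_on_sqrt chart_open(2) c(1) Ck_on_det Ck_metric det_metric_pos)
      then show "continuous_on (snd ?c ` fst ?c) (\<lambda>x. sqrt (det (gmat M ?c x)))" by simp
    qed
    then have "bounded ((\<lambda>x. sqrt (det (gmat M ?c x))) ` ?C)"
      by (intro compact_imp_bounded compact_continuous_image) simp_all
    then obtain b where "\<forall>y\<in>(\<lambda>x. sqrt (det (gmat M ?c x))) ` ?C. norm y \<le> b"
      unfolding bounded_iff by blast
    from bspec[OF this imageI] have b: "sqrt (det (gmat M ?c x)) \<le> b" if "x \<in> ?C" for x
      using that by fastforce
    have "(\<integral>\<^sup>+x\<in>ball (snd ?c p) r. ennreal (sqrt (det (gmat M ?c x))) \<partial>lborel)
        \<le> (\<integral>\<^sup>+x. ennreal b * indicator ?C x \<partial>lborel)"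
      using b by (intro nn_integral_mono) (simp add: indicator_def ennreal_leI)
    also have "\<dots> = ennreal b * emeasure lborel ?C" by (simp add: nn_integral_cmult_indicator)
    also have "\<dots> < \<infinity>"
      using emeasure_lborel_cball_finite[of "snd ?c p" r] by (simp add: ennreal_mult_less_top)
    finally show ?thesis .
  qed
  finally have "emeasure (vol M) ?V < \<infinity>" .
  moreover have "p \<in> ?V"
    using r(1) chart_inv_snd[OF c] by (intro image_eqI[of _ _ "snd ?c p"]) auto
  ultimately show ?thesis using V by blast
qed

lemma compact_vol_finite:
  assumes "compact (K :: 'a set)"
  shows "emeasure (vol M) K < \<infinity>"
proof -
  have "\<forall>p. \<exists>V. open V \<and> p \<in> V \<and> emeasure (vol M) V < \<infinity>" using locally_finite_vol by blast
  from choice[OF this] obtain V where "\<forall>p. open (V p) \<and> p \<in> V p \<and> emeasure (vol M) (V p) < \<infinity>" by blast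
  then have V: "\<And>p. open (V p)" "\<And>p. p \<in> V p" "\<And>p. emeasure (vol M) (V p) < \<infinity>" by auto
  have "K \<subseteq> (\<Union>p\<in>K. V p)" using V(2) by auto
  then obtain C where C: "C \<subseteq> K" "finite C" "K \<subseteq> (\<Union>p\<in>C. V p)"
    by (rule compactE_image[OF assms V(1)])
  have "emeasure (vol M) K \<le> emeasure (vol M) (\<Union>p\<in>C. V p)"
    using V(1) by (intro emeasure_mono C) (auto simp: sets_vol intro!: borel_open)
  also have "\<dots> \<le> (\<Sum>p\<in>C. emeasure (vol M) (V p))"
    using V(1) by (intro emeasure_subadditive_finite C) (auto simp: sets_vol)
  also have "\<dots> < \<infinity>" using C(2) V(3) by simp
  finally show ?thesis .
qed

lemma test_function_bounded:
  assumes "\<phi> \<in> test_functions M S"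
  obtains K b where "compact K" "\<And>p. p \<notin> K \<Longrightarrow> \<phi> p = 0" "\<And>p. cmod (\<phi> p) \<le> b"
    "\<phi> \<in> borel_measurable (vol M)"
proof -
  let ?K = "closure {p. \<phi> p \<noteq> 0}"
  have K: "compact ?K" using assms by (simp add: test_functions_def)
  have cont: "continuous_on UNIV \<phi>"
    using assms by (intro smooth_fun_continuous) (simp add: test_functions_def)
  then have "bounded (\<phi> ` ?K)"
    by (intro compact_imp_bounded compact_continuous_image K continuous_on_subset[OF cont]) simp
  then obtain b where b: "\<And>p. p \<in> ?K \<Longrightarrow> cmod (\<phi> p) \<le> b" unfolding bounded_iff by auto
  have out: "\<phi> p = 0" if "p \<notin> ?K" for p
    using that closure_subset[of "{p. \<phi> p \<noteq> 0}"] by auto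
  have "cmod (\<phi> p) \<le> max b 0" for p using b[of p] out[of p] by (cases "p \<in> ?K") auto
  moreover have "\<phi> \<in> borel_measurable (vol M)"
    unfolding borel_measurable_vol using cont by (rule borel_measurable_continuous_onI)
  ultimately show ?thesis using that K out by blast
qed

lemma test_function_integrable:
  assumes "\<phi> \<in> test_functions M S"
  shows "integrable (vol M) \<phi>" and "\<phi> \<in> L2 (vol M)"
proof -
  obtain K b where K: "compact K" "\<And>p. p \<notin> K \<Longrightarrow> \<phi> p = 0" "\<And>p. cmod (\<phi> p) \<le> b"
    "\<phi> \<in> borel_measurable (vol M)"
    using test_function_bounded[OF assms] by blast
  have Ks: "K \<in> sets (vol M)" using K(1) by (simp add: sets_vol compact_imp_closed)
  have int: "integrable (vol M) (\<lambda>p. a * indicator K p)" for a :: real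
    using Ks compact_vol_finite[OF K(1)] by (intro integrable_mult_right integrable_real_indicator) auto
  show "integrable (vol M) \<phi>"
    by (rule Bochner_Integration.integrable_bound[OF int[of b] K(4)])
      (use K(2,3) in \<open>auto simp: indicator_def order_trans[OF _ abs_ge_self]\<close>)
  show "\<phi> \<in> L2 (vol M)"
    by (rule L2_bounded[OF int[of "b\<^sup>2"] K(4)])
      (use K(2,3) in \<open>auto simp: indicator_def power_mono\<close>)
qed

lemma distr_of_restrict:
  assumes "open B" "\<phi> \<in> test_functions M B"
  shows "distr_of M v \<phi> = (LINT p|restrict_space (vol M) B. v p * \<phi> p)"
proof -
  have "(LINT p|restrict_space (vol M) B. v p * \<phi> p) = (LINT p|vol M. indicator B p *\<^sub>R (v p * \<phi> p))"
    using assms(1) by (intro integral_restrict_space) (simp add: sets_vol space_vol)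
  also have "\<dots> = distr_of M v \<phi>"
    unfolding distr_of_def using test_function_eq_0[OF assms(2)]
    by (intro Bochner_Integration.integral_cong refl) (auto simp: indicator_def)
  finally show ?thesis by simp
qed

lemma test_function_L2_restrict:
  assumes "open B" "\<phi> \<in> test_functions M S"
  shows "\<phi> \<in> L2 (restrict_space (vol M) B)"
  using test_function_integrable(2)[OF assms(2)] assms(1) by (intro L2_restrict_space) (simp_all add: sets_vol)

text \<open>
  Test functions on \<open>B\<close> vanish outside \<open>B\<close>, so all pairings can be computed in \<open>L\<^sup>2(B)\<close>.  This matters
  because the values of an element of \<open>q2 M k B\<close> outside \<open>B\<close> are arbitrary, even nonmeasurable.
\<close>

lemma q2_iff:
  assumes "open B"
  shows "v \<in> q2 M k B \<longleftrightarrow> v \<in> L2 (restrict_space (vol M) B) \<and>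
    (\<exists>c. \<forall>\<phi>\<in>test_functions M B.
      (LINT p|restrict_space (vol M) B. v p * (lap M ^^ k) \<phi> p) = c * (LINT p|vol M. \<phi> p))"
  unfolding q2_def distr_eq_on_def lap_distr_funpow
  by (simp add: distr_of_restrict[OF assms lap_funpow_test_function] distr_of_def[of M "\<lambda>p. _"])

lemma q2_linear:
  assumes B: "open B" and f: "f \<in> q2 M k B" and g: "g \<in> q2 M k B"
  shows "(\<lambda>x. f x + a * g x) \<in> q2 M k B"
proof -
  let ?N = "restrict_space (vol M) B"
  obtain c where c: "\<And>\<phi>. \<phi> \<in> test_functions M B \<Longrightarrow>
      (LINT p|?N. f p * (lap M ^^ k) \<phi> p) = c * (LINT p|vol M. \<phi> p)"
    using f unfolding q2_iff[OF B] by blast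
  obtain d where d: "\<And>\<phi>. \<phi> \<in> test_functions M B \<Longrightarrow>
      (LINT p|?N. g p * (lap M ^^ k) \<phi> p) = d * (LINT p|vol M. \<phi> p)"
    using g unfolding q2_iff[OF B] by blast
  have L: "f \<in> L2 ?N" "g \<in> L2 ?N" using f g by (simp_all add: q2_iff[OF B])
  have "(LINT p|?N. (f p + a * g p) * (lap M ^^ k) \<phi> p) = (c + a * d) * (LINT p|vol M. \<phi> p)"
    if \<phi>: "\<phi> \<in> test_functions M B" for \<phi>
  proof -
    have \<psi>: "(lap M ^^ k) \<phi> \<in> L2 ?N"
      by (rule test_function_L2_restrict[OF B lap_funpow_test_function[OF \<phi>]])
    have "(LINT p|?N. (f p + a * g p) * (lap M ^^ k) \<phi> p)
        = (LINT p|?N. f p * (lap M ^^ k) \<phi> p + a * (g p * (lap M ^^ k) \<phi> p))"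
      by (simp add: algebra_simps)
    also have "\<dots> = (LINT p|?N. f p * (lap M ^^ k) \<phi> p) + a * (LINT p|?N. g p * (lap M ^^ k) \<phi> p)"
      using L2_mult_integrable[OF L(1) \<psi>] L2_mult_integrable[OF L(2) \<psi>] by simp
    finally show ?thesis by (simp add: c[OF \<phi>] d[OF \<phi>] algebra_simps)
  qed
  then show ?thesis unfolding q2_iff[OF B] using L2_add[OF L(1) L2_cmult[OF L(2)]] by blast
qed

text \<open>
  For a fixed test function both sides of the defining equation depend continuously on the function in
  \<open>L\<^sup>2(B)\<close>; the point is that the constants \<open>c n\<close> converge too.  They can be read off from any test function
  with nonzero integral.  If there is none, both sides of the limit equation are zero.
\<close>

lemma q2_closed:
  assumes B: "open B" and q: "\<And>n :: nat. q n \<in> q2 M k B" and h: "h \<in> L2 (restrict_space (vol M) B)"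
    and lim: "(\<lambda>n. LINT x|restrict_space (vol M) B. (cmod (q n x - h x))\<^sup>2) \<longlonglongrightarrow> 0"
  shows "h \<in> q2 M k B"
proof -
  let ?N = "restrict_space (vol M) B"
  have "\<forall>n. \<exists>c. \<forall>\<phi>\<in>test_functions M B.
      (LINT p|?N. q n p * (lap M ^^ k) \<phi> p) = c * (LINT p|vol M. \<phi> p)"
    using q unfolding q2_iff[OF B] by blast
  from choice[OF this] obtain c where c: "\<And>n \<phi>. \<phi> \<in> test_functions M B \<Longrightarrow>
      (LINT p|?N. q n p * (lap M ^^ k) \<phi> p) = c n * (LINT p|vol M. \<phi> p)"
    by blast
  have qL: "q n \<in> L2 ?N" for n using q unfolding q2_iff[OF B] by blast
  have conv: "(\<lambda>n. c n * (LINT p|vol M. \<phi> p)) \<longlonglongrightarrow> (LINT p|?N. h p * (lap M ^^ k) \<phi> p)"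
    if \<phi>: "\<phi> \<in> test_functions M B" for \<phi>
    using L2_tendsto_integral_mult[OF qL h test_function_L2_restrict[OF B lap_funpow_test_function[OF \<phi>, of k]] lim]
    by (simp add: c[OF \<phi>])
  have "\<exists>C. \<forall>\<phi>\<in>test_functions M B. (LINT p|?N. h p * (lap M ^^ k) \<phi> p) = C * (LINT p|vol M. \<phi> p)"
  proof (cases "\<exists>\<phi>\<in>test_functions M B. (LINT p|vol M. \<phi> p) \<noteq> 0")
    case True
    then obtain \<phi>0 where \<phi>0: "\<phi>0 \<in> test_functions M B" "(LINT p|vol M. \<phi>0 p) \<noteq> 0" by blast
    let ?C = "(LINT p|?N. h p * (lap M ^^ k) \<phi>0 p) / (LINT p|vol M. \<phi>0 p)"
    have "c \<longlonglongrightarrow> ?C"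
      using tendsto_divide[OF conv[OF \<phi>0(1)] tendsto_const[of "LINT p|vol M. \<phi>0 p"]] \<phi>0(2) by simp
    then have "(\<lambda>n. c n * (LINT p|vol M. \<phi> p)) \<longlonglongrightarrow> ?C * (LINT p|vol M. \<phi> p)" for \<phi>
      by (intro tendsto_mult_right)
    then show ?thesis using conv LIMSEQ_unique by blast
  next
    case False
    then have "(LINT p|?N. h p * (lap M ^^ k) \<phi> p) = 0 * (LINT p|vol M. \<phi> p)"
      if "\<phi> \<in> test_functions M B" for \<phi>
      using conv[OF that] that by (simp add: LIMSEQ_const_iff)
    then show ?thesis by blast
  qed
  with h show ?thesis unfolding q2_iff[OF B] by blast
qed

lemma proj_perp_works:
  assumes B: "open B" and G: "G \<in> L2 (restrict_space (vol M) B)"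
  shows "proj_perp M k B G \<in> q2_perp M k B" "(\<lambda>p. G p - proj_perp M k B G p) \<in> q2 M k B"
proof -
  have ne: "(\<lambda>p. 0) \<in> q2 M k B"
    unfolding q2_iff[OF B] by (auto simp: L2_iff intro!: exI[of _ 0])
  have sub: "q2 M k B \<subseteq> L2 (restrict_space (vol M) B)" by (auto simp: q2_def)
  have "\<exists>w. w \<in> q2_perp M k B \<and> (\<lambda>p. G p - w p) \<in> q2 M k B"
  proof (rule L2_projection[OF sub _ _ _ G])
    show "q2 M k B \<noteq> {}" using ne by blast
    fix w
    assume "w \<in> L2 (restrict_space (vol M) B)" "(\<lambda>x. G x - w x) \<in> q2 M k B"
      "\<And>v. v \<in> q2 M k B \<Longrightarrow> (LINT x|restrict_space (vol M) B. w x * cnj (v x)) = 0"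
    then show ?thesis by (auto simp: q2_perp_def)
  qed (rule q2_linear[OF B] q2_closed[OF B]; assumption)+
  from someI_ex[OF this]
  show "proj_perp M k B G \<in> q2_perp M k B" "(\<lambda>p. G p - proj_perp M k B G p) \<in> q2 M k B"
    unfolding proj_perp_def by blast+
qed

lemma lap_L2_linear:
  assumes "lap_L2 M u f" "lap_L2 M u' f'"
  shows "lap_L2 M (\<lambda>p. u p + c * u' p) (\<lambda>p. f p + c * f' p)"
proof -
  have L: "u \<in> L2 (vol M)" "f \<in> L2 (vol M)" "u' \<in> L2 (vol M)" "f' \<in> L2 (vol M)"
    using assms by (simp_all add: lap_L2_def)
  have lin: "distr_of M (\<lambda>p. g p + c * g' p) \<psi> = distr_of M g \<psi> + c * distr_of M g' \<psi>"
    if g: "g \<in> L2 (vol M)" "g' \<in> L2 (vol M)" and \<psi>: "\<psi> \<in> test_functions M UNIV" for g g' \<psi>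
  proof -
    note int = L2_mult_integrable[OF g(1) test_function_integrable(2)[OF \<psi>]]
      L2_mult_integrable[OF g(2) test_function_integrable(2)[OF \<psi>]]
    have "distr_of M (\<lambda>p. g p + c * g' p) \<psi> = (LINT p|vol M. g p * \<psi> p + c * (g' p * \<psi> p))"
      by (simp add: distr_of_def algebra_simps)
    also have "\<dots> = distr_of M g \<psi> + c * distr_of M g' \<psi>"
      using int by (simp add: distr_of_def)
    finally show ?thesis .
  qed
  have "distr_of M u (lap M \<phi>) = distr_of M f \<phi>" "distr_of M u' (lap M \<phi>) = distr_of M f' \<phi>"
    if "\<phi> \<in> test_functions M UNIV" for \<phi>
    using assms that by (simp_all add: lap_L2_def distr_eq_on_def lap_distr_def)
  then show ?thesis
    using L by (auto simp: lap_L2_def distr_eq_on_def lap_distr_def lin lap_test_function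
        intro!: L2_add L2_cmult)
qed

end

locale riemannian_spectral_gap = riemannian M for M :: "('a::{metric_space,second_countable_topology}, 'n::finite) riem" +
  assumes gap: "spectral_bottom M > 0"
begin

lemma zero_in_resolvent_set: "0 \<in> L2_resolvent_set M"
proof (rule ccontr)
  assume "0 \<notin> L2_resolvent_set M"
  then have "complex_of_real 0 \<in> L2_spectrum M" by (simp add: L2_spectrum_def)
  then have "spectral_bottom M \<le> ereal 0" unfolding spectral_bottom_def by (intro Inf_lower) blast
  with gap show False by (simp add: zero_ereal_def)
qed

lemma lap_inv: 
  assumes "f \<in> L2 (vol M)"
  shows "lap_L2 M (lap_inv M f) f"
proof -
  have "\<exists>u. lap_L2 M u f" using zero_in_resolvent_set assms by (simp add: L2_resolvent_set_def)
  from someI_ex[OF this] show ?thesis by (simp add: lap_inv_def)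
qed

text \<open>
  The boundedness of the inverse is stated for all pairs in the graph of the operator: applied to
  differences, it also shows that solutions are unique almost everywhere.
\<close>

lemma inverse_bound: "\<exists>C :: real. \<forall>u f. lap_L2 M u f \<longrightarrow> L2_norm (vol M) u \<le> ennreal C * L2_norm (vol M) f"
proof -
  obtain C :: real where "\<forall>f\<in>L2 (vol M). \<forall>u. lap_L2 M u f \<longrightarrow> L2_norm (vol M) u \<le> ennreal C * L2_norm (vol M) f"
    using zero_in_resolvent_set by (auto simp: L2_resolvent_set_def)
  then show ?thesis by (auto simp: lap_L2_def)
qed

lemma lap_inv_funpow_L2: "f \<in> L2 (vol M) \<Longrightarrow> (lap_inv M ^^ k) f \<in> L2 (vol M)"
proof (induction k)
  case (Suc k)
  then show ?case using lap_inv[of "(lap_inv M ^^ k) f"] by (simp add: lap_L2_def)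
qed simp

lemma lap_inv_funpow_bound:
  "\<exists>C :: ennreal. C < \<infinity> \<and> (\<forall>f\<in>L2 (vol M). L2_norm (vol M) ((lap_inv M ^^ k) f) \<le> C * L2_norm (vol M) f)"
proof -
  obtain C :: real where C: "\<And>u f. lap_L2 M u f \<Longrightarrow> L2_norm (vol M) u \<le> ennreal C * L2_norm (vol M) f"
    using inverse_bound by blast
  have "L2_norm (vol M) ((lap_inv M ^^ k) f) \<le> ennreal C ^ k * L2_norm (vol M) f" if f: "f \<in> L2 (vol M)" for f
  proof (induction k)
    case (Suc k)
    have "L2_norm (vol M) ((lap_inv M ^^ Suc k) f) \<le> ennreal C * L2_norm (vol M) ((lap_inv M ^^ k) f)"
      using C[OF lap_inv[OF lap_inv_funpow_L2[OF f]]] by simp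
    also have "\<dots> \<le> ennreal C * (ennreal C ^ k * L2_norm (vol M) f)"
      by (rule mult_left_mono[OF Suc]) simp
    finally show ?case by (simp add: mult.assoc)
  qed simp
  moreover have "ennreal C ^ k < \<infinity>" by (simp add: power_less_top_ennreal)
  ultimately show ?thesis by blast
qed

text \<open>
  By induction, \<open>lap_inv M ^^ k\<close> applied to \<open>c f\<close> and \<open>c\<close> times \<open>lap_inv M ^^ k\<close> applied to \<open>f\<close> have
  distance zero in \<open>L\<^sup>2\<close>.  They need not be equal as functions, because \<open>lap_inv\<close> selects arbitrary
  representatives.
\<close>

lemma lap_inv_funpow_homogeneous:
  assumes f: "f \<in> L2 (vol M)"
  shows "L2_norm (vol M) ((lap_inv M ^^ k) (\<lambda>p. c * f p)) = ennreal (cmod c) * L2_norm (vol M) ((lap_inv M ^^ k) f)"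
proof -
  let ?d = "\<lambda>k p. (lap_inv M ^^ k) (\<lambda>p. c * f p) p + (- c) * (lap_inv M ^^ k) f p"
  note L = lap_inv_funpow_L2[OF L2_cmult[OF f]] lap_inv_funpow_L2[OF f]
  obtain C :: real where C: "\<And>u f. lap_L2 M u f \<Longrightarrow> L2_norm (vol M) u \<le> ennreal C * L2_norm (vol M) f"
    using inverse_bound by blast
  have "L2_norm (vol M) (?d k) = 0"
  proof (induction k)
    case 0
    then show ?case by (simp add: L2_norm_def enn_sqrt_def)
  next
    case (Suc k)
    have "lap_L2 M (?d (Suc k)) (?d k)"
      using lap_L2_linear[OF lap_inv[OF lap_inv_funpow_L2[OF L2_cmult[OF f, of c], of k]] lap_inv[OF L(2)[of k]], of "- c"] by simp
    from C[OF this] Suc show ?case by simp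
  qed
  then have "AE p in vol M. ?d k p = 0"
    by (subst (asm) L2_norm_0_iff) (intro L2_measurable L2_add L2_cmult L)
  then have "AE p in vol M. (lap_inv M ^^ k) (\<lambda>p. c * f p) p = c * (lap_inv M ^^ k) f p"
    by (rule eventually_mono) simp
  from L2_norm_AE_cong[OF this] show ?thesis by (simp add: L2_norm_cmult[OF L(2)])
qed

lemma opnorm_finite: "L2_opnorm (vol M) (lap_inv M ^^ k) < \<infinity>"
proof -
  obtain C :: ennreal where C: "C < \<infinity>"
    "\<And>f. f \<in> L2 (vol M) \<Longrightarrow> L2_norm (vol M) ((lap_inv M ^^ k) f) \<le> C * L2_norm (vol M) f"
    using lap_inv_funpow_bound by blast
  have "L2_opnorm (vol M) (lap_inv M ^^ k) \<le> C"
    unfolding L2_opnorm_def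
  proof (rule SUP_least)
    fix f assume f: "f \<in> {f \<in> L2 (vol M). L2_norm (vol M) f \<le> 1}"
    then have "L2_norm (vol M) ((lap_inv M ^^ k) f) \<le> C * L2_norm (vol M) f" using C(2) by simp
    also have "\<dots> \<le> C * 1" using f by (intro mult_left_mono) auto
    finally show "L2_norm (vol M) ((lap_inv M ^^ k) f) \<le> C" by simp
  qed
  with C(1) show ?thesis by (rule order.strict_trans1[rotated])
qed

text \<open>
  Rescaling to norm one.  When \<open>f\<close> has norm zero this is impossible, and the boundedness of the
  inverse is used instead.
\<close>

lemma opnorm_bound:
  assumes f: "f \<in> L2 (vol M)"
  shows "L2_norm (vol M) ((lap_inv M ^^ k) f) \<le> L2_opnorm (vol M) (lap_inv M ^^ k) * L2_norm (vol M) f"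
proof -
  define r where "r = sqrt (LINT p|vol M. (cmod (f p))\<^sup>2)"
  have nf: "L2_norm (vol M) f = ennreal r" and r: "r \<ge> 0" by (simp_all add: L2_norm_eq[OF f] r_def)
  show ?thesis
  proof (cases "r = 0")
    case True
    obtain C :: ennreal where
      "\<And>f. f \<in> L2 (vol M) \<Longrightarrow> L2_norm (vol M) ((lap_inv M ^^ k) f) \<le> C * L2_norm (vol M) f"
      using lap_inv_funpow_bound by blast
    from this[OF f] True show ?thesis by (simp add: nf)
  next
    case False
    with r have r: "r > 0" by simp
    let ?f = "\<lambda>p. of_real (1 / r) * f p"
    have "L2_norm (vol M) ?f = ennreal (cmod (of_real (1 / r))) * ennreal r"
      unfolding nf[symmetric] by (rule L2_norm_cmult[OF f])
    also have "\<dots> = 1" using r by (simp add: norm_divide flip: ennreal_mult)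
    finally have "L2_norm (vol M) ?f \<le> 1" by simp
    then have "L2_norm (vol M) ((lap_inv M ^^ k) ?f) \<le> L2_opnorm (vol M) (lap_inv M ^^ k)"
      unfolding L2_opnorm_def using L2_cmult[OF f, of "of_real (1 / r)"] by (intro SUP_upper) simp
    then have "ennreal r * (ennreal (1 / r) * L2_norm (vol M) ((lap_inv M ^^ k) f))
        \<le> ennreal r * L2_opnorm (vol M) (lap_inv M ^^ k)"
      using r unfolding lap_inv_funpow_homogeneous[OF f] by (intro mult_left_mono) (simp_all add: norm_divide)
    moreover have "ennreal r * ennreal (1 / r) = 1" using r by (simp flip: ennreal_mult)
    ultimately show ?thesis by (simp add: nf mult.commute flip: mult.assoc)
  qed
qed

lemma distr_of_lap_inv_funpow:
  assumes f: "f \<in> L2 (vol M)" and \<phi>: "\<phi> \<in> test_functions M UNIV"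
  shows "distr_of M ((lap_inv M ^^ k) f) ((lap M ^^ k) \<phi>) = distr_of M f \<phi>"
proof (induction k)
  case (Suc k)
  have "distr_of M (lap_inv M ((lap_inv M ^^ k) f)) (lap M ((lap M ^^ k) \<phi>))
      = distr_of M ((lap_inv M ^^ k) f) ((lap M ^^ k) \<phi>)"
    using lap_inv[OF lap_inv_funpow_L2[OF f, of k]] lap_funpow_test_function[OF \<phi>, of k]
    by (simp add: lap_L2_def distr_eq_on_def lap_distr_def)
  with Suc show ?case by simp
qed simp

text \<open>
  The heart of the proof: \<open>U - v\<close> is in \<open>q2 M k B\<close> for the global solution \<open>v\<close> with right-hand side
  \<open>(g - c) 1_B\<close>, so \<open>U\<close> and \<open>v\<close> have the same projection.
\<close>

lemma proj_perp_norm_le: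
  fixes g U :: "'a \<Rightarrow> complex"
  assumes B: "open B" and U: "U \<in> L2 (restrict_space (vol M) B)" and g: "g \<in> borel_measurable (vol M)"
    and eq: "distr_eq_on M B ((lap_distr M ^^ k) (distr_of M U)) (distr_of M g)"
    and fin: "(\<integral>\<^sup>+p\<in>B. ennreal ((cmod (g p - c))\<^sup>2) \<partial>vol M) < \<infinity>"
  shows "L2_norm (restrict_space (vol M) B) (proj_perp M k B U)
    \<le> L2_opnorm (vol M) (lap_inv M ^^ k) * enn_sqrt (\<integral>\<^sup>+p\<in>B. ennreal ((cmod (g p - c))\<^sup>2) \<partial>vol M)"
proof -
  let ?N = "restrict_space (vol M) B"
  have Bs: "B \<in> sets (vol M)" using B by (simp add: sets_vol)
  define f where "f p = indicator B p * (g p - c)" for p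
  have f_norm: "L2_norm (vol M) f = enn_sqrt (\<integral>\<^sup>+p\<in>B. ennreal ((cmod (g p - c))\<^sup>2) \<partial>vol M)"
    unfolding L2_norm_def f_def
    by (intro arg_cong[of _ _ enn_sqrt] nn_integral_cong) (auto simp: indicator_def)
  have f: "f \<in> L2 (vol M)"
    unfolding L2_def mem_Collect_eq f_norm enn_sqrt_less_top_iff
    using fin g Bs by (auto simp: f_def[abs_def])
  define v where "v = (lap_inv M ^^ k) f"
  have v: "v \<in> L2 (vol M)" unfolding v_def by (rule lap_inv_funpow_L2[OF f])
  have vN: "v \<in> L2 ?N" by (rule L2_restrict_space[OF v Bs])
  have "(\<lambda>p. U p + (- 1) * v p) \<in> q2 M k B"
    unfolding q2_iff[OF B]
  proof (intro conjI exI ballI)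
    show "(\<lambda>p. U p + (- 1) * v p) \<in> L2 ?N" by (intro L2_add L2_cmult U vN)
    fix \<phi> assume \<phi>: "\<phi> \<in> test_functions M B"
    let ?\<psi> = "(lap M ^^ k) \<phi>"
    have \<phi>U: "\<phi> \<in> test_functions M UNIV" using \<phi> test_functions_mono[of B UNIV M] by blast
    have \<psi>: "?\<psi> \<in> L2 ?N" by (rule test_function_L2_restrict[OF B lap_funpow_test_function[OF \<phi>]])
    have "(LINT p|?N. (U p + (- 1) * v p) * ?\<psi> p) = (LINT p|?N. U p * ?\<psi> p) - (LINT p|?N. v p * ?\<psi> p)"
      using L2_mult_integrable[OF U \<psi>] L2_mult_integrable[OF vN \<psi>] by (simp add: algebra_simps)
    also have "(LINT p|?N. U p * ?\<psi> p) = distr_of M g \<phi>"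
      using bspec[OF eq[unfolded distr_eq_on_def lap_distr_funpow] \<phi>]
      unfolding distr_of_restrict[OF B lap_funpow_test_function[OF \<phi>]] .
    also have "(LINT p|?N. v p * ?\<psi> p) = distr_of M f \<phi>"
      using distr_of_lap_inv_funpow[OF f \<phi>U, of k]
      by (simp add: v_def distr_of_restrict[OF B lap_funpow_test_function[OF \<phi>]])
    also have "distr_of M g \<phi> = (LINT p|vol M. f p * \<phi> p + c * \<phi> p)"
      unfolding distr_of_def using test_function_eq_0[OF \<phi>]
      by (intro Bochner_Integration.integral_cong refl) (auto simp: f_def indicator_def algebra_simps)
    also have "\<dots> = distr_of M f \<phi> + c * (LINT p|vol M. \<phi> p)"
      using L2_mult_integrable[OF f test_function_integrable(2)[OF \<phi>]] test_function_integrable(1)[OF \<phi>]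
      by (simp add: distr_of_def)
    finally show "(LINT p|?N. (U p + (- 1) * v p) * ?\<psi> p) = c * (LINT p|vol M. \<phi> p)" by simp
  qed
  then have "(\<lambda>p. (U p + (- 1) * v p) + (- 1) * (U p - proj_perp M k B U p)) \<in> q2 M k B"
    using proj_perp_works(2)[OF B U] by (rule q2_linear[OF B])
  then have "(\<lambda>p. proj_perp M k B U p - v p) \<in> q2 M k B" by (simp add: algebra_simps)
  from q2_perp_norm_le[OF proj_perp_works(1)[OF B U] vN this]
  have "L2_norm ?N (proj_perp M k B U) \<le> L2_norm ?N v" .
  also have "\<dots> \<le> L2_norm (vol M) v" by (rule L2_norm_restrict_le[OF Bs])
  also have "\<dots> \<le> L2_opnorm (vol M) (lap_inv M ^^ k) * L2_norm (vol M) f"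
    unfolding v_def by (rule opnorm_bound[OF f])
  finally show ?thesis by (simp add: f_norm)
qed

text \<open>
  The infimum over \<open>c\<close> need not be attained by an explicit constant here; a constant \<open>c\<close> that is optimal up to
  an error is enough, with the error scaled so that it becomes \<open>e\<close> after multiplication by the operator
  norm \<open>P\<close>.
\<close>

theorem GBMO_norm_le:
  fixes g U :: "'a \<Rightarrow> complex"
  assumes complete: "complete (UNIV :: 'a set)" and g: "g \<in> BMO s M" and U: "U \<in> L2_loc M"
    and eq: "distr_eq_on M UNIV ((lap_distr M ^^ k) (distr_of M U)) (distr_of M g)"
  shows "GBMO_norm s M k U \<le> L2_opnorm (vol M) (lap_inv M ^^ k) * BMO_norm s M g"
  unfolding GBMO_norm_def
proof (rule SUP_least)
  fix B :: "'a set" assume BB: "B \<in> balls_upto s"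
  then obtain p r where Br: "B = ball p r" by (auto simp: balls_upto_def)
  let ?N = "restrict_space (vol M) B"
  let ?X = "\<lambda>c. \<integral>\<^sup>+p\<in>B. ennreal ((cmod (g p - c))\<^sup>2) \<partial>vol M"
  let ?b = "emeasure (vol M) B"
  have B: "open B" by (simp add: Br)
  have K: "compact (cball p r)" by (rule Hopf_Rinow[OF complete])
  have BK: "B \<subseteq> cball p r" by (auto simp: Br)
  have Um: "U \<in> borel_measurable (vol M)" and "U \<in> L2 (restrict_space (vol M) (cball p r))"
    using U K by (auto simp: L2_loc_def)
  then have UB: "U \<in> L2 ?N" using B BK by (elim L2_restrict_subset) (auto simp: sets_vol)
  have gm: "g \<in> borel_measurable (vol M)" using g by (simp add: BMO_def L1_loc_def)
  have "?b \<le> emeasure (vol M) (cball p r)" by (rule emeasure_mono[OF BK]) (simp add: sets_vol)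
  also have "\<dots> < \<infinity>" by (rule compact_vol_finite[OF K])
  finally have b: "?b < \<infinity>" .
  have eqB: "distr_eq_on M B ((lap_distr M ^^ k) (distr_of M U)) (distr_of M g)"
    using eq test_functions_mono[of B UNIV M] by (auto simp: distr_eq_on_def)
  obtain P where P: "L2_opnorm (vol M) (lap_inv M ^^ k) = ennreal P" "P \<ge> 0"
    using opnorm_finite[of k] by (cases "L2_opnorm (vol M) (lap_inv M ^^ k)") auto
  obtain Q where Q: "BMO_norm s M g = ennreal Q" "Q \<ge> 0"
    using g by (cases "BMO_norm s M g") (auto simp: BMO_def)
  have inf: "(INF c. enn_sqrt (?X c / ?b)) \<le> BMO_norm s M g"
    unfolding BMO_norm_def using BB by (rule SUP_upper)
  have "L2_norm ?N (proj_perp M k B U) / enn_sqrt ?b \<le> ennreal (P * Q) + ennreal e" if e: "e > 0" for e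
  proof -
    define e' where "e' = e / (P + 1)"
    have e': "e' > 0" "P * e' \<le> e" using e P(2) by (simp_all add: e'_def field_simps)
    have "BMO_norm s M g < ennreal (Q + e')" using Q e' by (simp add: ennreal_lessI)
    with inf have "(INF c. enn_sqrt (?X c / ?b)) < ennreal (Q + e')" by (rule order.strict_trans1)
    then obtain c where c: "enn_sqrt (?X c / ?b) < ennreal (Q + e')" unfolding INF_less_iff by blast
    also have "\<dots> < \<infinity>" by simp
    finally have "?X c / ?b < \<infinity>" unfolding enn_sqrt_less_top_iff .
    then have X: "?X c < \<infinity>"
      using less_imp_neq[OF b] by (cases "?X c") (simp_all add: ennreal_top_divide)
    have "L2_norm ?N (proj_perp M k B U) / enn_sqrt ?b \<le> (ennreal P * enn_sqrt (?X c)) / enn_sqrt ?b"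
      using proj_perp_norm_le[OF B UB gm eqB X] by (intro divide_right_mono_ennreal) (simp add: P)
    also have "\<dots> = ennreal P * enn_sqrt (?X c / ?b)"
      by (simp add: enn_sqrt_divide[OF X b] ennreal_times_divide)
    also have "\<dots> \<le> ennreal P * ennreal (Q + e')" using c by (intro mult_left_mono) auto
    also have "\<dots> = ennreal (P * Q + P * e')" using P Q e' by (simp add: distrib_left flip: ennreal_mult)
    also have "\<dots> \<le> ennreal (P * Q + e)" using e' by (intro ennreal_leI) simp
    also have "\<dots> = ennreal (P * Q) + ennreal e" using P Q e by simp
    finally show ?thesis .
  qed
  then have "L2_norm ?N (proj_perp M k B U) / enn_sqrt ?b \<le> ennreal (P * Q)" by (rule ennreal_le_epsilon)
  also have "\<dots> = L2_opnorm (vol M) (lap_inv M ^^ k) * BMO_norm s M g"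
    using P Q by (simp add: ennreal_mult)
  finally show "L2_norm ?N (proj_perp M k B U) / enn_sqrt ?b
      \<le> L2_opnorm (vol M) (lap_inv M ^^ k) * BMO_norm s M g" .
qed

end

theorem proposition5p7:
  fixes M :: "('a::{metric_space,second_countable_topology}, 'n::finite) riem"
    and s0 :: real and k :: nat and g U :: "'a \<Rightarrow> complex"
  assumes "riemannian_manifold M"
    and "connected (UNIV :: 'a set)"
    and "complete (UNIV :: 'a set)"
    and "\<not> compact (UNIV :: 'a set)"
    and "emeasure (vol M) UNIV = \<infinity>"
    and "spectral_bottom M > 0"
    and "inj_radius M > 0"
    and "ricci_bounded_below M"
    and "0 < s0"
    and "inj_radius M \<noteq> \<infinity> \<Longrightarrow> ereal s0 = inj_radius M / 2"
    and "g \<in> BMO s0 M"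
    and "k > 0"
    and "U \<in> L2_loc M"
    and "distr_eq_on M UNIV ((lap_distr M ^^ k) (distr_of M U)) (distr_of M g)"
  shows "U \<in> GBMO s0 M k \<and>
    GBMO_norm s0 M k U \<le> L2_opnorm (vol M) (lap_inv M ^^ k) * BMO_norm s0 M g"
proof -
  interpret riemannian_spectral_gap M by unfold_locales fact+
  have le: "GBMO_norm s0 M k U \<le> L2_opnorm (vol M) (lap_inv M ^^ k) * BMO_norm s0 M g"
    using assms(3,11,13,14) by (rule GBMO_norm_le)
  also have "\<dots> < \<infinity>"
    using opnorm_finite[of k] assms(11) by (simp add: BMO_def ennreal_mult_less_top)
  finally have "U \<in> GBMO s0 M k" using assms(13) by (simp add: GBMO_def)
  with le show ?thesis by blast
qed

end
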